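(* Let $E$ be a uniformly convex Banach space, $1<p<\infty$, $\frac1p+\frac1q=1$, $T>0$, $I=[0,T]$. Assume: (A1) $f\colon I\times E\to E$ is a measurable family of maps (with $f(\cdot,0)\in L^p(I,E)$) satisfying $\|f(t,x)-f(t,0)\|\le\|x\|$ for all $x\in E$; (A2) $k\in L^\infty(I,L^q(0,T))$; put $C:=\|k\|_\infty$; (A3) $\Phi\colon I\times E\to E$ is a weak Carathéodory map satisfying $\|\Phi(t,u)\|_E\le G(t)\psi(\|u\|_E)$, where $G\in L^p(0,T)$, $\psi\colon[0,\infty)\to[0,\infty)$ is nondecreasing and locally bounded, and there exists $\overline{R}>\|f(\cdot,0)\|_p$ with $$\frac{\|G\|_p\,\psi(C\,\overline{R})}{\overline{R}-\|f(\cdot,0)\|_p}\le 1;$$ (A4) the operator $B\colon L^p(I,E)\to L^p(I,E)$, $B(u)(t)=f(t,u(t))-f(t,0)$, is sequentially weakly continuous; (A5) with $A\colon L^p(I,E)\to L^p(I,E)$, $A(u)(t)=f(t,0)+\Phi\left(t,\int_0^t k(t,s)u(s)\,ds\right)$, for each $u\in L^p(I,E)$ (for which the vectors $A(u)$, $B(u)$, $(A+B)(u)$ are nonzero), $$\alpha\big(A(u),(A+B)(u)\big)+\alpha\big(B(u),(A+B)(u)\big)\ge\epsilon_0(L^p(I,E)).$$ Then there exists $u\in L^p(I,E)$ solving $$u(t)=f(t,u(t))+\Phi\left(t,\int_0^t k(t,s)u(s)\,ds\right)\quad\text{for a.e. }t\in I.$$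
   Context: A map $\Phi\colon I\times E\to E$ is a weak Carathéodory map if for each fixed $x\in E$ the map $t\mapsto\Phi(t,x)$ is measurable and for almost every $t\in I$ the map $x\mapsto\Phi(t,x)$ is sequentially weakly continuous. A map is sequentially weakly continuous if it sends $u_n\rightharpoonup u$ to $Bu_n\rightharpoonup Bu$. For nonzero vectors $x,y$ of a normed space $F$, the angle is $\alpha(x,y):=\left\|\frac{x}{\|x\|}-\frac{y}{\|y\|}\right\|$. For a uniformly convex space $F$, the modulus of convexity $\delta$ is defined by $$\sup\left\{\left\|\tfrac{x+y}{2}\right\|:\|x\|=\|y\|=1,\ \|x-y\|=\varepsilon\right\}=1-\delta(\varepsilon).$$ $\epsilon_0(F)>0$ is the smallest positive number such that whenever $\epsilon_0(F)=\epsilon_1+\epsilon_2$ with $0\le\epsilon_1,\epsilon_2\le 2$, one has $\delta(\epsilon_1)+\delta(\epsilon_2)\ge 1/2$. (The space $F=L^p(I,E)$ is uniformly convex; angles and $\delta$ in (A5) are those of $L^p(I,E)$.) *)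

theory Defs
  imports "HOL-Analysis.Analysis" "HOL-Library.Function_Algebras"
begin

text \<open>Pointwise scalar multiplication, so that function spaces such as $L^p(I,E)$ are
  linear subspaces of a type of class \<^class>\<open>real_vector\<close>.\<close>

instantiation "fun" :: (type, real_vector) real_vector
begin

definition scaleR_fun :: "real \<Rightarrow> ('a \<Rightarrow> 'b) \<Rightarrow> 'a \<Rightarrow> 'b" where
  "scaleR_fun c f = (\<lambda>x. c *\<^sub>R f x)"

instance
  by standard (auto simp: scaleR_fun_def fun_eq_iff algebra_simps)

end

text \<open>A seminormed space is given by a linear subspace \<open>V\<close> of a real vector space and a seminorm
  \<open>N\<close> on it. A normed space is \<open>(UNIV, norm)\<close>. The space $L^p$ is the set of \<open>p\<close>-integrable
  functions with the \<open>p\<close>-seminorm; functions that agree almost everywhere are at distance 0, and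
  none of the notions below distinguishes elements at distance 0.\<close>

definition bounded_functional :: "'v::real_vector set \<Rightarrow> ('v \<Rightarrow> real) \<Rightarrow> ('v \<Rightarrow> real) \<Rightarrow> bool" where
  "bounded_functional V N \<phi> \<longleftrightarrow>
     (\<forall>x\<in>V. \<forall>y\<in>V. \<phi> (x + y) = \<phi> x + \<phi> y) \<and>
     (\<forall>c. \<forall>x\<in>V. \<phi> (c *\<^sub>R x) = c * \<phi> x) \<and>
     (\<exists>K. \<forall>x\<in>V. \<bar>\<phi> x\<bar> \<le> K * N x)"

definition weakly_converges ::
  "'v::real_vector set \<Rightarrow> ('v \<Rightarrow> real) \<Rightarrow> (nat \<Rightarrow> 'v) \<Rightarrow> 'v \<Rightarrow> bool" where
  "weakly_converges V N u l \<longleftrightarrow>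
     (\<forall>n. u n \<in> V) \<and> l \<in> V \<and>
     (\<forall>\<phi>. bounded_functional V N \<phi> \<longrightarrow> (\<lambda>n. \<phi> (u n)) \<longlonglongrightarrow> \<phi> l)"

definition seq_weakly_continuous ::
  "'v::real_vector set \<Rightarrow> ('v \<Rightarrow> real) \<Rightarrow> ('v \<Rightarrow> 'v) \<Rightarrow> bool" where
  "seq_weakly_continuous V N B \<longleftrightarrow>
     (\<forall>u\<in>V. B u \<in> V) \<and>
     (\<forall>u l. weakly_converges V N u l \<longrightarrow> weakly_converges V N (\<lambda>n. B (u n)) (B l))"

definition uniformly_convex :: "'v::real_vector set \<Rightarrow> ('v \<Rightarrow> real) \<Rightarrow> bool" where
  "uniformly_convex V N \<longleftrightarrow>
     (\<forall>\<epsilon>>0. \<exists>d>0. \<forall>x\<in>V. \<forall>y\<in>V.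
        N x = 1 \<longrightarrow> N y = 1 \<longrightarrow> N (x - y) \<ge> \<epsilon> \<longrightarrow> N ((x + y) /\<^sub>R 2) \<le> 1 - d)"

definition vangle :: "('v::real_vector \<Rightarrow> real) \<Rightarrow> 'v \<Rightarrow> 'v \<Rightarrow> real" where
  "vangle N x y = N (x /\<^sub>R N x - y /\<^sub>R N y)"

definition convexity_modulus :: "'v::real_vector set \<Rightarrow> ('v \<Rightarrow> real) \<Rightarrow> real \<Rightarrow> real" where
  "convexity_modulus V N \<epsilon> =
     1 - Sup {N ((x + y) /\<^sub>R 2) | x y. x \<in> V \<and> y \<in> V \<and> N x = 1 \<and> N y = 1 \<and> N (x - y) = \<epsilon>}"

definition epsilon0 :: "'v::real_vector set \<Rightarrow> ('v \<Rightarrow> real) \<Rightarrow> real" where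
  "epsilon0 V N = (LEAST e. 0 < e \<and>
     (\<forall>e1 e2. 0 \<le> e1 \<longrightarrow> e1 \<le> 2 \<longrightarrow> 0 \<le> e2 \<longrightarrow> e2 \<le> 2 \<longrightarrow> e = e1 + e2 \<longrightarrow>
        convexity_modulus V N e1 + convexity_modulus V N e2 \<ge> 1 / 2))"

text \<open>The library's Bochner theory is restricted to second countable target spaces, hence
  the following versions for arbitrary targets. Measurability is strong (Bochner) measurability:
  almost everywhere a limit of simple functions.\<close>

definition strongly_measurable ::
  "'a measure \<Rightarrow> 'v::real_vector set \<Rightarrow> ('v \<Rightarrow> real) \<Rightarrow> ('a \<Rightarrow> 'v) \<Rightarrow> bool" where
  "strongly_measurable M V N f \<longleftrightarrow>
     (AE t in M. f t \<in> V) \<and>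
     (\<exists>s. (\<forall>n::nat. simple_function M (s n) \<and> s n ` space M \<subseteq> V) \<and>
          (AE t in M. (\<lambda>n. N (s n t - f t)) \<longlonglongrightarrow> 0))"

definition has_Bochner_integral :: "'a measure \<Rightarrow> ('a \<Rightarrow> 'b::banach) \<Rightarrow> 'b \<Rightarrow> bool" where
  "has_Bochner_integral M f x \<longleftrightarrow>
     strongly_measurable M UNIV norm f \<and>
     (\<exists>s. (\<forall>n::nat. Bochner_Integration.simple_bochner_integrable M (s n)) \<and>
          (\<lambda>n. \<integral>\<^sup>+ t. ennreal (norm (f t - s n t)) \<partial>M) \<longlonglongrightarrow> 0 \<and>
          (\<lambda>n. Bochner_Integration.simple_bochner_integral M (s n)) \<longlonglongrightarrow> x)"

definition Bochner_integral :: "'a measure \<Rightarrow> ('a \<Rightarrow> 'b::banach) \<Rightarrow> 'b" where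
  "Bochner_integral M f =
     (if \<exists>x. has_Bochner_integral M f x then THE x. has_Bochner_integral M f x else 0)"

definition Lp_space :: "'a measure \<Rightarrow> real \<Rightarrow> ('a \<Rightarrow> 'b::banach) set" where
  "Lp_space M p =
     {u. strongly_measurable M UNIV norm u \<and> integrable M (\<lambda>t. norm (u t) powr p)}"

definition Lp_norm :: "'a measure \<Rightarrow> real \<Rightarrow> ('a \<Rightarrow> 'b::banach) \<Rightarrow> real" where
  "Lp_norm M p u = (\<integral>t. norm (u t) powr p \<partial>M) powr (1 / p)"

text \<open>$L^\infty$ with values in the seminormed space \<open>(V, N)\<close>.\<close>

definition Linf_space ::
  "'a measure \<Rightarrow> 'v::real_vector set \<Rightarrow> ('v \<Rightarrow> real) \<Rightarrow> ('a \<Rightarrow> 'v) set" where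
  "Linf_space M V N = {k. strongly_measurable M V N k \<and> (\<exists>c. AE t in M. N (k t) \<le> c)}"

definition Linf_norm :: "'a measure \<Rightarrow> ('v \<Rightarrow> real) \<Rightarrow> ('a \<Rightarrow> 'v) \<Rightarrow> real" where
  "Linf_norm M N k = Inf {c. 0 \<le> c \<and> (AE t in M. N (k t) \<le> c)}"

definition weak_Caratheodory :: "real measure \<Rightarrow> (real \<Rightarrow> 'b::banach \<Rightarrow> 'b) \<Rightarrow> bool" where
  "weak_Caratheodory M \<Phi> \<longleftrightarrow>
     (\<forall>x. strongly_measurable M UNIV norm (\<lambda>t. \<Phi> t x)) \<and>
     (AE t in M. seq_weakly_continuous UNIV norm (\<Phi> t))"

definition locally_bounded_on :: "real set \<Rightarrow> (real \<Rightarrow> real) \<Rightarrow> bool" where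
  "locally_bounded_on S \<psi> \<longleftrightarrow> (\<forall>r\<in>S. \<exists>e>0. bounded (\<psi> ` (S \<inter> ball r e)))"

definition Volterra :: "(real \<Rightarrow> real \<Rightarrow> real) \<Rightarrow> (real \<Rightarrow> 'b::banach) \<Rightarrow> real \<Rightarrow> 'b" where
  "Volterra k u t = Bochner_integral (lebesgue_on {0..t}) (\<lambda>s. k t s *\<^sub>R u s)"

definition opA ::
  "(real \<Rightarrow> 'b \<Rightarrow> 'b) \<Rightarrow> (real \<Rightarrow> 'b \<Rightarrow> 'b) \<Rightarrow> (real \<Rightarrow> real \<Rightarrow> real) \<Rightarrow>
     (real \<Rightarrow> 'b::banach) \<Rightarrow> real \<Rightarrow> 'b" where
  "opA f \<Phi> k u = (\<lambda>t. f t 0 + \<Phi> t (Volterra k u t))"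

definition opB :: "(real \<Rightarrow> 'b \<Rightarrow> 'b) \<Rightarrow> (real \<Rightarrow> 'b::banach) \<Rightarrow> real \<Rightarrow> 'b" where
  "opB f u = (\<lambda>t. f t (u t) - f t 0)"

end

theory Submission
  imports Defs
begin

text \<open>
  In the uniformly convex space \<open>X = L\<^sup>p(I,E)\<close> the angle condition keeps the sum \<open>S = A + B\<close> inside the
  ball of radius \<open>R\<close>: if \<open>j\<close> is a norming functional of \<open>Au + Bu\<close>, then \<open>j\<close> takes at most the value
  \<open>1 - 2 \<delta>(\<alpha>)\<close> on a unit vector at angle \<open>\<alpha>\<close> to \<open>Au + Bu\<close>, so that
  \<open>\<parallel>Au + Bu\<parallel> \<le> R (2 - 2 (\<delta>(\<alpha>\<^sub>1) + \<delta>(\<alpha>\<^sub>2))) \<le> R\<close>.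

  The map \<open>S\<close> is sequentially weakly continuous on the ball. For \<open>A\<close> no duality of \<open>L\<^sup>p(I,E)\<close> is needed:
  in a uniformly convex space nested bounded convex sets have a common limit point, so every bounded
  sequence has a strong limit of convex combinations of its tails; passing to a subsequence that
  converges almost everywhere identifies this limit with the pointwise weak limit.

  Brouwer's theorem, on the convex combinations of a finite net, gives points that \<open>S\<close> moves little
  as seen by finitely many functionals. Such points, collected in a countable set whose norming
  functionals identify weak limits, converge weakly to a fixed point along a subsequence.
\<close>

section \<open>Auxiliary facts about real sequences\<close>

text \<open>Two obstacles shape the proof. The first is \<open>epsilon0\<close>: it is a
  \<open>LEAST\<close> over the reals, and its condition concerns splittings whose sum is exactly
  this number, while the angle hypothesis is an inequality. So the minimum must be attained, and the
  modulus of convexity must be monotone and right continuous. The definition of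
  \<open>convexity_modulus\<close> does not show this: its pairs of unit vectors are at distance
  exactly \<epsilon>, and a one-dimensional space has no such pair for 0 < \<epsilon> < 2. In L^p of
  an interval such pairs can be produced and modified by rearranging functions. The second is
  measurability: \<Phi> t is only weakly continuous, so strong measurability of
  \<open>\<Phi> t (Volterra k u t)\<close> does not follow from strong pointwise limits. It comes
  out together with membership in L^p, from the limits of convex combinations. Uniform convexity of
  E enters as an inequality that is linear in p-th powers of norms and therefore survives
  integration. As L^p is not divided by the null functions, all functional analysis is done for a
  seminorm on a subspace.\<close>

lemma coordinatewise_convergent_subsequence:
  fixes a :: "nat \<Rightarrow> 'i::countable \<Rightarrow> real"
  assumes "\<And>n j. \<bar>a n j\<bar> \<le> b j"
  shows "\<exists>l r. strict_mono r \<and> (\<forall>j. (\<lambda>n. a (r n) j) \<longlonglongrightarrow> l j) \<and> (\<forall>j. \<bar>l j\<bar> \<le> b j)"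
proof -
  \<comment> \<open>Countability of the index type makes the product first countable, so compactness
    of the product of intervals yields convergent subsequences; this replaces a diagonal argument.
    The index types used below are \<open>unit\<close>, \<open>bool\<close> and
    \<open>nat\<close>.\<close>
  let ?K = "PiE UNIV (\<lambda>j. {- b j..b j})"
  have "compactin (product_topology (\<lambda>_. euclidean) UNIV) ?K"
    by (subst compactin_PiE) auto
  then have "compact ?K"
    by (simp add: euclidean_product_topology)
  then have "seq_compact ?K"
    by (rule compact_imp_seq_compact)
  moreover have "\<forall>n. a n \<in> ?K"
    using assms by (auto simp: abs_le_iff minus_le_iff)
  ultimately obtain l r where l: "l \<in> ?K" "strict_mono r" "(a \<circ> r) \<longlonglongrightarrow> l"
    by (rule seq_compactE)
  have "(\<lambda>n. (a \<circ> r) n j) \<longlonglongrightarrow> l j" for j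
  proof -
    have "continuous_on UNIV (\<lambda>x :: 'i \<Rightarrow> real. x j)"
      by simp
    then have "isCont (\<lambda>x :: 'i \<Rightarrow> real. x j) l"
      by (simp only: continuous_on_eq_continuous_at[OF open_UNIV] UNIV_I ball_simps)
    then show ?thesis
      by (rule isCont_tendsto_compose) (rule l)
  qed
  then show ?thesis
    using l by (auto simp: abs_le_iff minus_le_iff PiE_iff intro!: exI[of _ l] exI[of _ r])
qed

text \<open>Some neighbourhood of l is left infinitely often; boundedness gives a convergent
  subsequence of the terms outside it, whose limit stays away from l. Convergence can thus be proved
  by inspecting the limits of subsequences.\<close>

lemma not_tendsto_subsequence:
  fixes X :: "nat \<Rightarrow> real"
  assumes "\<not> X \<longlonglongrightarrow> l" and "\<And>n. \<bar>X n\<bar> \<le> b"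
  shows "\<exists>r c. strict_mono r \<and> (\<lambda>n. X (r n)) \<longlonglongrightarrow> c \<and> c \<noteq> l"
proof -
  from assms(1) obtain e where e: "e > 0" "\<not> (\<forall>\<^sub>F n in sequentially. dist (X n) l < e)"
    by (auto simp: tendsto_iff)
  then have "\<exists>\<^sub>\<infinity>n. \<not> dist (X n) l < e"
    by (simp add: not_eventually cofinite_eq_sequentially)
  then have inf: "infinite {n. \<not> dist (X n) l < e}"
    by (simp add: frequently_cofinite)
  define s where "s = enumerate {n. \<not> dist (X n) l < e}"
  have s: "strict_mono s" "\<And>n. \<not> dist (X (s n)) l < e"
    using strict_mono_enumerate[OF inf] enumerate_in_set[OF inf] by (auto simp: s_def)
  obtain L r where r: "strict_mono r" "(\<lambda>n. X (s (r n))) \<longlonglongrightarrow> L ()"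
    using coordinatewise_convergent_subsequence[where a = "\<lambda>n (_::unit). X (s n)" and b = "\<lambda>_. b"] assms(2) by auto
  have "L () \<noteq> l"
  proof
    assume "L () = l"
    then have "\<forall>\<^sub>F n in sequentially. dist (X (s (r n))) l < e"
      using r(2) e(1) by (auto simp: tendsto_iff)
    then show False
      using s(2) by (auto simp: eventually_sequentially)
  qed
  with r s(1) show ?thesis
    by (intro exI[of _ "s \<circ> r"] exI[of _ "L ()"]) (auto intro: strict_mono_o)
qed

section \<open>Brouwer's theorem on cubes of arbitrary dimension\<close>

text \<open>The dimension is a variable because it will be the size of a finite net, which depends
  on the functionals and on the precision. The argument is Kuhn's: label the points of ever finer
  grids, find a cell that carries both labels in every coordinate, and let the cells shrink. Only
  coordinates below n count.\<close>

lemma brouwer_nat_cube: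
  fixes F :: "(nat \<Rightarrow> real) \<Rightarrow> nat \<Rightarrow> real"
  assumes range: "\<And>x i. \<forall>j<n. 0 \<le> x j \<and> x j \<le> 1 \<Longrightarrow> i < n \<Longrightarrow> 0 \<le> F x i \<and> F x i \<le> 1"
    and cont: "\<And>X x i. \<forall>k. \<forall>j<n. 0 \<le> X k j \<and> X k j \<le> 1 \<Longrightarrow> \<forall>j<n. 0 \<le> x j \<and> x j \<le> 1 \<Longrightarrow>
       \<forall>j<n. (\<lambda>k. X k j) \<longlonglongrightarrow> x j \<Longrightarrow> i < n \<Longrightarrow> (\<lambda>k. F (X k) i) \<longlonglongrightarrow> F x i"
  shows "\<exists>x. (\<forall>j<n. 0 \<le> x j \<and> x j \<le> 1) \<and> (\<forall>i<n. F x i = x i)"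
proof -
  define pt where "pt p r = (\<lambda>i. real (r i) / real (Suc p))" for p and r :: "nat \<Rightarrow> nat"
  \<comment> \<open>Label 0 stands for a coordinate that F does not decrease, label 1 for one that
    it does not increase. The first two cases impose the labels that the combinatorial lemma
    requires on opposite faces; they agree with this meaning because F stays in the cube.\<close>
  define label where "label p r i = (if r i = Suc p then 1 else if r i = 0 then 0
      else if F (pt p r) i \<ge> pt p r i then 0 else (1::nat))" for p r i
  have pt01: "\<forall>j<n. 0 \<le> pt p r j \<and> pt p r j \<le> 1" if "\<forall>j<n. r j \<le> Suc p" for p r
    using that by (auto simp: pt_def divide_le_eq)
  have lab0: "F (pt p r) i \<ge> pt p r i" if "\<forall>j<n. r j \<le> Suc p" "i < n" "label p r i = 0" for p r i
    using that range[OF pt01[OF that(1)] that(2)]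
    by (auto simp: label_def split: if_splits) (auto simp: pt_def)
  have lab1: "F (pt p r) i \<le> pt p r i" if "\<forall>j<n. r j \<le> Suc p" "i < n" "label p r i \<noteq> 0" for p r i
    using that range[OF pt01[OF that(1)] that(2)]
    by (auto simp: label_def split: if_splits) (auto simp: pt_def)
  \<comment> \<open>Here q is the lower corner of a cell, and for each coordinate i the vertices
    \<open>r i\<close> and \<open>s i\<close> of this cell carry the two different labels in
    coordinate i.\<close>
  define Q where "Q p q r s \<longleftrightarrow> (\<forall>i<n. q i < Suc p) \<and> (\<forall>i<n. (\<forall>j<n. q j \<le> r i j \<and> r i j \<le> q j + 1) \<and>
      (\<forall>j<n. q j \<le> s i j \<and> s i j \<le> q j + 1) \<and> label p (r i) i = 0 \<and> label p (s i) i \<noteq> 0)" for p q r s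
  have "\<exists>q r s. Q p q r s" for p
  proof -
    obtain q where q: "\<forall>i<n. q i < Suc p"
      "\<forall>i<n. \<exists>r s. (\<forall>j<n. q j \<le> r j \<and> r j \<le> q j + 1) \<and> (\<forall>j<n. q j \<le> s j \<and> s j \<le> q j + 1) \<and>
         label p r i \<noteq> label p s i"
      by (rule kuhn_lemma[of "Suc p" n "label p"]) (auto simp: label_def)
    have "\<exists>r s. (\<forall>j<n. q j \<le> r j \<and> r j \<le> q j + 1) \<and> (\<forall>j<n. q j \<le> s j \<and> s j \<le> q j + 1) \<and>
         label p r i = 0 \<and> label p s i \<noteq> 0" if "i < n" for i
    proof -
      from q(2) that obtain r s where rs: "\<forall>j<n. q j \<le> r j \<and> r j \<le> q j + 1"
        "\<forall>j<n. q j \<le> s j \<and> s j \<le> q j + 1" "label p r i \<noteq> label p s i"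
        by blast
      show ?thesis
      proof (cases "label p r i = 0")
        case True
        with rs show ?thesis by auto
      next
        case False
        with rs have "label p s i = 0"
          by (auto simp: label_def split: if_splits)
        with rs False show ?thesis by blast
      qed
    qed
    then obtain r s where "\<forall>i<n. (\<forall>j<n. q j \<le> r i j \<and> r i j \<le> q j + 1) \<and>
      (\<forall>j<n. q j \<le> s i j \<and> s i j \<le> q j + 1) \<and> label p (r i) i = 0 \<and> label p (s i) i \<noteq> 0"
      by metis
    with q(1) show ?thesis unfolding Q_def by blast
  qed
  then obtain q r s where Q: "\<And>p. Q p (q p) (r p) (s p)"
    by metis
  then have q: "\<And>p i. i < n \<Longrightarrow> q p i < Suc p"
    and r: "\<And>p i j. i < n \<Longrightarrow> j < n \<Longrightarrow> q p j \<le> r p i j \<and> r p i j \<le> q p j + 1"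
    and s: "\<And>p i j. i < n \<Longrightarrow> j < n \<Longrightarrow> q p j \<le> s p i j \<and> s p i j \<le> q p j + 1"
    and l0: "\<And>p i. i < n \<Longrightarrow> label p (r p i) i = 0" and l1: "\<And>p i. i < n \<Longrightarrow> label p (s p i) i \<noteq> 0"
    unfolding Q_def by blast+
  have bd: "\<bar>if j < n then pt k (q k) j else 0\<bar> \<le> 1" for k j
    using q[of j k] by (auto simp: pt_def divide_le_eq less_imp_le)
  obtain x t where t: "strict_mono t" and x: "\<And>j. (\<lambda>k. if j < n then pt (t k) (q (t k)) j else 0) \<longlonglongrightarrow> x j"
    using coordinatewise_convergent_subsequence[where a = "\<lambda>k j. if j < n then pt k (q k) j else 0" and b = "\<lambda>_. 1", OF bd]
    by blast
  have x': "(\<lambda>k. pt (t k) (q (t k)) j) \<longlonglongrightarrow> x j" if "j < n" for j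
    using x[of j] that by simp
  \<comment> \<open>Vertices of a cell differ from its corner by at most the mesh width in each
    coordinate, so all of them have the same limit.\<close>
  have near: "(\<lambda>k. pt (t k) (v k) j) \<longlonglongrightarrow> x j"
    if "j < n" "\<And>k. q (t k) j \<le> v k j \<and> v k j \<le> q (t k) j + 1" for v j
  proof (rule tendsto_sandwich[OF _ _ x'[OF that(1)]])
    have "(\<lambda>k. 1 / real (Suc (t k))) \<longlonglongrightarrow> 0"
      using LIMSEQ_subseq_LIMSEQ[OF LIMSEQ_inverse_real_of_nat t]
      by (simp add: o_def inverse_eq_divide)
    from tendsto_add[OF x'[OF that(1)] this]
    show "(\<lambda>k. pt (t k) (q (t k)) j + 1 / real (Suc (t k))) \<longlonglongrightarrow> x j" by simp
    show "\<forall>\<^sub>F k in sequentially. pt (t k) (v k) j \<le> pt (t k) (q (t k)) j + 1 / real (Suc (t k))"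
    proof (intro always_eventually allI)
      fix k
      have "real (v k j) \<le> real (q (t k) j) + 1"
        using that(2)[of k] by linarith
      then show "pt (t k) (v k) j \<le> pt (t k) (q (t k)) j + 1 / real (Suc (t k))"
        by (simp add: pt_def add_divide_distrib[symmetric] divide_right_mono)
    qed
    show "\<forall>\<^sub>F k in sequentially. pt (t k) (q (t k)) j \<le> pt (t k) (v k) j"
      using that(2) by (intro always_eventually) (auto simp: pt_def divide_right_mono)
  qed
  have x01: "\<forall>j<n. 0 \<le> x j \<and> x j \<le> 1"
  proof (intro allI impI conjI)
    fix j assume "j < n"
    have "\<And>k. 0 \<le> pt (t k) (q (t k)) j \<and> pt (t k) (q (t k)) j \<le> 1"
      using bd[of j] \<open>j < n\<close> by (auto simp: pt_def)
    then show "0 \<le> x j" "x j \<le> 1"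
      using LIMSEQ_le_const[OF x'[OF \<open>j < n\<close>]] LIMSEQ_le_const2[OF x'[OF \<open>j < n\<close>]] by auto
  qed
  have "F x i = x i" if "i < n" for i
  proof (rule antisym)
    have rS: "\<forall>j<n. r (t k) i j \<le> Suc (t k)" and sS: "\<forall>j<n. s (t k) i j \<le> Suc (t k)" for k
      using r[OF that, of _ "t k"] s[OF that, of _ "t k"] q[of _ "t k"] by fastforce+
    have "(\<lambda>k. F (pt (t k) (r (t k) i)) i) \<longlonglongrightarrow> F x i" "(\<lambda>k. F (pt (t k) (s (t k) i)) i) \<longlonglongrightarrow> F x i"
      using that r s rS sS by (intro cont allI x01 pt01; auto intro!: near x01 pt01)+
    moreover have "(\<lambda>k. pt (t k) (r (t k) i) i) \<longlonglongrightarrow> x i" "(\<lambda>k. pt (t k) (s (t k) i) i) \<longlonglongrightarrow> x i"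
      using that r s by (auto intro!: near)
    ultimately show "x i \<le> F x i" "F x i \<le> x i"
      using lab0[OF rS that l0[OF that]] lab1[OF sS that l1[OF that]] by (auto intro: LIMSEQ_le)
  qed
  with x01 show ?thesis by blast
qed


section \<open>Seminormed spaces\<close>

locale seminormed_space =
  fixes V :: "'v::real_vector set" and N :: "'v \<Rightarrow> real"
  assumes subspace: "subspace V"
    and scale: "x \<in> V \<Longrightarrow> N (c *\<^sub>R x) = \<bar>c\<bar> * N x"
    and triangle: "x \<in> V \<Longrightarrow> y \<in> V \<Longrightarrow> N (x + y) \<le> N x + N y"
begin

lemma in_V [simp, intro]:
  "0 \<in> V" "x \<in> V \<Longrightarrow> y \<in> V \<Longrightarrow> x + y \<in> V" "x \<in> V \<Longrightarrow> c *\<^sub>R x \<in> V"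
  "x \<in> V \<Longrightarrow> y \<in> V \<Longrightarrow> x - y \<in> V" "x \<in> V \<Longrightarrow> - x \<in> V"
  using subspace by (auto simp: subspace_def intro: subspace_diff subspace_neg)

lemma in_V_sum [intro]: "(\<And>i. i \<in> I \<Longrightarrow> x i \<in> V) \<Longrightarrow> (\<Sum>i\<in>I. x i) \<in> V"
  by (rule subspace_sum[OF subspace])

lemma N_zero [simp]: "N 0 = 0"
  using scale[of 0 0] by simp

lemma N_minus: "x \<in> V \<Longrightarrow> N (- x) = N x"
  using scale[of x "-1"] by simp

lemma N_nonneg: "x \<in> V \<Longrightarrow> 0 \<le> N x"
  using triangle[of x "- x"] N_minus[of x] by simp

lemma N_diff: "x \<in> V \<Longrightarrow> y \<in> V \<Longrightarrow> N (x - y) \<le> N x + N y"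
  using triangle[of x "- y"] N_minus[of y] by simp

lemma N_commute: "x \<in> V \<Longrightarrow> y \<in> V \<Longrightarrow> N (x - y) = N (y - x)"
  using N_minus[of "x - y"] by simp

lemma N_triangle_sub: "x \<in> V \<Longrightarrow> y \<in> V \<Longrightarrow> z \<in> V \<Longrightarrow> N (x - z) \<le> N (x - y) + N (y - z)"
  using triangle[of "x - y" "y - z"] by simp

lemma N_le_diff: "x \<in> V \<Longrightarrow> y \<in> V \<Longrightarrow> N x \<le> N y + N (x - y)"
  using triangle[of y "x - y"] by simp

lemma N_sum: "(\<And>i. i \<in> I \<Longrightarrow> x i \<in> V) \<Longrightarrow> N (\<Sum>i\<in>I. x i) \<le> (\<Sum>i\<in>I. N (x i))"
proof (induction I rule: infinite_finite_induct)
  case (insert i I)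
  then have "N (x i + (\<Sum>i\<in>I. x i)) \<le> N (x i) + N (\<Sum>i\<in>I. x i)"
    by (intro triangle) auto
  with insert show ?case by force
qed auto

lemma bf_add: "bounded_functional V N \<phi> \<Longrightarrow> x \<in> V \<Longrightarrow> y \<in> V \<Longrightarrow> \<phi> (x + y) = \<phi> x + \<phi> y"
  and bf_scale: "bounded_functional V N \<phi> \<Longrightarrow> x \<in> V \<Longrightarrow> \<phi> (c *\<^sub>R x) = c * \<phi> x"
  unfolding bounded_functional_def by blast+

lemma bf_zero: "bounded_functional V N \<phi> \<Longrightarrow> \<phi> 0 = 0"
  using bf_scale[of \<phi> 0 0] by simp

lemma bf_diff: "bounded_functional V N \<phi> \<Longrightarrow> x \<in> V \<Longrightarrow> y \<in> V \<Longrightarrow> \<phi> (x - y) = \<phi> x - \<phi> y"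
  using bf_add[of \<phi> x "-1 *\<^sub>R y"] bf_scale[of \<phi> y "-1"] by simp

lemma bf_sum: "bounded_functional V N \<phi> \<Longrightarrow> (\<And>i. i \<in> I \<Longrightarrow> x i \<in> V) \<Longrightarrow>
    \<phi> (\<Sum>i\<in>I. x i) = (\<Sum>i\<in>I. \<phi> (x i))"
proof (induction I rule: infinite_finite_induct)
  case (insert i I)
  have "\<phi> (x i + (\<Sum>i\<in>I. x i)) = \<phi> (x i) + \<phi> (\<Sum>i\<in>I. x i)"
    using insert.prems by (intro bf_add in_V_sum) auto
  with insert show ?case by simp
qed (simp_all add: bf_zero)

lemma bf_bound:
  assumes "bounded_functional V N \<phi>"
  obtains K where "K \<ge> 0" "\<And>x. x \<in> V \<Longrightarrow> \<bar>\<phi> x\<bar> \<le> K * N x"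
proof -
  obtain K where K: "\<And>x. x \<in> V \<Longrightarrow> \<bar>\<phi> x\<bar> \<le> K * N x"
    using assms unfolding bounded_functional_def by blast
  have "\<bar>\<phi> x\<bar> \<le> \<bar>K\<bar> * N x" if "x \<in> V" for x
    using K[OF that] mult_right_mono[OF abs_ge_self N_nonneg[OF that], of K] by simp
  then show thesis by (intro that[of "\<bar>K\<bar>"]) auto
qed

text \<open>Boundedness by a multiple of N is what makes functionals blind to null elements; this
  stands in for passing to equivalence classes.\<close>

lemma bf_eq: "bounded_functional V N \<phi> \<Longrightarrow> x \<in> V \<Longrightarrow> y \<in> V \<Longrightarrow> N (x - y) = 0 \<Longrightarrow> \<phi> x = \<phi> y"
proof -
  assume \<phi>: "bounded_functional V N \<phi>" and x: "x \<in> V" "y \<in> V" "N (x - y) = 0"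
  obtain K where K: "\<And>x. x \<in> V \<Longrightarrow> \<bar>\<phi> x\<bar> \<le> K * N x"
    using \<phi> bf_bound by blast
  from K[of "x - y"] x show "\<phi> x = \<phi> y"
    by (simp add: bf_diff[OF \<phi>])
qed

lemma bf_tendsto:
  assumes \<phi>: "bounded_functional V N \<phi>" and x: "\<And>n. x n \<in> V" "g \<in> V"
    and lim: "(\<lambda>n. N (x n - g)) \<longlonglongrightarrow> 0"
  shows "(\<lambda>n. \<phi> (x n)) \<longlonglongrightarrow> \<phi> g"
proof -
  obtain K where K: "\<And>x. x \<in> V \<Longrightarrow> \<bar>\<phi> x\<bar> \<le> K * N x"
    using \<phi> bf_bound by blast
  have "(\<lambda>n. \<phi> (x n) - \<phi> g) \<longlonglongrightarrow> 0"
  proof (rule Lim_null_comparison)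
    show "\<forall>\<^sub>F n in sequentially. norm (\<phi> (x n) - \<phi> g) \<le> K * N (x n - g)"
      using K x \<phi> by (auto intro!: always_eventually simp flip: bf_diff)
    show "(\<lambda>n. K * N (x n - g)) \<longlonglongrightarrow> 0"
      using tendsto_mult[OF tendsto_const[of K] lim] by simp
  qed
  then show ?thesis by (rule LIM_zero_cancel)
qed

lemma weakly_converges_strong:
  assumes "\<And>n. x n \<in> V" "g \<in> V" "(\<lambda>n. N (x n - g)) \<longlonglongrightarrow> 0"
  shows "weakly_converges V N x g"
  unfolding weakly_converges_def using bf_tendsto[OF _ assms] assms(1,2) by blast

section \<open>The Hahn-Banach theorem for a seminorm on a subspace\<close>

definition sublinear :: "('v \<Rightarrow> real) \<Rightarrow> bool" where
  "sublinear q \<longleftrightarrow> (\<forall>x\<in>V. \<forall>y\<in>V. q (x + y) \<le> q x + q y) \<and>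
     (\<forall>x\<in>V. \<forall>c>0. q (c *\<^sub>R x) = c * q x) \<and> (\<forall>x. x \<notin> V \<longrightarrow> q x = 0)"

lemma sublinear_zero: "sublinear q \<Longrightarrow> q 0 = 0"
proof -
  assume "sublinear q"
  then have "q (2 *\<^sub>R 0) = 2 * q 0"
    unfolding sublinear_def using in_V(1) by (meson zero_less_numeral)
  then show ?thesis by simp
qed

text \<open>The auxiliary functional of the Hahn-Banach proof by minimality. Taking t = 0 shows that
  it is at most q, and t = 1 that its value at x is at most \<open>q (x + y) - q y\<close>. If
  sliding leaves q unchanged, the second bound is superadditivity of q; at x = -y the bound is -q
  y.\<close>

definition slide :: "'v \<Rightarrow> ('v \<Rightarrow> real) \<Rightarrow> 'v \<Rightarrow> real" where
  "slide y q x = (if x \<in> V then INF t\<in>{0..}. q (x + t *\<^sub>R y) - t * q y else 0)"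

text \<open>Subadditivity for ty = (x + ty) + (-x). The bound is independent of t, so the infimum in
  \<open>slide\<close> is a genuine one.\<close>

lemma slide_bdd:
  assumes q: "sublinear q" and "x \<in> V" "y \<in> V" "t \<ge> 0"
  shows "- q (- x) \<le> q (x + t *\<^sub>R y) - t * q y"
proof -
  have "q ((x + t *\<^sub>R y) + (- x)) \<le> q (x + t *\<^sub>R y) + q (- x)"
    using q in_V(2)[OF assms(2) in_V(3)[OF assms(3), of t]] in_V(5)[OF assms(2)] unfolding sublinear_def by blast
  moreover have "q (t *\<^sub>R y) = t * q y"
    using assms sublinear_zero[OF q] unfolding sublinear_def by (cases "t = 0") auto
  ultimately show ?thesis by (simp add: add.commute)
qed

lemma slide_le:
  assumes q: "sublinear q" and "x \<in> V" "y \<in> V" "t \<ge> 0"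
  shows "slide y q x \<le> q (x + t *\<^sub>R y) - t * q y"
proof -
  have "bdd_below ((\<lambda>t. q (x + t *\<^sub>R y) - t * q y) ` {0..})"
    using slide_bdd[OF q assms(2,3)] by (auto intro!: bdd_belowI)
  then show ?thesis
    using assms unfolding slide_def by (auto intro!: cINF_lower)
qed

lemma sublinear_slide:
  assumes q: "sublinear q" and y: "y \<in> V"
  shows "sublinear (slide y q)"
  unfolding sublinear_def
proof (intro conjI ballI allI impI)
  fix x z assume xz: "x \<in> V" "z \<in> V"
  show "slide y q (x + z) \<le> slide y q x + slide y q z"
  proof (rule field_le_epsilon)
    fix e :: real assume e: "e > 0"
    obtain t where t: "t \<ge> 0" "q (x + t *\<^sub>R y) - t * q y < slide y q x + e / 2"
      using cInf_lessD[of "(\<lambda>t. q (x + t *\<^sub>R y) - t * q y) ` {0..}" "slide y q x + e / 2"] e xz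
      by (auto simp: slide_def)
    obtain s where s: "s \<ge> 0" "q (z + s *\<^sub>R y) - s * q y < slide y q z + e / 2"
      using cInf_lessD[of "(\<lambda>t. q (z + t *\<^sub>R y) - t * q y) ` {0..}" "slide y q z + e / 2"] e xz
      by (auto simp: slide_def)
    have "q ((x + t *\<^sub>R y) + (z + s *\<^sub>R y)) \<le> q (x + t *\<^sub>R y) + q (z + s *\<^sub>R y)"
      using q xz y unfolding sublinear_def by auto
    moreover have "(x + t *\<^sub>R y) + (z + s *\<^sub>R y) = x + z + (t + s) *\<^sub>R y"
      by (simp add: algebra_simps)
    moreover have "slide y q (x + z) \<le> q (x + z + (t + s) *\<^sub>R y) - (t + s) * q y"
      using xz y s t by (intro slide_le[OF q]) auto
    ultimately show "slide y q (x + z) \<le> slide y q x + slide y q z + e"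
      using s t by (simp add: algebra_simps)
  qed
next
  \<comment> \<open>Replacing t by t/c gives one inequality of homogeneity; applying it to
    \<open>c *\<^sub>R x\<close> with the factor 1/c gives the other.\<close>
  have le: "c * slide y q x \<le> slide y q (c *\<^sub>R x)" if x: "x \<in> V" and c: "c > 0" for x c
  proof -
    have "c * slide y q x \<le> q (c *\<^sub>R x + t *\<^sub>R y) - t * q y" if "t \<ge> 0" for t
    proof -
      have "q (c *\<^sub>R (x + (t / c) *\<^sub>R y)) = c * q (x + (t / c) *\<^sub>R y)"
        using q x y c unfolding sublinear_def by auto
      moreover have "slide y q x \<le> q (x + (t / c) *\<^sub>R y) - (t / c) * q y"
        using that c x y by (intro slide_le[OF q]) auto
      ultimately show ?thesis using c
        by (simp add: algebra_simps pos_le_divide_eq) (simp add: field_simps)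
    qed
    then show ?thesis
      using x unfolding slide_def[of y q "c *\<^sub>R x"] by (auto intro!: cINF_greatest)
  qed
  fix x and c :: real assume x: "x \<in> V" and c: "0 < c"
  have "(1 / c) * slide y q (c *\<^sub>R x) \<le> slide y q x"
    using le[of "c *\<^sub>R x" "1 / c"] x c by auto
  then show "slide y q (c *\<^sub>R x) = c * slide y q x"
    using le[OF x c] c by (intro antisym) (auto simp: field_simps)
qed (auto simp: slide_def)

lemma slide_le_self:
  assumes q: "sublinear q" and y: "y \<in> V"
  shows "slide y q \<le> q"
proof (rule le_funI)
  fix x show "slide y q x \<le> q x"
    using slide_le[OF q, of x y 0] y q by (cases "x \<in> V") (auto simp: slide_def sublinear_def)
qed

text \<open>A minimal sublinear functional below a given one is additive, because sliding it in any
  direction does not decrease it.\<close>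

lemma minimal_sublinear:
  assumes q0: "sublinear q0"
  shows "\<exists>q. sublinear q \<and> q \<le> q0 \<and> (\<forall>q'. sublinear q' \<longrightarrow> q' \<le> q \<longrightarrow> q' = q)"
proof -
  define A where "A = {q. sublinear q \<and> q \<le> q0}"
  have "\<exists>m\<in>A. \<forall>a\<in>A. m \<ge> a \<longrightarrow> a = m"
  proof (rule predicate_Zorn)
    show "partial_order_on A (relation_of (\<ge>) A)"
      by (rule partial_order_on_relation_ofI) auto
  next
    fix C assume C: "C \<in> Chains (relation_of (\<ge>) A)"
    then have CA: "C \<subseteq> A" and tot: "\<And>q r. q \<in> C \<Longrightarrow> r \<in> C \<Longrightarrow> q \<le> r \<or> r \<le> q"
      by (auto simp: Chains_def relation_of_def)
    show "\<exists>u\<in>A. \<forall>a\<in>C. u \<le> a"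
    proof (cases "C = {}")
      case True
      then show ?thesis using q0 by (auto simp: A_def)
    next
      case False
      \<comment> \<open>The lower bound of a chain is its pointwise infimum. It is finite because
        every q below q0 satisfies q x >= -q0 (-x).\<close>
      define u where "u = (\<lambda>x. INF q\<in>C. q x)"
      have bdd: "bdd_below ((\<lambda>q. q x) ` C)" for x
      proof (intro bdd_belowI[of _ "if x \<in> V then - q0 (- x) else 0"], safe)
        fix q assume "q \<in> C"
        then have q: "sublinear q" "q \<le> q0" using CA by (auto simp: A_def)
        show "(if x \<in> V then - q0 (- x) else 0) \<le> q x"
        proof (cases "x \<in> V")
          case True
          then have "q (x + - x) \<le> q x + q (- x)"
            using q(1) unfolding sublinear_def by blast
          then show ?thesis
            using sublinear_zero[OF q(1)] le_funD[OF q(2), of "- x"] True by simp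
        qed (use q in \<open>auto simp: sublinear_def\<close>)
      qed
      have u_le: "u x \<le> q x" if "q \<in> C" for q x
        unfolding u_def using bdd that by (intro cINF_lower) auto
      have u_ge: "c \<le> u x" if "\<And>q. q \<in> C \<Longrightarrow> c \<le> q x" for c x
        unfolding u_def using that False by (intro cINF_greatest) auto
      have u_close: "\<exists>q\<in>C. q x < u x + e" if "e > 0" for x e
        using cInf_lessD[of "(\<lambda>q. q x) ` C" "u x + e"] False that by (auto simp: u_def)
      have "sublinear u"
        unfolding sublinear_def
      proof (intro conjI ballI allI impI)
        fix x y assume xy: "x \<in> V" "y \<in> V"
        show "u (x + y) \<le> u x + u y"
        proof (rule field_le_epsilon)
          fix e :: real assume e: "e > 0"
          obtain q r where qr: "q \<in> C" "r \<in> C" "q x < u x + e / 2" "r y < u y + e / 2"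
            using u_close[of "e / 2"] e by (meson half_gt_zero)
          \<comment> \<open>q nearly attains the infimum at x and r at y; comparability gives one
            member of the chain that does both, and its subadditivity passes to u.\<close>
          obtain s where s: "s \<in> C" "s \<le> q" "s \<le> r"
            using tot[OF qr(1,2)] qr by blast
          then have "s (x + y) \<le> s x + s y"
            using CA xy by (auto simp: A_def sublinear_def)
          then show "u (x + y) \<le> u x + u y + e"
            using qr u_le[OF s(1), of "x + y"] le_funD[OF s(2), of x] le_funD[OF s(3), of y] by simp
        qed
      next
        fix x and c :: real assume x: "x \<in> V" and c: "0 < c"
        have sc: "q (c *\<^sub>R x) = c * q x" if "q \<in> C" for q
          using that CA x c by (auto simp: A_def sublinear_def)
        show "u (c *\<^sub>R x) = c * u x"
        proof (rule antisym)
          have "u (c *\<^sub>R x) / c \<le> u x"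
            using u_le[of _ "c *\<^sub>R x"] sc c by (intro u_ge) (auto simp: field_simps)
          then show "u (c *\<^sub>R x) \<le> c * u x" using c by (simp add: field_simps)
          show "c * u x \<le> u (c *\<^sub>R x)"
          proof (rule u_ge)
            fix q assume "q \<in> C"
            then show "c * u x \<le> q (c *\<^sub>R x)"
              using sc[of q] c u_le[of q x] by simp
          qed
        qed
      next
        fix x assume x: "x \<notin> V"
        have "q x = 0" if "q \<in> C" for q
          using that CA x by (auto simp: A_def sublinear_def)
        moreover obtain q where "q \<in> C" using False by auto
        ultimately show "u x = 0"
          using u_le[of q x] u_ge[of 0 x] by fastforce
      qed
      moreover obtain q where "q \<in> C" using False by auto
      then have "u \<le> q" "q \<le> q0"
        using u_le CA by (auto simp: A_def le_fun_def)
      then have "u \<le> q0" by (rule order_trans)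
      ultimately show ?thesis
        using u_le by (intro bexI[of _ u]) (auto simp: A_def le_fun_def)
    qed
  qed
  then obtain m where m: "sublinear m" "m \<le> q0" "\<And>a. sublinear a \<Longrightarrow> a \<le> q0 \<Longrightarrow> a \<le> m \<Longrightarrow> a = m"
    by (auto simp: A_def)
  then show ?thesis
    by (intro exI[of _ m]) (auto intro: order_trans)
qed

text \<open>Minimality is applied below \<open>slide x0 N'\<close> instead of N', because the former
  is at most -N x0 at -x0. A minimal functional is unchanged by every slide, hence linear, and
  linearity turns this bound into q x0 >= N x0.\<close>

theorem Hahn_Banach_norming:
  assumes x0: "x0 \<in> V"
  shows "\<exists>\<phi>. bounded_functional V N \<phi> \<and> \<phi> x0 = N x0 \<and> (\<forall>x\<in>V. \<bar>\<phi> x\<bar> \<le> N x)"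
proof -
  \<comment> \<open>Sublinear functionals are required to be 0 outside V, so that agreement on V is
    equality of functions and the pointwise order suits Zorn's lemma; N is cut off
    accordingly.\<close>
  define N' where "N' = (\<lambda>x. if x \<in> V then N x else 0)"
  have N': "sublinear N'"
    unfolding sublinear_def N'_def using triangle scale by auto
  obtain q where q: "sublinear q" "q \<le> slide x0 N'"
    and min: "\<And>q'. sublinear q' \<Longrightarrow> q' \<le> q \<Longrightarrow> q' = q"
    using minimal_sublinear[OF sublinear_slide[OF N' x0]] by blast
  have qN: "q \<le> N'"
    using q(2) slide_le_self[OF N' x0] by (rule order_trans)
  have sl: "slide y q = q" if "y \<in> V" for y
    using that q(1) by (intro min sublinear_slide slide_le_self)
  have add: "q (x + y) = q x + q y" if "x \<in> V" "y \<in> V" for x y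
  proof (rule antisym)
    show "q (x + y) \<le> q x + q y" using q(1) that by (auto simp: sublinear_def)
    show "q x + q y \<le> q (x + y)"
      using slide_le[OF q(1) that, of 1] sl[OF that(2)] by simp
  qed
  have minus: "q (- x) = - q x" if "x \<in> V" for x
    using add[of x "- x"] that sublinear_zero[OF q(1)] by simp
  have sc: "q (c *\<^sub>R x) = c * q x" if "x \<in> V" for c x
  proof (cases c "0 :: real" rule: linorder_cases)
    case less
    then have "q ((- c) *\<^sub>R x) = - c * q x"
      using q(1) that unfolding sublinear_def by (metis neg_0_less_iff_less)
    then show ?thesis using minus[of "c *\<^sub>R x"] that by simp
  next
    case equal
    then show ?thesis by (simp add: sublinear_zero[OF q(1)])
  next
    case greater
    then show ?thesis using q(1) that unfolding sublinear_def by blast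
  qed
  have le: "\<bar>q x\<bar> \<le> N x" if "x \<in> V" for x
    using le_funD[OF qN, of x] le_funD[OF qN, of "- x"] that minus[OF that] N_minus[OF that]
    by (auto simp: N'_def abs_le_iff)
  have "q (- x0) \<le> - N x0"
    using le_funD[OF q(2), of "- x0"] slide_le[OF N', of "- x0" x0 1] x0 by (simp add: N'_def)
  then have "q x0 = N x0"
    using le[OF x0] minus[OF x0] by simp
  moreover have "bounded_functional V N q"
    unfolding bounded_functional_def using add sc le by (auto intro: exI[of _ 1])
  ultimately show ?thesis using le by blast
qed

lemma N_eq_0_iff_functionals:
  assumes "x \<in> V" "\<And>\<phi>. bounded_functional V N \<phi> \<Longrightarrow> \<phi> x = 0"
  shows "N x = 0"
proof -
  obtain \<phi> where "bounded_functional V N \<phi>" "\<phi> x = N x"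
    using Hahn_Banach_norming[OF assms(1)] by blast
  then show ?thesis using assms(2)[of \<phi>] by simp
qed

text \<open>By the Hahn-Banach theorem every weak limit of a sequence has this property; here it is
  taken as the definition because it is what a nested sequence of convex sets provides.\<close>

definition tail_limit :: "(nat \<Rightarrow> 'v) \<Rightarrow> 'v \<Rightarrow> bool" where
  "tail_limit x g \<longleftrightarrow> g \<in> V \<and> (\<forall>m. \<forall>e>0. \<exists>c\<in>convex hull (x ` {m..}). N (c - g) < e)"

lemma hull_in_V: "A \<subseteq> V \<Longrightarrow> convex hull A \<subseteq> V"
  by (simp add: hull_minimal subspace subspace_imp_convex)

text \<open>The points of V whose value under \<phi> is within e/2 of c form a convex set. It
  contains a tail of the sequence, hence the hull of this tail, and g is arbitrarily close to this
  hull.\<close>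

lemma tail_limit_functional:
  assumes x: "\<And>n. x n \<in> V" and g: "tail_limit x g" and \<phi>: "bounded_functional V N \<phi>"
    and lim: "(\<lambda>n. \<phi> (x n)) \<longlonglongrightarrow> c"
  shows "\<phi> g = c"
proof -
  obtain K where K: "K \<ge> 0" "\<And>x. x \<in> V \<Longrightarrow> \<bar>\<phi> x\<bar> \<le> K * N x"
    using \<phi> bf_bound by blast
  have gV: "g \<in> V" using g by (simp add: tail_limit_def)
  have "\<bar>\<phi> g - c\<bar> \<le> 0"
  proof (rule field_le_epsilon)
    fix e :: real assume e: "e > 0"
    obtain m where m: "\<And>n. n \<ge> m \<Longrightarrow> \<bar>\<phi> (x n) - c\<bar> < e / 2"
      using LIMSEQ_D[OF lim, of "e / 2"] e by auto
    let ?H = "{v \<in> V. \<bar>\<phi> v - c\<bar> \<le> e / 2}"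
    have "convex ?H"
    proof (rule convexI, safe)
      fix v w and s t :: real
      assume v: "v \<in> V" "w \<in> V" "\<bar>\<phi> v - c\<bar> \<le> e / 2" "\<bar>\<phi> w - c\<bar> \<le> e / 2" "0 \<le> s" "0 \<le> t" "s + t = 1"
      then have "\<phi> (s *\<^sub>R v + t *\<^sub>R w) - c = s * \<phi> v + t * \<phi> w - (s + t) * c"
        using \<phi> by (simp add: bf_add bf_scale)
      also have "\<dots> = s * (\<phi> v - c) + t * (\<phi> w - c)"
        by (simp add: algebra_simps)
      also have "\<bar>\<dots>\<bar> \<le> s * \<bar>\<phi> v - c\<bar> + t * \<bar>\<phi> w - c\<bar>"
        using v by (intro order_trans[OF abs_triangle_ineq]) (simp add: abs_mult)
      also have "\<dots> \<le> s * (e / 2) + t * (e / 2)"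
        using v by (intro add_mono mult_left_mono)
      also have "\<dots> = (s + t) * (e / 2)" by (simp only: distrib_right)
      finally show "\<bar>\<phi> (s *\<^sub>R v + t *\<^sub>R w) - c\<bar> \<le> e / 2"
        using v by simp
    qed auto
    then have sub: "convex hull (x ` {m..}) \<subseteq> ?H"
      using m x by (intro hull_minimal) (force intro: less_imp_le)+
    obtain d where d: "d \<in> convex hull (x ` {m..})" "N (d - g) < e / (2 * (K + 1))"
      using g e K(1) unfolding tail_limit_def by (meson divide_pos_pos mult_pos_pos add_nonneg_pos zero_less_one zero_less_numeral)
    have dV: "d \<in> V" using d sub by auto
    have "\<bar>\<phi> d - \<phi> g\<bar> \<le> K * N (d - g)"
      using K(2)[of "d - g"] dV gV \<phi> by (simp add: bf_diff)
    also have "\<dots> \<le> (K + 1) * (e / (2 * (K + 1)))"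
      using K(1) d(2) N_nonneg[of "d - g"] dV gV by (intro mult_mono) auto
    also have "\<dots> = e / 2" using K(1) by (simp add: field_simps)
    finally have "\<bar>\<phi> d - \<phi> g\<bar> \<le> e / 2" .
    moreover have "\<bar>\<phi> d - c\<bar> \<le> e / 2" using d(1) sub by auto
    ultimately show "\<bar>\<phi> g - c\<bar> \<le> 0 + e" by linarith
  qed
  then show ?thesis by simp
qed

lemma convex_N_le: "convex {v \<in> V. N v \<le> b}"
proof (rule convexI, safe)
  fix v w and s t :: real
  assume v: "v \<in> V" "w \<in> V" "N v \<le> b" "N w \<le> b" "0 \<le> s" "0 \<le> t" "s + t = 1"
  have "N (s *\<^sub>R v + t *\<^sub>R w) \<le> s * N v + t * N w"
    using v triangle[of "s *\<^sub>R v" "t *\<^sub>R w"] by (simp add: scale)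
  also have "\<dots> \<le> s * b + t * b"
    using v by (intro add_mono mult_left_mono)
  also have "\<dots> = (s + t) * b" by (simp only: distrib_right)
  finally show "N (s *\<^sub>R v + t *\<^sub>R w) \<le> b"
    using v by simp
qed auto

text \<open>Balls are convex, so the hulls stay in the ball; this is weak lower semicontinuity of
  the norm in the form needed here.\<close>

lemma tail_limit_N_le:
  assumes x: "\<And>n. x n \<in> V" "\<And>n. N (x n) \<le> b" and g: "tail_limit x g"
  shows "N g \<le> b"
proof (rule field_le_epsilon)
  fix e :: real assume "e > 0"
  then obtain c where c: "c \<in> convex hull (x ` {0..})" "N (c - g) < e"
    using g unfolding tail_limit_def by blast
  have "convex hull (x ` {0..}) \<subseteq> {v \<in> V. N v \<le> b}"
    using x by (intro hull_minimal convex_N_le) auto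
  with c have "c \<in> V" "N c \<le> b" by auto
  then show "N g \<le> b + e"
    using c g N_le_diff[of g c] N_commute[of g c] by (auto simp: tail_limit_def)
qed

end

section \<open>Weak compactness in uniformly convex spaces\<close>

text \<open>The condition \<open>convexity\<close> says that a small defect in the midpoint
  inequality for p-th powers forces x and y together, up to a term whose coefficient \<eta> may be
  as small as desired. Being linear in p-th powers of norms it can be integrated, so L^p(I,E)
  inherits it from E with the same \<eta> and K.\<close>

locale uniformly_convex_space = seminormed_space +
  fixes p :: real
  assumes p_gt_1: "1 < p"
    and complete: "(\<And>n::nat. x n \<in> V) \<Longrightarrow>
      (\<And>e. e > 0 \<Longrightarrow> \<exists>n0. \<forall>m\<ge>n0. \<forall>n\<ge>n0. N (x m - x n) < e) \<Longrightarrow>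
      \<exists>g\<in>V. (\<lambda>n. N (x n - g)) \<longlonglongrightarrow> 0"
    and convexity: "\<eta> > 0 \<Longrightarrow> \<exists>K\<ge>0. \<forall>x\<in>V. \<forall>y\<in>V.
      N (x - y) powr p \<le> \<eta> * (N x powr p + N y powr p) +
        K * ((N x powr p + N y powr p) / 2 - N ((x + y) /\<^sub>R 2) powr p)"
begin

text \<open>An almost norm-minimal element is chosen in each set, and the minimal norms increase to
  a limit D. For m <= n the midpoint of \<open>c m\<close> and \<open>c n\<close> lies in
  \<open>C m\<close>, so its norm is at least \<open>d m\<close>. All norms involved are near D, and
  the convexity inequality makes the selection Cauchy.\<close>

lemma nested_convex_sets_converging_selection:
  assumes C: "\<And>n. C n \<subseteq> V" "\<And>n. convex (C n)" "\<And>n. C n \<noteq> {}" "\<And>m n. m \<le> n \<Longrightarrow> C n \<subseteq> C m"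
    and bound: "\<And>n c. c \<in> C n \<Longrightarrow> N c \<le> b"
  shows "\<exists>c g. (\<forall>n::nat. c n \<in> C n) \<and> g \<in> V \<and> (\<lambda>n. N (c n - g)) \<longlonglongrightarrow> 0"
proof -
  define d where "d n = Inf (N ` C n)" for n
  have bdd: "bdd_below (N ` C n)" for n
    using C(1) N_nonneg by (intro bdd_belowI[of _ 0]) auto
  have d_le: "d n \<le> N c" if "c \<in> C n" for n c
    unfolding d_def using that bdd by (intro cInf_lower) auto
  have d_mono: "d m \<le> d n" if "m \<le> n" for m n
    unfolding d_def using C(3) C(4)[OF that] bdd by (intro cInf_superset_mono) auto
  have d_nonneg: "0 \<le> d n" for n
    unfolding d_def using C(1,3) N_nonneg by (intro cInf_greatest) auto
  have d_b: "d n \<le> b" for n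
    using C(3)[of n] d_le bound by (metis all_not_in_conv order_trans)
  have "\<exists>c. c \<in> C n \<and> N c < d n + inverse (real (Suc n))" for n
    using cInf_lessD[of "N ` C n" "d n + inverse (real (Suc n))"] C(3) by (auto simp: d_def)
  then obtain c where c: "\<And>n. c n \<in> C n" "\<And>n. N (c n) < d n + inverse (real (Suc n))"
    by metis
  obtain D where D: "d \<longlonglongrightarrow> D"
    by (rule incseq_convergent[of d b]) (use d_mono d_b in \<open>auto simp: incseq_def\<close>)
  have Nc: "(\<lambda>n. N (c n)) \<longlonglongrightarrow> D"
  proof (rule tendsto_sandwich[OF _ _ D])
    show "(\<lambda>n. d n + inverse (real (Suc n))) \<longlonglongrightarrow> D"
      using tendsto_add[OF D LIMSEQ_inverse_real_of_nat] by simp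
  qed (use c d_le in \<open>auto intro!: always_eventually less_imp_le\<close>)
  define P where "P = D powr p"
  have lim1: "(\<lambda>n. N (c n) powr p) \<longlonglongrightarrow> P" and lim2: "(\<lambda>n. d n powr p) \<longlonglongrightarrow> P"
    unfolding P_def using p_gt_1 c(1) C(1) N_nonneg d_nonneg
    by (auto intro!: tendsto_powr' Nc D always_eventually)
  have P0: "0 \<le> P" by (simp add: P_def)
  have cV: "c n \<in> V" for n using c(1) C(1) by blast
  have "\<exists>g\<in>V. (\<lambda>n. N (c n - g)) \<longlonglongrightarrow> 0"
  proof (rule complete)
    fix e :: real assume e: "e > 0"
    define E where "E = e powr p"
    have E: "E > 0" using e by (simp add: E_def)
    \<comment> \<open>\<eta> here and s below are chosen so that each of the two terms on the right
      of the convexity inequality is at most E/4, once the p-th powers of the norms are below P +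
      1.\<close>
    define \<eta> where "\<eta> = E / (8 * (P + 1))"
    have \<eta>: "\<eta> > 0" using E P0 by (simp add: \<eta>_def)
    obtain K where K: "K \<ge> 0" "\<And>x y. x \<in> V \<Longrightarrow> y \<in> V \<Longrightarrow>
      N (x - y) powr p \<le> \<eta> * (N x powr p + N y powr p) +
        K * ((N x powr p + N y powr p) / 2 - N ((x + y) /\<^sub>R 2) powr p)"
      using convexity[OF \<eta>] by blast
    define s where "s = min 1 (E / (8 * (K + 1)))"
    have s: "s > 0" "s \<le> 1" "s \<le> E / (8 * (K + 1))" using E K by (auto simp: s_def)
    have "\<forall>\<^sub>F n in sequentially. \<bar>N (c n) powr p - P\<bar> < s \<and> \<bar>d n powr p - P\<bar> < s"
      using tendstoD[OF lim1 s(1)] tendstoD[OF lim2 s(1)] by eventually_elim (simp add: dist_real_def)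
    then obtain n0 where n0: "\<And>n. n \<ge> n0 \<Longrightarrow> \<bar>N (c n) powr p - P\<bar> < s \<and> \<bar>d n powr p - P\<bar> < s"
      by (auto simp: eventually_sequentially)
    have *: "N (c m - c n) < e" if "n0 \<le> m" "m \<le> n" for m n
    proof (rule ccontr)
      assume "\<not> N (c m - c n) < e"
      then have 1: "E \<le> N (c m - c n) powr p"
        unfolding E_def using e p_gt_1 by (intro powr_mono2) auto
      have "(1 / 2) *\<^sub>R c m + (1 / 2) *\<^sub>R c n \<in> C m"
        using C(4)[OF that(2)] c(1) by (intro convexD[OF C(2)]) auto
      then have "(c m + c n) /\<^sub>R 2 \<in> C m"
        by (simp add: scaleR_add_right inverse_eq_divide)
      then have 2: "d m powr p \<le> N ((c m + c n) /\<^sub>R 2) powr p"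
        using d_le d_nonneg p_gt_1 by (intro powr_mono2) auto
      have 3: "N (c m) powr p < P + s" "N (c n) powr p < P + s" "P - s < d m powr p"
        using n0[of m] n0[of n] that by (auto simp: abs_less_iff)
      have "\<eta> * (N (c m) powr p + N (c n) powr p) \<le> \<eta> * (2 * (P + 1))"
        using 3 s(2) \<eta> by (intro mult_left_mono) auto
      also have "\<dots> = E / 4" using P0 by (simp add: \<eta>_def field_simps)
      finally have 4: "\<eta> * (N (c m) powr p + N (c n) powr p) \<le> E / 4" .
      have "(N (c m) powr p + N (c n) powr p) / 2 \<le> P + s"
        using 3 by simp
      with 2 3 have 5: "(N (c m) powr p + N (c n) powr p) / 2 - N ((c m + c n) /\<^sub>R 2) powr p \<le> 2 * s"
        by linarith
      have "K * ((N (c m) powr p + N (c n) powr p) / 2 - N ((c m + c n) /\<^sub>R 2) powr p) \<le> K * (2 * s)"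
        using 5 K(1) by (rule mult_left_mono)
      also have "\<dots> \<le> (K + 1) * (2 * (E / (8 * (K + 1))))"
        using K(1) s by (intro mult_mono) auto
      also have "\<dots> = E / 4" using K(1) by (simp add: field_simps)
      finally show False
        using K(2)[OF cV cV, of m n] 1 4 E by linarith
    qed
    show "\<exists>n0. \<forall>m\<ge>n0. \<forall>n\<ge>n0. N (c m - c n) < e"
    proof (intro exI allI impI)
      fix m n assume "n0 \<le> m" "n0 \<le> n"
      then show "N (c m - c n) < e"
        using *[of m n] *[of n m] N_commute[OF cV cV, of m n] by (cases "m \<le> n") auto
    qed
  qed (rule cV)
  with c(1) show ?thesis by blast
qed

text \<open>The hulls of the tails form a decreasing sequence of convex sets in a ball. This takes
  the place of weak compactness of balls: no weakly convergent subsequence is extracted, only a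
  strong limit of convex combinations.\<close>

lemma tail_limit_exists:
  assumes x: "\<And>n. x n \<in> V" "\<And>n. N (x n) \<le> b"
  shows "\<exists>g. tail_limit x g"
proof -
  define C where "C m = convex hull (x ` {m..})" for m
  have mono: "C n \<subseteq> C m" if "m \<le> n" for m n
    unfolding C_def using that by (intro hull_mono) auto
  have sub: "C m \<subseteq> {v \<in> V. N v \<le> b}" for m
    unfolding C_def using x by (intro hull_minimal convex_N_le) auto
  have "\<exists>c g. (\<forall>n. c n \<in> C n) \<and> g \<in> V \<and> (\<lambda>n. N (c n - g)) \<longlonglongrightarrow> 0"
  proof (rule nested_convex_sets_converging_selection)
    show "C n \<subseteq> V" "C n \<noteq> {}" "convex (C n)" for n
      using sub[of n] by (auto simp: C_def)
    show "C n \<subseteq> C m" if "m \<le> n" for m n using that by (rule mono)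
    show "N c \<le> b" if "c \<in> C n" for c n using that sub[of n] by auto
  qed
  then obtain c g where c: "\<And>n. c n \<in> C n" "g \<in> V" and c_lim: "(\<lambda>n. N (c n - g)) \<longlonglongrightarrow> 0"
    by blast
  have "\<exists>v\<in>C m. N (v - g) < e" if "e > 0" for m e
  proof -
    obtain n0 where n0: "\<And>n. n \<ge> n0 \<Longrightarrow> \<bar>N (c n - g)\<bar> < e"
      using LIMSEQ_D[OF c_lim \<open>e > 0\<close>] by auto
    show ?thesis
      using n0[of "max m n0"] c(1)[of "max m n0"] mono[of m "max m n0"]
      by (intro bexI[of _ "c (max m n0)"]) auto
  qed
  with c(2) show ?thesis
    unfolding tail_limit_def C_def by blast
qed

text \<open>If \<phi> (x n) did not tend to \<phi> g, some subsequence would have another limit c of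
  its values; a tail limit h of this subsequence has \<phi> h = c, although h is at distance 0 from
  g. Weak convergence thus becomes a matter of identifying tail limits.\<close>

lemma weakly_converges_if_tail_limits:
  assumes x: "\<And>n. x n \<in> V" "\<And>n. N (x n) \<le> b" and g: "g \<in> V"
    and lim: "\<And>r h. strict_mono r \<Longrightarrow> tail_limit (\<lambda>n. x (r n)) h \<Longrightarrow> N (h - g) = 0"
  shows "weakly_converges V N x g"
  unfolding weakly_converges_def
proof (intro conjI allI impI)
  fix \<phi> assume \<phi>: "bounded_functional V N \<phi>"
  obtain K where K: "K \<ge> 0" "\<And>x. x \<in> V \<Longrightarrow> \<bar>\<phi> x\<bar> \<le> K * N x"
    using \<phi> bf_bound by blast
  show "(\<lambda>n. \<phi> (x n)) \<longlonglongrightarrow> \<phi> g"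
  proof (rule ccontr)
    assume "\<not> (\<lambda>n. \<phi> (x n)) \<longlonglongrightarrow> \<phi> g"
    moreover have "\<bar>\<phi> (x n)\<bar> \<le> K * b" for n
      using K(2)[OF x(1)] mult_left_mono[OF x(2) K(1)] by (rule order_trans)
    ultimately obtain r c where r: "strict_mono r" "(\<lambda>n. \<phi> (x (r n))) \<longlonglongrightarrow> c" "c \<noteq> \<phi> g"
      using not_tendsto_subsequence[of "\<lambda>n. \<phi> (x n)"] by blast
    obtain h where h: "tail_limit (\<lambda>n. x (r n)) h"
      using tail_limit_exists[of "\<lambda>n. x (r n)"] x by blast
    have "\<phi> h = c"
      using x(1) h \<phi> r(2) by (rule tail_limit_functional)
    moreover have "\<phi> h = \<phi> g"
      using \<phi> lim[OF r(1) h] h g by (intro bf_eq) (auto simp: tail_limit_def)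
    ultimately show False using r(3) by simp
  qed
qed (use x g in auto)

lemma tail_limit_weakly_converges:
  assumes "weakly_converges V N x g" "tail_limit x h"
  shows "N (h - g) = 0"
proof (rule N_eq_0_iff_functionals)
  show "h - g \<in> V" using assms by (auto simp: weakly_converges_def tail_limit_def)
  fix \<phi> assume \<phi>: "bounded_functional V N \<phi>"
  then have "\<phi> h = \<phi> g"
    using assms by (intro tail_limit_functional[of x h]) (auto simp: weakly_converges_def)
  then show "\<phi> (h - g) = 0"
    using \<phi> assms by (auto simp: bf_diff weakly_converges_def tail_limit_def)
qed

section \<open>A fixed point theorem for sequentially weakly continuous maps\<close>

text \<open>Each point of the ball is sent to the list of integer parts of \<phi> y / e. The
  functionals are bounded on the ball, so only finitely many lists occur; Z consists of one preimage
  of each. Equal lists mean that all values differ by less than e.\<close>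

lemma finite_functional_net:
  assumes \<phi>: "\<And>\<phi>. \<phi> \<in> set \<phi>s \<Longrightarrow> bounded_functional V N \<phi>" and e: "e > 0" and R: "R \<ge> 0"
  shows "\<exists>Z. finite Z \<and> Z \<subseteq> {v \<in> V. N v \<le> R} \<and>
    (\<forall>y\<in>V. N y \<le> R \<longrightarrow> (\<exists>z\<in>Z. \<forall>\<phi>\<in>set \<phi>s. \<bar>\<phi> y - \<phi> z\<bar> < e))"
proof -
  let ?B = "{v \<in> V. N v \<le> R}"
  define g where "g y = map (\<lambda>\<phi>. \<lfloor>\<phi> y / e\<rfloor>) \<phi>s" for y :: 'a
  have "\<exists>M. \<forall>\<phi>\<in>set \<phi>s. \<forall>y\<in>?B. \<bar>\<phi> y\<bar> \<le> M"
    using \<phi>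
  proof (induction \<phi>s)
    case (Cons \<phi> \<phi>s)
    then obtain M where M: "\<forall>\<phi>\<in>set \<phi>s. \<forall>y\<in>?B. \<bar>\<phi> y\<bar> \<le> M" by auto
    obtain K where K: "K \<ge> 0" "\<And>x. x \<in> V \<Longrightarrow> \<bar>\<phi> x\<bar> \<le> K * N x"
      using Cons.prems bf_bound[of \<phi>] by auto
    have "\<bar>\<phi> y\<bar> \<le> K * R" if "y \<in> ?B" for y
      using K(2)[of y] mult_left_mono[OF _ K(1), of "N y" R] that by auto
    with M show ?case
      by (intro exI[of _ "max M (K * R)"]) (auto simp: le_max_iff_disj)
  qed auto
  then obtain M where M: "\<And>\<phi> y. \<phi> \<in> set \<phi>s \<Longrightarrow> y \<in> ?B \<Longrightarrow> \<bar>\<phi> y\<bar> \<le> M" by blast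
  have "g ` ?B \<subseteq> {xs. set xs \<subseteq> {\<lfloor>- M / e\<rfloor>..\<lfloor>M / e\<rfloor>} \<and> length xs = length \<phi>s}"
  proof safe
    fix y z assume y: "y \<in> V" "N y \<le> R" and "z \<in> set (g y)"
    then obtain \<phi> where \<phi>: "\<phi> \<in> set \<phi>s" "z = \<lfloor>\<phi> y / e\<rfloor>" by (auto simp: g_def)
    have "- M \<le> \<phi> y" "\<phi> y \<le> M" using M[OF \<phi>(1), of y] y by auto
    then have "- M / e \<le> \<phi> y / e" "\<phi> y / e \<le> M / e"
      using e by (intro divide_right_mono; simp)+
    then show "z \<in> {\<lfloor>- M / e\<rfloor>..\<lfloor>M / e\<rfloor>}"
      unfolding \<phi>(2) atLeastAtMost_iff by (intro conjI floor_mono)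
  qed (auto simp: g_def)
  then have fin: "finite (g ` ?B)"
    by (rule finite_subset) (auto intro: finite_lists_length_eq)
  show ?thesis
  proof (intro exI conjI ballI impI)
    show "finite (inv_into ?B g ` (g ` ?B))" using fin by simp
    show "inv_into ?B g ` (g ` ?B) \<subseteq> ?B" using inv_into_into[of _ g ?B] by blast
    fix y assume y: "y \<in> V" "N y \<le> R"
    let ?z = "inv_into ?B g (g y)"
    have gz: "g ?z = g y" using y by (intro f_inv_into_f) auto
    have "\<bar>\<phi> y - \<phi> ?z\<bar> < e" if "\<phi> \<in> set \<phi>s" for \<phi>
    proof -
      have "\<lfloor>\<phi> ?z / e\<rfloor> = \<lfloor>\<phi> y / e\<rfloor>"
        using gz that by (simp add: g_def)
      then have "\<bar>\<phi> y / e - \<phi> ?z / e\<bar> < 1" by linarith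
      then show ?thesis
        using e by (simp flip: diff_divide_distrib)
    qed
    then show "\<exists>z\<in>inv_into ?B g ` (g ` ?B). \<forall>\<phi>\<in>set \<phi>s. \<bar>\<phi> y - \<phi> z\<bar> < e"
      using y by (intro bexI[of _ ?z]) auto
  qed
qed

text \<open>A Schauder projection: S followed by a partition of unity subordinate to the net becomes
  a self-map of a cube. Combinations of the net points depend on their coefficients continuously in
  norm, hence weakly, so sequential weak continuity of S makes this map continuous.\<close>

lemma approximate_fixed_point:
  assumes SV: "\<And>x. x \<in> V \<Longrightarrow> S x \<in> V"
    and S: "\<And>x g. weakly_converges V N x g \<Longrightarrow> (\<And>n. N (x n) \<le> R) \<Longrightarrow> N g \<le> R \<Longrightarrow>
      weakly_converges V N (\<lambda>n. S (x n)) (S g)"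
    and ball: "\<And>x. x \<in> V \<Longrightarrow> N x \<le> R \<Longrightarrow> N (S x) \<le> R" and R: "R \<ge> 0"
    and \<phi>: "\<And>\<phi>. \<phi> \<in> set \<phi>s \<Longrightarrow> bounded_functional V N \<phi>" and e: "e > 0"
  shows "\<exists>u\<in>V. N u \<le> R \<and> (\<forall>\<phi>\<in>set \<phi>s. \<bar>\<phi> (S u - u)\<bar> \<le> e)"
proof -
  obtain Z where Z: "finite Z" "Z \<subseteq> {v \<in> V. N v \<le> R}"
    "\<And>y. y \<in> V \<Longrightarrow> N y \<le> R \<Longrightarrow> \<exists>z\<in>Z. \<forall>\<phi>\<in>set \<phi>s. \<bar>\<phi> y - \<phi> z\<bar> < e"
    using finite_functional_net[of \<phi>s e R, OF \<phi> e R] by blast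
  obtain z where bij: "bij_betw z {0..<card Z} Z"
    using ex_bij_betw_nat_finite[OF Z(1)] by blast
  define n where "n = card Z"
  have z: "z i \<in> V" "N (z i) \<le> R" if "i < n" for i
    using bij_betwE[OF bij] that Z(2) by (auto simp: n_def)
  have net: "\<exists>i<n. \<forall>\<phi>\<in>set \<phi>s. \<bar>\<phi> y - \<phi> (z i)\<bar> < e" if "y \<in> V" "N y \<le> R" for y
  proof -
    obtain v where v: "v \<in> Z" "\<forall>\<phi>\<in>set \<phi>s. \<bar>\<phi> y - \<phi> v\<bar> < e"
      using Z(3)[OF \<open>y \<in> V\<close> \<open>N y \<le> R\<close>] by blast
    have "v \<in> z ` {0..<card Z}" using v(1) bij_betw_imp_surj_on[OF bij] by simp
    then obtain i where "i < n" "v = z i" by (auto simp: n_def)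
    with v show ?thesis by blast
  qed
  \<comment> \<open>This weight is positive exactly if every functional of the list differs by less
    than e between y and \<open>z i\<close>.\<close>
  define \<mu> where "\<mu> i y = (\<Prod>\<phi>\<in>set \<phi>s. max 0 (e - \<bar>\<phi> y - \<phi> (z i)\<bar>))" for i y
  define \<sigma> where "\<sigma> y = (\<Sum>i<n. \<mu> i y)" for y
  \<comment> \<open>Dividing by the maximum of 1 and the sum keeps \<open>u x\<close> in the ball on
    the whole cube, with no restriction to the simplex. At a fixed point of F the sum is 1, so the
    division has no effect there.\<close>
  define c where "c x i = x i / max 1 (\<Sum>i<n. x i)" for x :: "nat \<Rightarrow> real" and i
  define u where "u x = (\<Sum>i<n. c x i *\<^sub>R z i)" for x
  define F where "F x i = \<mu> i (S (u x)) / \<sigma> (S (u x))" for x i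
  have \<mu>0: "\<mu> i y \<ge> 0" for i y
    unfolding \<mu>_def by (intro prod_nonneg) auto
  have \<sigma>: "\<sigma> y > 0" if "y \<in> V" "N y \<le> R" for y
  proof -
    obtain i where i: "i < n" "\<forall>\<phi>\<in>set \<phi>s. \<bar>\<phi> y - \<phi> (z i)\<bar> < e"
      using net[OF \<open>y \<in> V\<close> \<open>N y \<le> R\<close>] by blast
    then have "\<mu> i y > 0" unfolding \<mu>_def by (intro prod_pos) auto
    then show ?thesis unfolding \<sigma>_def using i \<mu>0 by (intro sum_pos2) auto
  qed
  have uV: "u x \<in> V" for x
    unfolding u_def using z by (intro in_V_sum) auto
  have uR: "N (u x) \<le> R" if "\<forall>j<n. 0 \<le> x j \<and> x j \<le> 1" for x :: "nat \<Rightarrow> real"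
  proof -
    have "N (u x) \<le> (\<Sum>i<n. N (c x i *\<^sub>R z i))"
      unfolding u_def using z by (intro N_sum) auto
    also have "\<dots> \<le> (\<Sum>i<n. c x i * R)"
    proof (rule sum_mono)
      fix i assume i: "i \<in> {..<n}"
      then have "0 \<le> c x i" using that by (auto simp: c_def intro!: divide_nonneg_nonneg)
      with i z show "N (c x i *\<^sub>R z i) \<le> c x i * R"
        by (simp add: scale mult_left_mono)
    qed
    also have "\<dots> = (\<Sum>i<n. x i) / max 1 (\<Sum>i<n. x i) * R"
      by (simp add: c_def sum_divide_distrib sum_distrib_right)
    also have "\<dots> \<le> 1 * R"
      using R by (intro mult_right_mono) auto
    finally show ?thesis by simp
  qed
  have \<mu>_le: "\<mu> i y \<le> \<sigma> y" if "i < n" for i y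
    unfolding \<sigma>_def using that \<mu>0 by (intro member_le_sum) auto
  have "\<exists>x. (\<forall>j<n. 0 \<le> x j \<and> x j \<le> 1) \<and> (\<forall>i<n. F x i = x i)"
  proof (rule brouwer_nat_cube)
    fix x :: "nat \<Rightarrow> real" and i assume x: "\<forall>j<n. 0 \<le> x j \<and> x j \<le> 1" and i: "i < n"
    then show "0 \<le> F x i \<and> F x i \<le> 1"
      using \<mu>0 \<sigma>[OF SV[OF uV] ball[OF uV uR[OF x]]] \<mu>_le[OF i] by (auto simp: F_def)
  next
    fix X :: "nat \<Rightarrow> nat \<Rightarrow> real" and x i assume X: "\<forall>k. \<forall>j<n. 0 \<le> X k j \<and> X k j \<le> 1" and x: "\<forall>j<n. 0 \<le> x j \<and> x j \<le> 1"
      and lim: "\<forall>j<n. (\<lambda>k. X k j) \<longlonglongrightarrow> x j" and i: "i < n"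
    have c_lim: "(\<lambda>k. c (X k) j) \<longlonglongrightarrow> c x j" if "j < n" for j
      unfolding c_def using lim that by (intro tendsto_divide tendsto_max tendsto_sum) auto
    have "(\<lambda>k. N (u (X k) - u x)) \<longlonglongrightarrow> 0"
    proof (rule Lim_null_comparison)
      show "\<forall>\<^sub>F k in sequentially. norm (N (u (X k) - u x)) \<le> (\<Sum>j<n. \<bar>c (X k) j - c x j\<bar> * N (z j))"
      proof (intro always_eventually allI)
        fix k
        have "u (X k) - u x = (\<Sum>j<n. (c (X k) j - c x j) *\<^sub>R z j)"
          by (simp add: u_def scaleR_diff_left sum_subtractf)
        also have "N \<dots> \<le> (\<Sum>j<n. N ((c (X k) j - c x j) *\<^sub>R z j))"
          using z by (intro N_sum) auto
        also have "\<dots> = (\<Sum>j<n. \<bar>c (X k) j - c x j\<bar> * N (z j))"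
          using z by (intro sum.cong) (auto simp: scale)
        finally show "norm (N (u (X k) - u x)) \<le> (\<Sum>j<n. \<bar>c (X k) j - c x j\<bar> * N (z j))"
          using N_nonneg[of "u (X k) - u x"] uV by simp
      qed
      have "(\<lambda>k. \<Sum>j<n. \<bar>c (X k) j - c x j\<bar> * N (z j)) \<longlonglongrightarrow> (\<Sum>j<n. \<bar>c x j - c x j\<bar> * N (z j))"
        using c_lim by (intro tendsto_sum tendsto_mult tendsto_rabs tendsto_diff tendsto_const) auto
      then show "(\<lambda>k. \<Sum>j<n. \<bar>c (X k) j - c x j\<bar> * N (z j)) \<longlonglongrightarrow> 0" by simp
    qed
    then have "weakly_converges V N (\<lambda>k. u (X k)) (u x)"
      by (intro weakly_converges_strong uV)
    then have "weakly_converges V N (\<lambda>k. S (u (X k))) (S (u x))"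
      by (rule S) (use uR X x in blast)+
    then have \<phi>_lim: "(\<lambda>k. \<phi> (S (u (X k)))) \<longlonglongrightarrow> \<phi> (S (u x))" if "\<phi> \<in> set \<phi>s" for \<phi>
      using that \<phi> by (auto simp: weakly_converges_def)
    have \<mu>_lim: "(\<lambda>k. \<mu> j (S (u (X k)))) \<longlonglongrightarrow> \<mu> j (S (u x))" for j
      unfolding \<mu>_def using \<phi>_lim
      by (intro tendsto_prod tendsto_max tendsto_diff tendsto_rabs tendsto_const) auto
    then show "(\<lambda>k. F (X k) i) \<longlonglongrightarrow> F x i"
      unfolding F_def using \<sigma>[OF SV[OF uV] ball[OF uV uR[OF x]]]
      by (intro tendsto_divide) (auto simp: \<sigma>_def intro!: tendsto_sum)
  qed
  then obtain x where x: "\<forall>j<n. 0 \<le> x j \<and> x j \<le> 1" and fix_x: "\<And>i. i < n \<Longrightarrow> F x i = x i"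
    by blast
  let ?y = "S (u x)"
  have yV: "?y \<in> V" and yR: "N ?y \<le> R" using SV uV ball uR[OF x] by auto
  note \<sigma>y = \<sigma>[OF yV yR]
  have "(\<Sum>i<n. x i) = (\<Sum>i<n. F x i)" using fix_x by simp
  also have "\<dots> = 1" using \<sigma>y by (simp add: F_def \<sigma>_def flip: sum_divide_distrib)
  finally have sum1: "(\<Sum>i<n. x i) = 1" .
  have "\<bar>\<phi> (?y - u x)\<bar> \<le> e" if \<phi>s: "\<phi> \<in> set \<phi>s" for \<phi>
  proof -
    have "\<phi> (u x) = (\<Sum>i<n. x i * \<phi> (z i))"
      unfolding u_def using z \<phi>[OF \<phi>s] by (subst bf_sum) (auto simp: bf_scale c_def sum1 intro!: sum.cong)
    moreover have "\<phi> ?y = (\<Sum>i<n. x i * \<phi> ?y)"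
      by (simp add: sum1 flip: sum_distrib_right)
    ultimately have "\<phi> (?y - u x) = (\<Sum>i<n. x i * (\<phi> ?y - \<phi> (z i)))"
      using \<phi>[OF \<phi>s] yV uV by (simp add: bf_diff right_diff_distrib sum_subtractf)
    also have "\<bar>\<dots>\<bar> \<le> (\<Sum>i<n. x i * e)"
    proof (rule order_trans[OF sum_abs sum_mono])
      fix i assume i: "i \<in> {..<n}"
      show "\<bar>x i * (\<phi> ?y - \<phi> (z i))\<bar> \<le> x i * e"
      \<comment> \<open>A net point with nonzero weight is within e of \<open>S (u x)\<close> for
        every functional, so only deviations below e are averaged.\<close>
      proof (cases "x i = 0")
        case False
        then have "\<mu> i ?y \<noteq> 0" using fix_x[of i] i by (auto simp: F_def)
        then have "max 0 (e - \<bar>\<phi> ?y - \<phi> (z i)\<bar>) \<noteq> 0" using \<phi>s by (auto simp: \<mu>_def)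
        then show ?thesis using x i by (auto simp: abs_mult max_def intro!: mult_left_mono split: if_splits)
      qed simp
    qed
    also have "\<dots> = e" by (simp add: sum1 flip: sum_distrib_right)
    finally show ?thesis .
  qed
  then show ?thesis using uV uR[OF x] by blast
qed

text \<open>The weak topology need not be metrizable, and sequential weak continuity says nothing about
  nets. So a countable set is constructed that is closed under the map, under rational linear
  combinations and under passing to approximate fixed points for the norming functionals of its
  elements; these countably many functionals then identify weak limits.\<close>

theorem fixed_point:
  assumes SV: "\<And>x. x \<in> V \<Longrightarrow> S x \<in> V"
    and S: "\<And>x g. weakly_converges V N x g \<Longrightarrow> (\<And>n. N (x n) \<le> R) \<Longrightarrow> N g \<le> R \<Longrightarrow>
      weakly_converges V N (\<lambda>n. S (x n)) (S g)"
    and ball: "\<And>x. x \<in> V \<Longrightarrow> N x \<le> R \<Longrightarrow> N (S x) \<le> R" and R: "R \<ge> 0"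
  shows "\<exists>u\<in>V. N u \<le> R \<and> N (S u - u) = 0"
proof -
  obtain nf where nf: "\<And>d. d \<in> V \<Longrightarrow> bounded_functional V N (nf d)" "\<And>d. d \<in> V \<Longrightarrow> nf d d = N d"
    "\<And>d x. d \<in> V \<Longrightarrow> x \<in> V \<Longrightarrow> \<bar>nf d x\<bar> \<le> N x"
    using Hahn_Banach_norming by metis
  \<comment> \<open>\<open>pt ds\<close> is an approximate fixed point for the norming functionals
    of the vectors in ds, with a precision that improves with the length of the list. Choosing it
    once as a function of lists allows a countable set to be closed under it.\<close>
  have "\<exists>pt. \<forall>ds. set ds \<subseteq> V \<longrightarrow> pt ds \<in> V \<and> N (pt ds) \<le> R \<and>
      (\<forall>d\<in>set ds. \<bar>nf d (S (pt ds) - pt ds)\<bar> \<le> inverse (real (Suc (length ds))))"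
  proof (rule choice, rule allI)
    fix ds
    show "\<exists>v. set ds \<subseteq> V \<longrightarrow> v \<in> V \<and> N v \<le> R \<and>
      (\<forall>d\<in>set ds. \<bar>nf d (S v - v)\<bar> \<le> inverse (real (Suc (length ds))))"
    proof (cases "set ds \<subseteq> V")
      case True
      have "\<exists>u\<in>V. N u \<le> R \<and> (\<forall>\<phi>\<in>set (map nf ds). \<bar>\<phi> (S u - u)\<bar> \<le> inverse (real (Suc (length ds))))"
      proof (rule approximate_fixed_point[where S = S and R = R])
        show "bounded_functional V N \<phi>" if "\<phi> \<in> set (map nf ds)" for \<phi>
          using that True nf(1) by auto
        show "weakly_converges V N (\<lambda>n. S (x n)) (S g)"
          if "weakly_converges V N x g" "\<And>n. N (x n) \<le> R" "N g \<le> R" for x g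
          using that by (rule S)
      qed (use SV ball R in auto)
      then show ?thesis by auto
    qed simp
  qed
  then obtain pt where pt: "\<And>ds. set ds \<subseteq> V \<Longrightarrow> pt ds \<in> V" "\<And>ds. set ds \<subseteq> V \<Longrightarrow> N (pt ds) \<le> R"
    "\<And>ds d. set ds \<subseteq> V \<Longrightarrow> d \<in> set ds \<Longrightarrow>
       \<bar>nf d (S (pt ds) - pt ds)\<bar> \<le> inverse (real (Suc (length ds)))"
    by blast
  define step where "step A = A \<union> (\<lambda>((a, b), (x, y)). a *\<^sub>R x + b *\<^sub>R y) ` ((\<rat> \<times> \<rat>) \<times> (A \<times> A)) \<union>
    S ` A \<union> pt ` lists A" for A
  define D where "D n = (step ^^ n) {0}" for n
  define DD where "DD = (\<Union>n. D n)"
  have D_Suc: "D (Suc n) = step (D n)" for n by (simp add: D_def)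
  have D_mono: "D m \<subseteq> D n" if "m \<le> n" for m n
    using that by (rule lift_Suc_mono_le[rotated]) (auto simp: D_Suc step_def)
  have DV: "D n \<subseteq> V" for n
  proof (induction n)
    case (Suc n)
    then show ?case
      using SV pt(1) by (auto simp: D_Suc step_def subset_iff lists_eq_set intro!: in_V)
  qed (simp add: D_def)
  then have DDV: "d \<in> V" if "d \<in> DD" for d
    using that by (auto simp: DD_def)
  have "countable (D n)" for n
  proof (induction n)
    case (Suc n)
    then show ?case
      unfolding D_Suc step_def by (intro countable_Un countable_image countable_SIGMA countable_rat countable_lists)
  qed (simp add: D_def)
  then have DD_countable: "countable DD" by (simp add: DD_def)
  have DD0: "0 \<in> DD" by (auto simp: DD_def D_def intro: exI[of _ 0])
  have DD_comb: "a *\<^sub>R x + b *\<^sub>R y \<in> DD" if "x \<in> DD" "y \<in> DD" "a \<in> \<rat>" "b \<in> \<rat>" for a b x y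
  proof -
    obtain m n where "x \<in> D m" "y \<in> D n" using \<open>x \<in> DD\<close> \<open>y \<in> DD\<close> unfolding DD_def by blast
    then have "x \<in> D (max m n)" "y \<in> D (max m n)"
      using D_mono[of m "max m n"] D_mono[of n "max m n"] by auto
    then have "a *\<^sub>R x + b *\<^sub>R y \<in> D (Suc (max m n))"
      unfolding D_Suc step_def using that(3,4) by (intro UnI1 UnI2 rev_image_eqI[of "((a, b), (x, y))"]) auto
    then show ?thesis by (auto simp: DD_def)
  qed
  have DD_S: "S x \<in> DD" if "x \<in> DD" for x
  proof -
    obtain n where "x \<in> D n" using \<open>x \<in> DD\<close> by (auto simp: DD_def)
    then have "S x \<in> D (Suc n)" by (auto simp: D_Suc step_def)
    then show ?thesis by (auto simp: DD_def)
  qed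
  have DD_pt: "pt ds \<in> DD" if "set ds \<subseteq> DD" for ds
  proof -
    have "\<exists>n. set ds \<subseteq> D n" using that
    proof (induction ds)
      case (Cons d ds)
      then obtain m n where mn: "set ds \<subseteq> D m" "d \<in> D n" by (auto simp: DD_def)
      then show ?case
        using D_mono[of m "max m n"] D_mono[of n "max m n"] by (intro exI[of _ "max m n"]) auto
    qed auto
    then obtain n where "set ds \<subseteq> D n" by blast
    then have "pt ds \<in> D (Suc n)" by (auto simp: D_Suc step_def lists_eq_set)
    then show ?thesis by (auto simp: DD_def)
  qed
  \<comment> \<open>A is the closure of DD. Although DD is closed only under rational combinations,
    A is a subspace, as real coefficients are approximated by rational ones. Hence A contains the
    tail limits of sequences in DD.\<close>
  define A where "A = {v \<in> V. \<forall>e>0. \<exists>d\<in>DD. N (d - v) < e}"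
  have DD_A: "DD \<subseteq> A"
  proof
    fix d assume d: "d \<in> DD"
    then have "N (d - d) < e" if "e > 0" for e using that by simp
    with d DDV show "d \<in> A" unfolding A_def by blast
  qed
  have A_approx: "\<exists>d\<in>DD. N (d - v) < e" if "v \<in> A" "e > 0" for v e
    using that by (simp add: A_def)
  have A_add: "v + w \<in> A" if v: "v \<in> A" and w: "w \<in> A" for v w
  proof -
    have "\<exists>d\<in>DD. N (d - (v + w)) < e" if e: "e > 0" for e
    proof -
      obtain c d where cd: "c \<in> DD" "d \<in> DD" "N (c - v) < e / 2" "N (d - w) < e / 2"
        using A_approx[OF v, of "e / 2"] A_approx[OF w, of "e / 2"] e by auto
      have "N ((c - v) + (d - w)) \<le> N (c - v) + N (d - w)"
        using cd v w DDV by (intro triangle) (auto simp: A_def)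
      moreover have "c + d \<in> DD" using DD_comb[OF cd(1,2), of 1 1] by simp
      ultimately show ?thesis
        using cd by (intro bexI[of _ "c + d"]) (auto simp: algebra_simps)
    qed
    then show ?thesis using v w by (auto simp: A_def)
  qed
  have A_scale: "a *\<^sub>R v \<in> A" if v: "v \<in> A" for a v
  proof -
    have vV: "v \<in> V" using v by (simp add: A_def)
    have "\<exists>d\<in>DD. N (d - a *\<^sub>R v) < e" if e: "e > 0" for e
    proof -
      define s where "s = min 1 (e / (2 * (\<bar>a\<bar> + 1)))"
      have s: "s > 0" "s \<le> e / (2 * (\<bar>a\<bar> + 1))"
        using e by (auto simp: s_def)
      have as: "\<bar>a\<bar> * s \<le> e / 2"
      proof -
        have "\<bar>a\<bar> * s \<le> (\<bar>a\<bar> + 1) * (e / (2 * (\<bar>a\<bar> + 1)))"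
          using s by (intro mult_mono) auto
        also have "\<dots> = e / 2" by (simp add: field_simps add_eq_0_iff)
        finally show ?thesis .
      qed
      obtain d where d: "d \<in> DD" "N (d - v) < s"
        using A_approx[OF v s(1)] by blast
      define t where "t = e / (2 * (N d + 1))"
      have Nd: "N d \<ge> 0" using d DDV N_nonneg by auto
      have t: "t > 0" using Nd e by (simp add: t_def)
      obtain q where q: "q \<in> \<rat>" "a < q" "q < a + t"
        using Rats_dense_in_real[of a "a + t"] t by auto
      have "N (q *\<^sub>R d - a *\<^sub>R v) = N ((q - a) *\<^sub>R d + a *\<^sub>R (d - v))"
        by (simp add: algebra_simps)
      also have "\<dots> \<le> N ((q - a) *\<^sub>R d) + N (a *\<^sub>R (d - v))"
        using d DDV vV by (intro triangle) auto
      also have "\<dots> = \<bar>q - a\<bar> * N d + \<bar>a\<bar> * N (d - v)"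
        using d DDV vV by (simp add: scale)
      also have "\<dots> \<le> \<bar>q - a\<bar> * N d + e / 2"
      proof -
        have "\<bar>a\<bar> * N (d - v) \<le> \<bar>a\<bar> * s" using d by (intro mult_left_mono) auto
        then show ?thesis using as by simp
      qed
      also have "\<bar>q - a\<bar> * N d \<le> t * N d"
        using q Nd by (intro mult_right_mono) auto
      also have "t * N d < e / 2"
        using Nd e by (simp add: t_def field_simps)
      finally have "N (q *\<^sub>R d - a *\<^sub>R v) < e" by simp
      moreover have "q *\<^sub>R d \<in> DD" using DD_comb[OF d(1) d(1) q(1), of 0] by simp
      ultimately show ?thesis by blast
    qed
    then show ?thesis using vV by (auto simp: A_def)
  qed
  have A_subspace: "subspace A"
    using A_add A_scale DD0 DD_A by (auto simp: subspace_def)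
  have A_tail: "g \<in> A" if x: "\<And>n. x n \<in> DD" and g: "tail_limit x g" for x g
  proof -
    have hull: "convex hull (x ` {0..}) \<subseteq> A"
      using x DD_A A_subspace by (intro hull_minimal subspace_imp_convex) auto
    have gV: "g \<in> V" using g by (simp add: tail_limit_def)
    have "\<exists>d\<in>DD. N (d - g) < e" if e: "e > 0" for e
    proof -
      obtain c where c: "c \<in> convex hull (x ` {0..})" "N (c - g) < e / 2"
        using g e unfolding tail_limit_def by (meson half_gt_zero)
      then have cA: "c \<in> A" using hull by blast
      then obtain d where d: "d \<in> DD" "N (d - c) < e / 2"
        using e A_approx[OF cA, of "e / 2"] by auto
      have "N (d - g) \<le> N (d - c) + N (c - g)"
        using d DDV cA gV by (intro N_triangle_sub) (auto simp: A_def)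
      then show ?thesis using c d by (intro bexI[of _ d]) auto
    qed
    then show ?thesis using gV by (auto simp: A_def)
  qed
  \<comment> \<open>For d close to v, the norming functional of d gives N d = nf d (d - v) <= N (d -
    v) if it vanishes at v; so N v is at most 2 N (d - v).\<close>
  have separating: "N v = 0" if v: "v \<in> A" and zero: "\<And>d. d \<in> DD \<Longrightarrow> nf d v = 0" for v
  proof -
    have vV: "v \<in> V" using v by (simp add: A_def)
    have "N v \<le> 0"
    proof (rule field_le_epsilon)
      fix e :: real assume "e > 0"
      then obtain d where d: "d \<in> DD" "N (d - v) < e / 2"
        using A_approx[OF v, of "e / 2"] by auto
      have dV: "d \<in> V" using d DDV by blast
      have "N d = nf d (d - v)"
        using nf(2)[OF dV] zero[OF d(1)] bf_diff[OF nf(1)[OF dV] dV vV] by simp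
      also have "\<dots> \<le> N (d - v)" using nf(3)[OF dV, of "d - v"] dV vV by auto
      finally show "N v \<le> 0 + e"
        using d(2) N_le_diff[OF vV dV] N_commute[OF vV dV] by linarith
    qed
    then show ?thesis using N_nonneg[OF vV] by simp
  qed
  define d where "d = from_nat_into DD"
  have d_range: "range d = DD"
    unfolding d_def using DD0 DD_countable by (intro range_from_nat_into) auto
  then have dDD: "d j \<in> DD" for j by auto
  \<comment> \<open>\<open>u n\<close> uses the first n elements of an enumeration of DD, so
    \<open>nf (d j)\<close> is taken into account by all \<open>u n\<close> with n > j.\<close>
  define u where "u n = pt (map d [0..<n])" for n
  have setd: "set (map d [0..<n]) \<subseteq> V" "set (map d [0..<n]) \<subseteq> DD" for n
    using DDV dDD by auto
  have uDD: "u n \<in> DD" and uV: "u n \<in> V" and uR: "N (u n) \<le> R" for n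
    unfolding u_def using setd pt DD_pt by blast+
  have u_approx: "\<bar>nf (d j) (S (u n) - u n)\<bar> \<le> inverse (real (Suc n))" if "j < n" for j n
    using pt(3)[OF setd(1)[of n], of "d j"] that by (auto simp: u_def)
  have "\<bar>nf (d j) (u n)\<bar> \<le> R" for n j
    using nf(3)[OF DDV[OF dDD] uV] uR by (rule order_trans)
  then obtain l r where r: "strict_mono r" and l: "\<And>j. (\<lambda>n. nf (d j) (u (r n))) \<longlonglongrightarrow> l j"
    using coordinatewise_convergent_subsequence[where a = "\<lambda>n j. nf (d j) (u n)" and b = "\<lambda>_. R"] by blast
  obtain g where g: "tail_limit (\<lambda>n. u (r n)) g"
    using tail_limit_exists[of "\<lambda>n. u (r n)" R] uV uR by blast
  have gV: "g \<in> V" using g by (simp add: tail_limit_def)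
  have gR: "N g \<le> R" using tail_limit_N_le[OF _ _ g] uV uR by blast
  have gA: "g \<in> A" using A_tail[OF _ g] uDD by blast
  have g_nf: "nf (d j) g = l j" for j
    using tail_limit_functional[OF _ g nf(1)[OF DDV[OF dDD]] l] uV by blast
  \<comment> \<open>Tail limits of subsequences lie in A, and the functionals
    \<open>nf (d j)\<close> take the values \<open>l j\<close> on them; by \<open>separating\<close>
    they are all at distance 0 from g.\<close>
  have "weakly_converges V N (\<lambda>n. u (r n)) g"
  proof (rule weakly_converges_if_tail_limits)
    fix s h assume s: "strict_mono (s :: nat \<Rightarrow> nat)" and h: "tail_limit (\<lambda>n. u (r (s n))) h"
    have hA: "h \<in> A" using A_tail[OF _ h] uDD by blast
    have "nf (d j) h = l j" for j
      using tail_limit_functional[OF _ h nf(1)[OF DDV[OF dDD]] LIMSEQ_subseq_LIMSEQ[OF l s, unfolded o_def]] uV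
      by blast
    then have "nf c (h - g) = 0" if "c \<in> DD" for c
      using that d_range g_nf hA gV bf_diff[OF nf(1)[OF DDV[OF that]]] by (auto simp: A_def)
    moreover have "h - g \<in> A" using hA gA A_subspace by (intro subspace_diff)
    ultimately show "N (h - g) = 0" by (intro separating)
  qed (use uV uR gV in auto)
  then have Sg: "weakly_converges V N (\<lambda>n. S (u (r n))) (S g)"
    by (rule S) (use uR gR in auto)
  \<comment> \<open>That S g belongs to A is not evident, since S is only weakly continuous. The
    tail limit h of the images, which are in DD, does belong to A and is at distance 0 from S g; so
    \<open>separating\<close> is applied to h - g.\<close>
  obtain h where h: "tail_limit (\<lambda>n. S (u (r n))) h"
    using tail_limit_exists[of "\<lambda>n. S (u (r n))" R] uV uR SV ball by blast
  have hA: "h \<in> A" using A_tail[OF _ h] uDD DD_S by blast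
  then have hV: "h \<in> V" by (simp add: A_def)
  have hS: "N (h - S g) = 0" using tail_limit_weakly_converges[OF Sg h] .
  have "nf (d j) (h - g) = 0" for j
  proof -
    note bf = nf(1)[OF DDV[OF dDD], of j]
    have "(\<lambda>n. nf (d j) (S (u (r n)) - u (r n))) \<longlonglongrightarrow> 0"
    proof (rule Lim_null_comparison)
      show "\<forall>\<^sub>F n in sequentially. norm (nf (d j) (S (u (r n)) - u (r n))) \<le> inverse (real (Suc n))"
      proof (rule eventually_sequentiallyI[of "Suc j"])
        fix n assume n: "Suc j \<le> n"
        have "n \<le> r n" using r by (rule seq_suble)
        then have "\<bar>nf (d j) (S (u (r n)) - u (r n))\<bar> \<le> inverse (real (Suc (r n)))"
          using n by (intro u_approx) auto
        also have "\<dots> \<le> inverse (real (Suc n))"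
          using \<open>n \<le> r n\<close> by (intro le_imp_inverse_le) auto
        finally show "norm (nf (d j) (S (u (r n)) - u (r n))) \<le> inverse (real (Suc n))" by simp
      qed
    qed (rule LIMSEQ_inverse_real_of_nat)
    moreover have "(\<lambda>n. nf (d j) (S (u (r n)) - u (r n))) \<longlonglongrightarrow> nf (d j) (S g) - nf (d j) g"
      using tendsto_diff[OF _ l[of j]] Sg bf uV SV g_nf by (simp add: bf_diff weakly_converges_def)
    ultimately have "nf (d j) (S g) = nf (d j) g"
      using LIMSEQ_unique by fastforce
    moreover have "nf (d j) h = nf (d j) (S g)"
      using bf hV SV gV hS by (intro bf_eq) auto
    ultimately show ?thesis using bf hV gV by (simp add: bf_diff)
  qed
  then have "N (h - g) = 0"
    using d_range hA gA A_subspace by (intro separating subspace_diff) auto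
  then have "N (S g - g) = 0"
    using N_triangle_sub[of "S g" h g] N_commute[of "S g" h] hS hV gV SV N_nonneg[of "S g - g"] by auto
  then show ?thesis using gV gR by blast
qed

end

section \<open>Strong measurability and Lebesgue-Bochner spaces\<close>

lemma scaleR_fun_apply [simp]: "(c *\<^sub>R f) x = c *\<^sub>R f x"
  by (simp add: scaleR_fun_def)

text \<open>Completeness lets measurability pass to functions that agree almost everywhere and to
  almost everywhere limits. Finiteness makes constants integrable and all simple functions Bochner
  integrable.\<close>

locale complete_finite_measure = finite_measure M + complete_measure M for M :: "'a measure"
begin

abbreviation smeas :: "('a \<Rightarrow> 'b::real_normed_vector) \<Rightarrow> bool" where
  "smeas \<equiv> strongly_measurable M UNIV norm"

lemma smeas_iff:
  "smeas f \<longleftrightarrow> (\<exists>s. (\<forall>n::nat. simple_function M (s n)) \<and> (AE t in M. (\<lambda>n. s n t) \<longlonglongrightarrow> f t))"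
  by (simp add: strongly_measurable_def tendsto_norm_zero_iff LIM_zero_iff)

lemma smeas_simple: "simple_function M f \<Longrightarrow> smeas f"
  unfolding smeas_iff by (intro exI[of _ "\<lambda>_. f"]) auto

lemma smeas_const [simp]: "smeas (\<lambda>_. c)"
  by (intro smeas_simple) simp

text \<open>The map h is applied to the approximating simple functions, so its continuity is asked
  for only at almost every value of the pair. This leeway serves for x / (1 - norm x), which is
  continuous off the unit sphere.\<close>

lemma smeas_comp2:
  assumes f: "smeas f" and g: "smeas g"
    and h: "AE t in M. isCont (\<lambda>z. h (fst z) (snd z)) (f t, g t)"
  shows "smeas (\<lambda>t. h (f t) (g t))"
proof -
  obtain r s where r: "\<And>n. simple_function M (r n)" "AE t in M. (\<lambda>n. r n t) \<longlonglongrightarrow> f t"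
    and s: "\<And>n. simple_function M (s n)" "AE t in M. (\<lambda>n. s n t) \<longlonglongrightarrow> g t"
    using f g unfolding smeas_iff by blast
  have "AE t in M. (\<lambda>n::nat. h (r n t) (s n t)) \<longlonglongrightarrow> h (f t) (g t)"
    using r(2) s(2) h
  proof eventually_elim
    case (elim t)
    then show ?case using isCont_tendsto_compose[OF elim(3) tendsto_Pair[OF elim(1,2)]] by simp
  qed
  then show ?thesis
    unfolding smeas_iff using r(1) s(1) by (intro exI[of _ "\<lambda>n t. h (r n t) (s n t)"]) (auto intro: simple_function_compose2)
qed

lemma smeas_comp:
  assumes f: "smeas f" and h: "AE t in M. isCont h (f t)"
  shows "smeas (\<lambda>t. h (f t))"
proof (rule smeas_comp2[OF f f, where h = "\<lambda>x y. h x"])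
  show "AE t in M. isCont (\<lambda>z. h (fst z)) (f t, f t)"
    using h
  proof eventually_elim
    case (elim t)
    then show ?case using isCont_o2[where f = fst and a = "(f t, f t)" and g = h] by simp
  qed
qed

lemma smeas_AE_cong:
  assumes "smeas f" "AE t in M. f t = g t"
  shows "smeas g"
proof -
  obtain r where r: "\<And>n. simple_function M (r n)" "AE t in M. (\<lambda>n. r n t) \<longlonglongrightarrow> f t"
    using assms(1) unfolding smeas_iff by blast
  have "AE t in M. (\<lambda>n. r n t) \<longlonglongrightarrow> g t"
    using r(2) assms(2) by eventually_elim simp
  with r(1) show ?thesis unfolding smeas_iff by blast
qed

lemma smeas_add: "smeas f \<Longrightarrow> smeas g \<Longrightarrow> smeas (\<lambda>t. f t + g t)"
  and smeas_diff: "smeas f \<Longrightarrow> smeas g \<Longrightarrow> smeas (\<lambda>t. f t - g t)"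
  using smeas_comp2[where h = "(+)", OF _ _ AE_I2] smeas_comp2[where h = "(-)", OF _ _ AE_I2]
  by (simp_all add: continuous_intros)

lemma smeas_scaleR: "smeas f \<Longrightarrow> smeas g \<Longrightarrow> smeas (\<lambda>t. f t *\<^sub>R g t)"
  using smeas_comp2[where h = "(*\<^sub>R)", OF _ _ AE_I2] by (simp add: continuous_intros)

lemma smeas_cmul: "smeas g \<Longrightarrow> smeas (\<lambda>t. c *\<^sub>R g t)"
  by (rule smeas_scaleR[OF smeas_const])

lemma borel_measurable_AE_cong:
  fixes f g :: "'a \<Rightarrow> 'c::topological_space"
  assumes f: "f \<in> borel_measurable M" and eq: "AE t in M. f t = g t"
  shows "g \<in> borel_measurable M"
proof (rule measurableI)
  fix A :: "'c set" assume A: "A \<in> sets borel"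
  show "g -` A \<inter> space M \<in> sets M"
  proof (rule in_sets_AE[where A = "f -` A \<inter> space M"])
    show "AE t in M. t \<in> f -` A \<inter> space M \<longleftrightarrow> t \<in> g -` A \<inter> space M"
      using eq by eventually_elim auto
  qed (use measurable_sets[OF f A] in auto)
qed auto

lemma borel_measurable_LIMSEQ_AE:
  fixes s :: "nat \<Rightarrow> 'a \<Rightarrow> real"
  assumes s: "\<And>n. s n \<in> borel_measurable M" and lim: "AE t in M. (\<lambda>n. s n t) \<longlonglongrightarrow> f t"
  shows "f \<in> borel_measurable M"
proof -
  define Z where "Z = {t \<in> space M. \<not> (\<lambda>n. s n t) \<longlonglongrightarrow> f t}"
  have Z: "Z \<in> null_sets M" using lim by (simp add: AE_iff_null_sets Z_def)
  have "(\<lambda>t. if t \<in> Z then 0 else f t) \<in> borel_measurable M"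
  proof (rule borel_measurable_LIMSEQ_metric)
    show "(\<lambda>t. if t \<in> Z then 0 else s n t) \<in> borel_measurable M" for n
      using s Z by (intro measurable_If_set) auto
    show "(\<lambda>n. if t \<in> Z then 0 else s n t) \<longlonglongrightarrow> (if t \<in> Z then 0 else f t)" if "t \<in> space M" for t
      using that by (auto simp: Z_def)
  qed
  moreover have "AE t in M. (if t \<in> Z then 0 else f t) = f t"
    using AE_not_in[OF Z] by eventually_elim simp
  ultimately show ?thesis by (rule borel_measurable_AE_cong)
qed

lemma smeas_real_iff: "smeas (f :: 'a \<Rightarrow> real) \<longleftrightarrow> f \<in> borel_measurable M"
proof
  assume "smeas f"
  then obtain s where s: "\<And>n::nat. simple_function M (s n)" "AE t in M. (\<lambda>n. s n t) \<longlonglongrightarrow> f t"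
    unfolding smeas_iff by blast
  show "f \<in> borel_measurable M"
    by (rule borel_measurable_LIMSEQ_AE[OF borel_measurable_simple_function[OF s(1)] s(2)])
next
  assume "f \<in> borel_measurable M"
  from borel_measurable_implies_sequence_metric[OF this, of 0]
  obtain F where F: "\<forall>i. simple_function M (F i)" "\<forall>x\<in>space M. (\<lambda>i. F i x) \<longlonglongrightarrow> f x"
    by blast
  show "smeas f"
    unfolding smeas_iff
  proof (intro exI[of _ F] conjI)
    show "AE t in M. (\<lambda>n. F n t) \<longlonglongrightarrow> f t" by (rule AE_I2) (use F(2) in blast)
  qed (rule F(1))
qed

lemma smeas_norm: "smeas f \<Longrightarrow> (\<lambda>t. norm (f t)) \<in> borel_measurable M"
  unfolding smeas_real_iff[symmetric]
  by (rule smeas_comp[where h = norm]) (simp_all add: continuous_intros)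

lemma smeas_indicator:
  assumes "smeas f" "A \<in> sets M"
  shows "smeas (\<lambda>t. indicator A t *\<^sub>R f t)"
  by (rule smeas_scaleR[OF _ assms(1)]) (use assms(2) in \<open>simp add: smeas_real_iff\<close>)

lemma smeas_sum: "(\<And>i. i \<in> I \<Longrightarrow> smeas (f i)) \<Longrightarrow> smeas (\<lambda>t. \<Sum>i\<in>I. f i t)"
proof (induction I rule: infinite_finite_induct)
  case (insert i I)
  then have "smeas (\<lambda>t. f i t + (\<Sum>i\<in>I. f i t))"
    by (intro smeas_add) simp_all
  with insert show ?case by simp
qed simp_all

text \<open>The simple function is replaced by 0 wherever its norm exceeds twice that of f. Where f
  vanishes this leaves 0; elsewhere the factor 2 leaves room, so the cut-off is eventually
  inactive.\<close>

lemma smeas_dominated_approx: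
  assumes "smeas f"
  obtains s where "\<And>n::nat. simple_function M (s n)" "AE t in M. (\<lambda>n. s n t) \<longlonglongrightarrow> f t"
    "\<And>n t. norm (s n t) \<le> 2 * norm (f t)"
proof -
  obtain s where s: "\<And>n::nat. simple_function M (s n)" "AE t in M. (\<lambda>n. s n t) \<longlonglongrightarrow> f t"
    using assms unfolding smeas_iff by blast
  define r where "r n t = (if norm (s n t) \<le> 2 * norm (f t) then s n t else 0)" for n t
  have "simple_function M (r n)" for n
  proof -
    let ?A = "{t \<in> space M. norm (s n t) \<le> 2 * norm (f t)}"
    have [measurable]: "(\<lambda>t. norm (s n t)) \<in> borel_measurable M" "(\<lambda>t. norm (f t)) \<in> borel_measurable M"
      using s(1) assms by (auto intro: smeas_norm smeas_simple)
    have "?A \<in> sets M" by measurable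
    then have "simple_function M (\<lambda>t. indicator ?A t *\<^sub>R s n t)"
      using s(1) by (intro simple_function_compose2[where h = "\<lambda>c x. c *\<^sub>R x"]) auto
    moreover have "r n t = indicator ?A t *\<^sub>R s n t" if "t \<in> space M" for t
      using that by (auto simp: r_def indicator_def)
    ultimately show ?thesis
      by (subst simple_function_cong) auto
  qed
  moreover have "AE t in M. (\<lambda>n. r n t) \<longlonglongrightarrow> f t"
    using s(2)
  proof eventually_elim
    case (elim t)
    show ?case
    proof (cases "f t = 0")
      case True
      then have "r n t = 0" for n by (auto simp: r_def)
      then show ?thesis using True by simp
    next
      case False
      have "\<forall>\<^sub>F n in sequentially. norm (s n t) < 2 * norm (f t)"
        using tendsto_norm[OF elim] False by (intro order_tendstoD) auto
      then have "\<forall>\<^sub>F n in sequentially. s n t = r n t"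
        by eventually_elim (simp add: r_def)
      then show ?thesis using elim by (rule Lim_transform_eventually[rotated])
    qed
  qed
  moreover have "norm (r n t) \<le> 2 * norm (f t)" for n t
    by (auto simp: r_def)
  ultimately show thesis by (rule that)
qed

end

section \<open>Lebesgue-Bochner spaces: triangle inequality, dominated convergence,
  completeness\<close>

lemma powr_add_le:
  fixes a b p :: real
  assumes "0 \<le> a" "0 \<le> b" "0 \<le> p"
  shows "(a + b) powr p \<le> 2 powr p * (a powr p + b powr p)"
proof -
  have "(a + b) powr p \<le> (2 * max a b) powr p"
    using assms by (intro powr_mono2) auto
  also have "\<dots> = 2 powr p * max a b powr p"
    using assms by (simp add: powr_mult)
  also have "\<dots> \<le> 2 powr p * (a powr p + b powr p)"
    by (intro mult_left_mono) (auto simp: max_def)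
  finally show ?thesis .
qed

lemma powr_convex_combination:
  fixes a b p s t :: real
  assumes "0 \<le> a" "0 \<le> b" "1 \<le> p" "0 \<le> s" "0 \<le> t" "s + t = 1"
  shows "(s * a + t * b) powr p \<le> s * a powr p + t * b powr p"
proof -
  \<comment> \<open>Convexity of x^p is used on the positive reals; if one argument is 0 the claim
    reduces to (c x)^p <= c x^p for c in [0,1].\<close>
  have z: "(c * x) powr p \<le> c * x powr p" if "0 \<le> c" "c \<le> 1" "0 \<le> x" for c x :: real
  proof -
    have "c powr p \<le> c"
      using that assms powr_mono'[of 1 p c] by (cases "c = 0") auto
    then show ?thesis using that by (simp add: powr_mult mult_right_mono)
  qed
  consider "a = 0" | "b = 0" | "a > 0" "b > 0" using assms by linarith
  then show ?thesis
  proof cases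
    case 3
    then show ?thesis
      using convex_onD[OF powr_convex[OF assms(3)], of t a b] assms
      by (simp add: algebra_simps flip: eq_diff_eq)
  qed (use z assms in auto)
qed

context complete_finite_measure
begin

context
  fixes p :: real
  assumes p: "1 \<le> p"
begin

lemma LpD: "u \<in> Lp_space M p \<Longrightarrow> smeas u" "u \<in> Lp_space M p \<Longrightarrow> integrable M (\<lambda>t. norm (u t) powr p)"
  by (auto simp: Lp_space_def)

lemma smeas_norm_powr: "smeas u \<Longrightarrow> (\<lambda>t. norm (u t) powr p) \<in> borel_measurable M"
  using smeas_norm by measurable

lemma Lp_dominated:
  assumes u: "smeas u" and h: "integrable M (\<lambda>t. h t powr p)" and le: "AE t in M. norm (u t) \<le> h t"
  shows "u \<in> Lp_space M p"
proof -
  have "integrable M (\<lambda>t. norm (u t) powr p)"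
  proof (rule Bochner_Integration.integrable_bound[OF h smeas_norm_powr[OF u]])
    show "AE t in M. norm (norm (u t) powr p) \<le> norm (h t powr p)"
      using le by eventually_elim (use p in \<open>auto intro!: powr_mono2\<close>)
  qed
  with u show ?thesis by (simp add: Lp_space_def)
qed

lemma Lp_norm_powr: "Lp_norm M p u powr p = (\<integral>t. norm (u t) powr p \<partial>M)"
proof -
  have "0 \<le> (\<integral>t. norm (u t) powr p \<partial>M)" by (intro integral_nonneg_AE) auto
  then show ?thesis using p by (simp add: Lp_norm_def powr_powr)
qed

lemma Lp_norm_nonneg: "0 \<le> Lp_norm M p u"
  by (simp add: Lp_norm_def)

lemma Lp_norm_le_iff: "0 \<le> c \<Longrightarrow> Lp_norm M p u \<le> c \<longleftrightarrow> (\<integral>t. norm (u t) powr p \<partial>M) \<le> c powr p"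
proof -
  assume c: "0 \<le> c"
  have "Lp_norm M p u powr p \<le> c powr p" if "Lp_norm M p u \<le> c"
    using that p Lp_norm_nonneg by (intro powr_mono2) auto
  moreover have "c powr p < Lp_norm M p u powr p" if "c < Lp_norm M p u"
    using that p c by (intro powr_less_mono2) auto
  ultimately show ?thesis
    unfolding Lp_norm_powr[symmetric] by linarith
qed

lemma Lp_norm_tendsto_0_iff:
  "((\<lambda>n. Lp_norm M p (u n)) \<longlongrightarrow> 0) F \<longleftrightarrow> ((\<lambda>n. \<integral>t. norm (u n t) powr p \<partial>M) \<longlongrightarrow> 0) F"
proof
  assume "((\<lambda>n. Lp_norm M p (u n)) \<longlongrightarrow> 0) F"
  then have "((\<lambda>n. Lp_norm M p (u n) powr p) \<longlongrightarrow> 0 powr p) F"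
    using p by (intro tendsto_powr') (auto intro!: always_eventually Lp_norm_nonneg)
  then show "((\<lambda>n. \<integral>t. norm (u n t) powr p \<partial>M) \<longlongrightarrow> 0) F"
    by (simp add: Lp_norm_powr)
next
  assume "((\<lambda>n. \<integral>t. norm (u n t) powr p \<partial>M) \<longlongrightarrow> 0) F"
  then have "((\<lambda>n. (\<integral>t. norm (u n t) powr p \<partial>M) powr (1 / p)) \<longlongrightarrow> 0 powr (1 / p)) F"
    using p by (intro tendsto_powr') (auto intro!: always_eventually integral_nonneg_AE)
  then show "((\<lambda>n. Lp_norm M p (u n)) \<longlongrightarrow> 0) F"
    by (simp add: Lp_norm_def)
qed

lemma Lp_zero: "0 \<in> Lp_space M p"
  using p by (auto simp: Lp_space_def zero_fun_def)

lemma Lp_add: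
  assumes u: "u \<in> Lp_space M p" and v: "v \<in> Lp_space M p"
  shows "u + v \<in> Lp_space M p"
proof -
  have "integrable M (\<lambda>t. norm (u t + v t) powr p)"
  proof (rule Bochner_Integration.integrable_bound)
    show "integrable M (\<lambda>t. 2 powr p * (norm (u t) powr p + norm (v t) powr p))"
      using u v by (intro integrable_mult_right Bochner_Integration.integrable_add LpD)
    show "(\<lambda>t. norm (u t + v t) powr p) \<in> borel_measurable M"
      using u v by (intro smeas_norm_powr smeas_add LpD)
    show "AE t in M. norm (norm (u t + v t) powr p) \<le> norm (2 powr p * (norm (u t) powr p + norm (v t) powr p))"
    proof (rule AE_I2)
      fix t
      have "norm (u t + v t) powr p \<le> (norm (u t) + norm (v t)) powr p"
        using p by (intro powr_mono2 norm_triangle_ineq) auto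
      also have "\<dots> \<le> 2 powr p * (norm (u t) powr p + norm (v t) powr p)"
        using p by (intro powr_add_le) auto
      finally show "norm (norm (u t + v t) powr p) \<le> norm (2 powr p * (norm (u t) powr p + norm (v t) powr p))"
        by simp
    qed
  qed
  then show ?thesis
    using smeas_add[OF LpD(1)[OF u] LpD(1)[OF v]] by (simp add: Lp_space_def plus_fun_def)
qed

lemma Lp_scaleR:
  assumes u: "u \<in> Lp_space M p"
  shows "c *\<^sub>R u \<in> Lp_space M p"
  using smeas_cmul[OF LpD(1)[OF u], of c] LpD(2)[OF u]
  by (simp add: Lp_space_def scaleR_fun_def powr_mult)

lemma Lp_norm_scaleR: "Lp_norm M p (c *\<^sub>R u) = \<bar>c\<bar> * Lp_norm M p u"
proof -
  have "(\<integral>t. norm ((c *\<^sub>R u) t) powr p \<partial>M) = \<bar>c\<bar> powr p * (\<integral>t. norm (u t) powr p \<partial>M)"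
    by (simp add: powr_mult)
  then show ?thesis
    using p by (simp add: Lp_norm_def powr_mult powr_powr integral_nonneg_AE)
qed

lemma Lp_norm_AE_0:
  assumes "AE t in M. u t = 0" shows "Lp_norm M p u = 0"
proof -
  have "(\<integral>t. norm (u t) powr p \<partial>M) = (\<integral>t. 0 \<partial>M)"
  proof (rule integral_cong_AE)
    show ae: "AE t in M. norm (u t) powr p = 0"
      using assms by eventually_elim simp
    show "(\<lambda>t. norm (u t) powr p) \<in> borel_measurable M"
    proof (rule borel_measurable_AE_cong[of "\<lambda>_. 0"])
      show "AE t in M. 0 = norm (u t) powr p" using ae by eventually_elim simp
    qed simp
  qed simp
  then show ?thesis by (simp add: Lp_norm_def)
qed

lemma Lp_norm_eq_0_AE:
  assumes u: "u \<in> Lp_space M p" and "Lp_norm M p u = 0"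
  shows "AE t in M. u t = 0"
proof -
  have "(\<integral>t. norm (u t) powr p \<partial>M) = 0"
    using Lp_norm_powr[of u] assms(2) by simp
  then have "AE t in M. norm (u t) powr p = 0"
    using integral_nonneg_eq_0_iff_AE[OF LpD(2)[OF u]] by simp
  then show ?thesis by eventually_elim simp
qed

text \<open>Convexity of x^p applied to the normalised functions u/a and v/b with weights a/(a + b)
  and b/(a + b). The added e/2 keeps a and b positive even if a norm is 0.\<close>

lemma Lp_norm_triangle:
  assumes u: "u \<in> Lp_space M p" and v: "v \<in> Lp_space M p"
  shows "Lp_norm M p (u + v) \<le> Lp_norm M p u + Lp_norm M p v"
proof (rule field_le_epsilon)
  fix e :: real assume e: "e > 0"
  define a where "a = Lp_norm M p u + e / 2"
  define b where "b = Lp_norm M p v + e / 2"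
  have ab: "a > 0" "b > 0" using e Lp_norm_nonneg[of u] Lp_norm_nonneg[of v] by (auto simp: a_def b_def)
  define s where "s = a / (a + b)"
  define t where "t = b / (a + b)"
  have st: "0 \<le> s" "0 \<le> t" "s + t = 1" "s / a = 1 / (a + b)" "t / b = 1 / (a + b)"
    using ab by (auto simp: s_def t_def add_divide_distrib[symmetric])
  have Iu: "(\<integral>x. norm (u x) powr p \<partial>M) \<le> a powr p"
    using e Lp_norm_nonneg[of u] by (subst Lp_norm_le_iff[symmetric]) (auto simp: a_def)
  have Iv: "(\<integral>x. norm (v x) powr p \<partial>M) \<le> b powr p"
    using e Lp_norm_nonneg[of v] by (subst Lp_norm_le_iff[symmetric]) (auto simp: b_def)
  have pw: "norm ((u + v) x) powr p \<le> (a + b) powr p * (s / a powr p * norm (u x) powr p + t / b powr p * norm (v x) powr p)" for x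
  proof -
    have "norm ((u + v) x) \<le> (a + b) * (s * (norm (u x) / a) + t * (norm (v x) / b))"
    proof -
      have "(a + b) * (s * (norm (u x) / a) + t * (norm (v x) / b)) = (a + b) * (s / a * norm (u x) + t / b * norm (v x))"
        by simp
      also have "\<dots> = norm (u x) + norm (v x)"
        using ab by (simp only: st distrib_left) simp
      finally have "(a + b) * (s * (norm (u x) / a) + t * (norm (v x) / b)) = norm (u x) + norm (v x)" .
      then show ?thesis by (simp add: norm_triangle_ineq)
    qed
    then have "norm ((u + v) x) powr p \<le> ((a + b) * (s * (norm (u x) / a) + t * (norm (v x) / b))) powr p"
      using p by (intro powr_mono2) auto
    also have "\<dots> = (a + b) powr p * (s * (norm (u x) / a) + t * (norm (v x) / b)) powr p"
      using ab st by (simp add: powr_mult)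
    also have "\<dots> \<le> (a + b) powr p * (s * (norm (u x) / a) powr p + t * (norm (v x) / b) powr p)"
      using ab st p by (intro mult_left_mono powr_convex_combination) auto
    also have "\<dots> = (a + b) powr p * (s / a powr p * norm (u x) powr p + t / b powr p * norm (v x) powr p)"
      using ab by (simp add: powr_divide)
    finally show ?thesis .
  qed
  have "(\<integral>x. norm ((u + v) x) powr p \<partial>M) \<le>
      (\<integral>x. (a + b) powr p * (s / a powr p * norm (u x) powr p + t / b powr p * norm (v x) powr p) \<partial>M)"
    using u v LpD(2)[OF Lp_add[OF u v]] pw
    by (intro integral_mono integrable_mult_right Bochner_Integration.integrable_add LpD(2) Lp_add)
  also have "\<dots> = (a + b) powr p * (s / a powr p * (\<integral>x. norm (u x) powr p \<partial>M) + t / b powr p * (\<integral>x. norm (v x) powr p \<partial>M))"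
    using LpD(2)[OF u] LpD(2)[OF v] by simp
  also have "\<dots> \<le> (a + b) powr p * (s / a powr p * a powr p + t / b powr p * b powr p)"
    using st Iu Iv by (intro mult_left_mono add_mono) auto
  also have "\<dots> = (a + b) powr p" using ab st by simp
  finally have "Lp_norm M p (u + v) \<le> a + b"
    using ab by (subst Lp_norm_le_iff) auto
  then show "Lp_norm M p (u + v) \<le> Lp_norm M p u + Lp_norm M p v + e"
    by (simp add: a_def b_def)
qed

lemma seminormed_space_Lp: "seminormed_space (Lp_space M p) (Lp_norm M p)"
  by standard (auto simp: subspace_def Lp_zero Lp_add Lp_scaleR Lp_norm_scaleR Lp_norm_triangle)

lemma Lp_diff: "u \<in> Lp_space M p \<Longrightarrow> v \<in> Lp_space M p \<Longrightarrow> u - v \<in> Lp_space M p"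
  using seminormed_space.in_V(4)[OF seminormed_space_Lp] by blast

lemma Lp_cong_AE:
  assumes "u \<in> Lp_space M p" "AE t in M. u t = v t"
  shows "v \<in> Lp_space M p"
proof (rule Lp_dominated)
  show "smeas v" using LpD(1)[OF assms(1)] assms(2) by (rule smeas_AE_cong)
  show "integrable M (\<lambda>t. norm (u t) powr p)" using assms(1) by (rule LpD)
  show "AE t in M. norm (v t) \<le> norm (u t)" using assms(2) by eventually_elim simp
qed

lemma Lp_dominated_convergence:
  assumes u: "\<And>n. smeas (u n)" and v: "smeas v" and lim: "AE t in M. (\<lambda>n. u n t) \<longlonglongrightarrow> v t"
    and h: "integrable M (\<lambda>t. h t powr p)" and le: "\<And>n. AE t in M. norm (u n t) \<le> h t"
  shows "\<And>n. u n \<in> Lp_space M p" "v \<in> Lp_space M p" "(\<lambda>n. Lp_norm M p (u n - v)) \<longlonglongrightarrow> 0"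
proof -
  show "u n \<in> Lp_space M p" for n using u h le by (rule Lp_dominated)
  have le': "AE t in M. \<forall>n. norm (u n t) \<le> h t"
    using le by (simp add: AE_all_countable)
  have vle: "AE t in M. norm (v t) \<le> h t"
    using lim le'
  proof eventually_elim
    case (elim t)
    then show ?case using LIMSEQ_le_const2[OF tendsto_norm[OF elim(1)]] by blast
  qed
  then show "v \<in> Lp_space M p" using v h by (intro Lp_dominated)
  have "(\<lambda>n. \<integral>t. norm ((u n - v) t) powr p \<partial>M) \<longlonglongrightarrow> (\<integral>t. 0 \<partial>M)"
  proof (rule integral_dominated_convergence)
    show "(\<lambda>t. norm ((u n - v) t) powr p) \<in> borel_measurable M" for n
      using u v by (auto intro!: smeas_norm_powr smeas_diff)
    show "integrable M (\<lambda>t. 2 powr p * h t powr p)" using h by simp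
    show "AE t in M. (\<lambda>n. norm ((u n - v) t) powr p) \<longlonglongrightarrow> 0"
      using lim
    proof eventually_elim
      case (elim t)
      have "(\<lambda>n. norm (u n t - v t) powr p) \<longlonglongrightarrow> 0 powr p"
        using p tendsto_norm_zero[OF LIM_zero[OF elim]] by (intro tendsto_powr') auto
      then show ?case by simp
    qed
    show "AE t in M. norm (norm ((u n - v) t) powr p) \<le> 2 powr p * h t powr p" for n
      using le[of n] vle
    proof eventually_elim
      case (elim t)
      have h0: "0 \<le> h t" using elim(1) norm_ge_zero order_trans by blast
      have "norm (u n t - v t) powr p \<le> (2 * h t) powr p"
        using p elim norm_triangle_ineq4[of "u n t" "v t"] by (intro powr_mono2) auto
      then show ?case using h0 by (simp add: powr_mult)
    qed
  qed auto
  then show "(\<lambda>n. Lp_norm M p (u n - v)) \<longlonglongrightarrow> 0"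
    by (simp add: Lp_norm_tendsto_0_iff)
qed

lemma Lp_simple_approx:
  assumes u: "u \<in> Lp_space M p" and e: "e > 0"
  shows "\<exists>s. simple_function M s \<and> s \<in> Lp_space M p \<and> Lp_norm M p (s - u) < e"
proof -
  obtain s where s: "\<And>n::nat. simple_function M (s n)" "AE t in M. (\<lambda>n. s n t) \<longlonglongrightarrow> u t"
    "\<And>n t. norm (s n t) \<le> 2 * norm (u t)"
    using smeas_dominated_approx[OF LpD(1)[OF u]] by blast
  have int: "integrable M (\<lambda>t. (2 * norm (u t)) powr p)"
    using LpD(2)[OF u] by (simp add: powr_mult)
  note dc = Lp_dominated_convergence[OF smeas_simple[OF s(1)] LpD(1)[OF u] s(2) int AE_I2[OF s(3)]]
  have "\<forall>\<^sub>F n in sequentially. Lp_norm M p (s n - u) < e"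
    using dc(3) e by (rule order_tendstoD)
  then obtain n where "Lp_norm M p (s n - u) < e"
    by (auto simp: eventually_sequentially)
  then show ?thesis using s(1) dc(1) by blast
qed

lemma Lp_convergent_AE_subseq:
  assumes u: "\<And>n. u n \<in> Lp_space M p" and lim: "(\<lambda>n. Lp_norm M p (u n)) \<longlonglongrightarrow> 0"
  shows "\<exists>r. strict_mono r \<and> (AE t in M. (\<lambda>n. u (r n) t) \<longlonglongrightarrow> 0)"
proof -
  have "(\<lambda>n. \<integral>t. norm (norm (u n t) powr p) \<partial>M) \<longlonglongrightarrow> 0"
    using lim by (simp add: Lp_norm_tendsto_0_iff)
  then obtain r where r: "strict_mono r" "AE t in M. (\<lambda>n. norm (u (r n) t) powr p) \<longlonglongrightarrow> 0"
    using tendsto_L1_AE_subseq[of M "\<lambda>n t. norm (u n t) powr p"] LpD(2)[OF u] by blast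
  have "AE t in M. (\<lambda>n. u (r n) t) \<longlonglongrightarrow> 0"
    using r(2)
  proof eventually_elim
    case (elim t)
    have "(\<lambda>n. (norm (u (r n) t) powr p) powr (1 / p)) \<longlonglongrightarrow> 0 powr (1 / p)"
      using p by (intro tendsto_powr' elim) auto
    then have "(\<lambda>n. norm (u (r n) t)) \<longlonglongrightarrow> 0" using p by (simp add: powr_powr)
    then show ?case by (rule tendsto_norm_zero_cancel)
  qed
  with r(1) show ?thesis by blast
qed


text \<open>The usual argument with a fast subsequence is run on simple functions close to
  \<open>u (r k)\<close>: a pointwise limit of simple functions is strongly measurable by
  definition, whereas for limits of arbitrary strongly measurable functions this is derived later,
  from the present lemma.\<close>

lemma Lp_complete:
  fixes u :: "nat \<Rightarrow> 'a \<Rightarrow> 'b::banach"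
  assumes u: "\<And>n. u n \<in> Lp_space M p"
    and cauchy: "\<And>e. e > 0 \<Longrightarrow> \<exists>n0. \<forall>m\<ge>n0. \<forall>n\<ge>n0. Lp_norm M p (u m - u n) < e"
  shows "\<exists>g\<in>Lp_space M p. (\<lambda>n. Lp_norm M p (u n - g)) \<longlonglongrightarrow> 0"
proof -
  interpret L: seminormed_space "Lp_space M p :: ('a \<Rightarrow> 'b) set" "Lp_norm M p"
    by (rule seminormed_space_Lp)
  have "\<exists>n0. \<forall>m\<ge>n0. \<forall>n\<ge>n0. Lp_norm M p (u m - u n) < (1/4) ^ k" for k :: nat
    by (rule cauchy) simp
  then obtain n0 where n0: "\<And>k m n. m \<ge> n0 k \<Longrightarrow> n \<ge> n0 k \<Longrightarrow> Lp_norm M p (u m - u n) < (1/4) ^ k"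
    by metis
  define r where "r k = Max (n0 ` {..k})" for k
  have r: "n0 k \<le> r j" if "k \<le> j" for k j
    unfolding r_def using that by (intro Max_ge) auto
  have "\<exists>s. simple_function M s \<and> s \<in> Lp_space M p \<and> Lp_norm M p (s - u (r k)) < (1/4) ^ k" for k
    by (rule Lp_simple_approx[OF u]) simp
  then obtain v where v: "\<And>k. simple_function M (v k)" "\<And>k. v k \<in> Lp_space M p"
    "\<And>k. Lp_norm M p (v k - u (r k)) < (1/4) ^ k"
    by metis
  have vu: "Lp_norm M p (v k - u n) < 2 * (1/4) ^ k" if "n \<ge> n0 k" for k n
    using L.N_triangle_sub[OF v(2)[of k] u[of "r k"] u[of n]] v(3)[of k] n0[of k "r k" n] that r[of k k] by simp
  have vv: "Lp_norm M p (v (Suc k) - v k) \<le> 4 * (1/4) ^ k" for k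
  proof -
    have "Lp_norm M p (v (Suc k) - v k) \<le> Lp_norm M p (v (Suc k) - u (r (Suc k))) + Lp_norm M p (u (r (Suc k)) - v k)"
      using v u by (intro L.N_triangle_sub)
    also have "Lp_norm M p (u (r (Suc k)) - v k) = Lp_norm M p (v k - u (r (Suc k)))"
      using v u by (intro L.N_commute)
    also have "Lp_norm M p (v (Suc k) - u (r (Suc k))) + \<dots> \<le> (1/4) ^ Suc k + 2 * (1/4) ^ k"
      using v(3)[of "Suc k"] vu[of k "r (Suc k)"] r[of k "Suc k"] by linarith
    also have "\<dots> \<le> 4 * (1/4) ^ k" by simp
    finally show ?thesis .
  qed
  \<comment> \<open>Successive differences have norms of order 4^-k, so even after multiplication by
    2^k their p-th powers have summable integrals. Hence \<open>d k t\<close> tends to 0 almost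
    everywhere, which bounds the differences at t by 2^-k eventually.\<close>
  define d where "d k t = (2 ^ k * norm (v (Suc k) t - v k t)) powr p" for k t
  have d_int: "integrable M (d k)" "(\<integral>t. d k t \<partial>M) \<le> 4 powr p * (1/2) ^ k" for k
  proof -
    have d_eq: "d k t = (2 ^ k) powr p * norm ((v (Suc k) - v k) t) powr p" for t
      by (simp add: d_def powr_mult)
    have vL: "v (Suc k) - v k \<in> Lp_space M p" using v by (intro Lp_diff)
    show "integrable M (d k)"
      unfolding d_eq using LpD(2)[OF vL] by (rule integrable_mult_right)
    have "(\<integral>t. d k t \<partial>M) = (2 ^ k) powr p * Lp_norm M p (v (Suc k) - v k) powr p"
      unfolding d_eq Lp_norm_powr by simp
    also have "\<dots> \<le> (2 ^ k) powr p * (4 * (1/4) ^ k) powr p"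
      using vv[of k] p by (intro mult_left_mono powr_mono2 Lp_norm_nonneg) auto
    also have "\<dots> = (4 * (2 ^ k * (1/4) ^ k)) powr p"
      by (simp only: powr_mult mult.left_commute)
    also have "(2::real) ^ k * (1/4) ^ k = (1/2) ^ k"
      by (simp flip: power_mult_distrib)
    also have "(4 * (1/2) ^ k) powr p = 4 powr p * ((1/2) ^ k) powr p" by (simp add: powr_mult)
    also have "\<dots> \<le> 4 powr p * ((1/2) ^ k) powr 1"
      using p by (intro mult_left_mono powr_mono') (auto simp: power_le_one)
    finally show "(\<integral>t. d k t \<partial>M) \<le> 4 powr p * (1/2) ^ k" by simp
  qed
  have d0: "0 \<le> d k t" for k t by (simp add: d_def)
  have "AE t in M. (\<lambda>k. d k t) \<longlonglongrightarrow> 0"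
  proof -
    have meas: "(\<lambda>t. ennreal (d k t)) \<in> borel_measurable M" for k
      using d_int(1)[of k] by measurable
    have "(\<integral>\<^sup>+t. (\<Sum>k. ennreal (d k t)) \<partial>M) = (\<Sum>k. \<integral>\<^sup>+t. ennreal (d k t) \<partial>M)"
      by (rule nn_integral_suminf) (rule meas)
    also have "\<dots> = (\<Sum>k. ennreal (\<integral>t. d k t \<partial>M))"
      using d_int d0 by (intro suminf_cong nn_integral_eq_integral) auto
    also have "\<dots> \<le> (\<Sum>k. ennreal (4 powr p * (1/2) ^ k))"
      using d_int by (intro suminf_le ennreal_leI) auto
    also have "\<dots> = ennreal (\<Sum>k. 4 powr p * (1/2) ^ k)"
      by (intro suminf_ennreal2 summable_mult summable_geometric) auto
    finally have "(\<integral>\<^sup>+t. (\<Sum>k. ennreal (d k t)) \<partial>M) \<noteq> \<infinity>"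
      by (auto simp: top_unique)
    then have "AE t in M. (\<Sum>k. ennreal (d k t)) \<noteq> \<infinity>"
      using meas by (intro nn_integral_PInf_AE) auto
    then show ?thesis
    proof eventually_elim
      case (elim t)
      then have "summable (\<lambda>k. d k t)"
        using d0 by (intro summable_suminf_not_top) (auto simp: top_unique)
      then show ?case by (rule summable_LIMSEQ_zero)
    qed
  qed
  then have conv: "AE t in M. convergent (\<lambda>k. v k t)"
  proof eventually_elim
    case (elim t)
    then have "\<forall>\<^sub>F k in sequentially. d k t < 1"
      by (rule order_tendstoD) simp
    then obtain k0 where k0: "\<And>k. k \<ge> k0 \<Longrightarrow> d k t < 1"
      by (auto simp: eventually_sequentially)
    have le: "norm (v (Suc k) t - v k t) \<le> (1/2) ^ k" if "k \<ge> k0" for k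
    proof (rule ccontr)
      assume "\<not> norm (v (Suc k) t - v k t) \<le> (1/2) ^ k"
      then have "1 < 2 ^ k * norm (v (Suc k) t - v k t)"
        by (simp add: field_simps)
      then have "1 powr p \<le> d k t"
        unfolding d_def using p by (intro powr_mono2) auto
      then show False using k0[OF that] by simp
    qed
    have "summable (\<lambda>k. (1/2 :: real) ^ k)" by (rule summable_geometric) simp
    then have "summable (\<lambda>k. v (Suc k) t - v k t)"
      using le by (rule summable_comparison_test')
    then have "convergent (\<lambda>n. \<Sum>k<n. v (Suc k) t - v k t)"
      by (simp add: summable_iff_convergent)
    then have "convergent (\<lambda>n. (\<Sum>k<n. v (Suc k) t - v k t) + v 0 t)"
      by (intro convergent_add convergent_const)
    moreover have "(\<Sum>k<n. v (Suc k) t - v k t) + v 0 t = v n t" for n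
      using sum_lessThan_telescope[of "\<lambda>k. v k t" n] by simp
    ultimately show ?case by simp
  qed
  define g where "g t = lim (\<lambda>k. v k t)" for t
  have lim: "AE t in M. (\<lambda>k. v k t) \<longlonglongrightarrow> g t"
    using conv by eventually_elim (simp add: g_def convergent_LIMSEQ_iff)
  have g: "smeas g"
    unfolding smeas_iff by (intro exI[of _ v] conjI allI v(1) lim)
  \<comment> \<open>Fatou's lemma along j compares \<open>u n\<close> with g. It also shows that
    \<open>u n - g\<close>, and therefore g, is in L^p.\<close>
  have bound: "u n - g \<in> Lp_space M p \<and> Lp_norm M p (u n - g) \<le> 2 * (1/4) ^ k" if n: "n \<ge> n0 k" for n k
  proof -
    have meas: "(\<lambda>t. ennreal (norm (u n t - v j t) powr p)) \<in> borel_measurable M" for j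
      by (rule measurable_compose[OF smeas_norm_powr[OF smeas_diff[OF LpD(1)[OF u] LpD(1)[OF v(2)]]]
            measurable_ennreal])
    have meas_g: "(\<lambda>t. norm (u n t - g t) powr p) \<in> borel_measurable M"
      by (rule smeas_norm_powr[OF smeas_diff[OF LpD(1)[OF u] g]])
    have small: "(\<integral>\<^sup>+t. ennreal (norm (u n t - v j t) powr p) \<partial>M) \<le> ennreal ((2 * (1/4) ^ k) powr p)"
      if "j \<ge> k" for j
    proof -
      have uv: "u n - v j \<in> Lp_space M p" using u v by (intro Lp_diff)
      have "Lp_norm M p (u n - v j) \<le> Lp_norm M p (u n - u (r j)) + Lp_norm M p (u (r j) - v j)"
        using u v by (intro L.N_triangle_sub)
      moreover have "Lp_norm M p (u (r j) - v j) = Lp_norm M p (v j - u (r j))"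
        using u v by (intro L.N_commute)
      moreover have "(1/4 :: real) ^ j \<le> (1/4) ^ k"
        using that by (intro power_decreasing) auto
      ultimately have "Lp_norm M p (u n - v j) \<le> 2 * (1/4) ^ k"
        using n0[OF n r[OF that]] v(3)[of j] by linarith
      then have "(\<integral>t. norm ((u n - v j) t) powr p \<partial>M) \<le> (2 * (1/4) ^ k) powr p"
        using Lp_norm_le_iff[of "2 * (1/4) ^ k" "u n - v j"] by simp
      moreover have "(\<integral>\<^sup>+t. ennreal (norm ((u n - v j) t) powr p) \<partial>M) = ennreal (\<integral>t. norm ((u n - v j) t) powr p \<partial>M)"
        using LpD(2)[OF uv] by (intro nn_integral_eq_integral) auto
      ultimately show ?thesis by (simp add: ennreal_leI)
    qed
    have "(\<integral>\<^sup>+t. ennreal (norm (u n t - g t) powr p) \<partial>M) \<le>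
        (\<integral>\<^sup>+t. liminf (\<lambda>j. ennreal (norm (u n t - v j t) powr p)) \<partial>M)"
    proof (rule nn_integral_mono_AE)
      show "AE t in M. ennreal (norm (u n t - g t) powr p) \<le> liminf (\<lambda>j. ennreal (norm (u n t - v j t) powr p))"
        using lim
      proof eventually_elim
        case (elim t)
        have "(\<lambda>j. norm (u n t - v j t) powr p) \<longlonglongrightarrow> norm (u n t - g t) powr p"
          using p by (intro tendsto_powr' tendsto_norm tendsto_diff tendsto_const elim) auto
        then have "(\<lambda>j. ennreal (norm (u n t - v j t) powr p)) \<longlonglongrightarrow> ennreal (norm (u n t - g t) powr p)"
          by (rule tendsto_ennrealI)
        then show ?case
          using lim_imp_Liminf[OF sequentially_bot] by fastforce
      qed
    qed
    also have "\<dots> \<le> liminf (\<lambda>j. \<integral>\<^sup>+t. ennreal (norm (u n t - v j t) powr p) \<partial>M)"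
      by (rule nn_integral_liminf) (rule meas)
    also have "\<dots> \<le> ennreal ((2 * (1/4) ^ k) powr p)"
      using small by (intro Liminf_le) (auto intro: eventually_sequentiallyI[of k])
    finally have *: "(\<integral>\<^sup>+t. ennreal (norm (u n t - g t) powr p) \<partial>M) \<le> ennreal ((2 * (1/4) ^ k) powr p)" .
    have int: "integrable M (\<lambda>t. norm (u n t - g t) powr p)"
    proof (rule integrableI_bounded[OF meas_g])
      show "(\<integral>\<^sup>+t. ennreal (norm (norm (u n t - g t) powr p)) \<partial>M) < \<infinity>"
        using * by (auto intro: le_less_trans)
    qed
    then have "u n - g \<in> Lp_space M p"
      using smeas_diff[OF LpD(1)[OF u] g, of n] by (simp add: Lp_space_def fun_diff_def)
    moreover have "ennreal (\<integral>t. norm (u n t - g t) powr p \<partial>M) \<le> ennreal ((2 * (1/4) ^ k) powr p)"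
      using * int by (subst nn_integral_eq_integral[symmetric]) auto
    then have "(\<integral>t. norm ((u n - g) t) powr p \<partial>M) \<le> (2 * (1/4) ^ k) powr p"
      by simp
    then have "Lp_norm M p (u n - g) \<le> 2 * (1/4) ^ k"
      by (subst Lp_norm_le_iff) auto
    ultimately show ?thesis by blast
  qed
  have "u (n0 0) - g \<in> Lp_space M p"
    using bound[of 0 "n0 0"] by simp
  from Lp_diff[OF u[of "n0 0"] this] have "g \<in> Lp_space M p" by simp
  moreover have "(\<lambda>n. Lp_norm M p (u n - g)) \<longlonglongrightarrow> 0"
  proof (rule LIMSEQ_I)
    fix e :: real assume e: "e > 0"
    have "(\<lambda>k. 2 * (1/4::real) ^ k) \<longlonglongrightarrow> 2 * 0"
      by (intro tendsto_mult tendsto_const LIMSEQ_realpow_zero) auto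
    then have "\<forall>\<^sub>F k in sequentially. 2 * (1/4::real) ^ k < e"
      using e by (intro order_tendstoD) auto
    then obtain k where k: "2 * (1/4::real) ^ k < e"
      by (auto simp: eventually_sequentially)
    show "\<exists>no. \<forall>n\<ge>no. norm (Lp_norm M p (u n - g) - 0) < e"
    proof (intro exI[of _ "n0 k"] allI impI)
      fix n assume "n0 k \<le> n"
      then have "Lp_norm M p (u n - g) < e" using bound[of k n] k by linarith
      then show "norm (Lp_norm M p (u n - g) - 0) < e"
        using Lp_norm_nonneg[of "u n - g"] by simp
    qed
  qed
  ultimately show ?thesis by blast
qed

end
end

section \<open>Uniform convexity of Lebesgue-Bochner spaces\<close>

lemma powr_midpoint_strict:
  fixes a b p :: real
  assumes "0 \<le> a" "a < b" "1 < p"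
  shows "((a + b) / 2) powr p < (a powr p + b powr p) / 2"
proof (cases "a = 0")
  case True
  have "2 powr 1 < (2 :: real) powr p" using assms by (intro powr_less_mono) auto
  then have "b powr p * 2 < b powr p * 2 powr p"
    using assms by (intro mult_strict_left_mono) auto
  then show ?thesis using True assms by (simp add: powr_divide pos_divide_less_eq)
next
  case False
  define m where "m = (a + b) / 2"
  have m: "0 < a" "a < m" "m < b" "m - a = (b - a) / 2" "b - m = (b - a) / 2"
    using False assms by (auto simp: m_def field_simps)
  have deriv: "((\<lambda>x. x powr p) has_real_derivative p * x powr (p - 1)) (at x)" if "x > 0" for x
    using that by (auto intro!: derivative_eq_intros)
  obtain z1 where z1: "a < z1" "z1 < m" "m powr p - a powr p = (m - a) * (p * z1 powr (p - 1))"
    using MVT2[of a m "\<lambda>x. x powr p" "\<lambda>x. p * x powr (p - 1)"] m deriv by auto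
  obtain z2 where z2: "m < z2" "z2 < b" "b powr p - m powr p = (b - m) * (p * z2 powr (p - 1))"
    using MVT2[of m b "\<lambda>x. x powr p" "\<lambda>x. p * x powr (p - 1)"] m deriv by auto
  have "z1 powr (p - 1) < z2 powr (p - 1)"
    using z1 z2 m assms by (intro powr_less_mono2) auto
  then have "(b - a) / 2 * (p * z1 powr (p - 1)) < (b - a) / 2 * (p * z2 powr (p - 1))"
    using assms by (intro mult_strict_left_mono) auto
  then have "m powr p - a powr p < b powr p - m powr p"
    using z1(3) z2(3) by (simp only: m(4,5))
  then show ?thesis by (simp add: m_def)
qed

lemma powr_midpoint_eq:
  fixes a b p :: real
  assumes "0 \<le> a" "0 \<le> b" "1 < p" "((a + b) / 2) powr p = (a powr p + b powr p) / 2"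
  shows "a = b"
  using assms powr_midpoint_strict[of a b p] powr_midpoint_strict[of b a p]
  by (cases a b rule: linorder_cases) (auto simp: add.commute)

lemma powr_midpoint_le:
  fixes x y :: "'e::real_normed_vector" and p :: real
  assumes "1 \<le> p"
  shows "norm ((x + y) /\<^sub>R 2) powr p \<le> ((norm x + norm y) / 2) powr p"
    and "((norm x + norm y) / 2) powr p \<le> (norm x powr p + norm y powr p) / 2"
proof -
  have "norm ((x + y) /\<^sub>R 2) \<le> (norm x + norm y) / 2"
    using norm_triangle_ineq[of x y] by simp
  then show "norm ((x + y) /\<^sub>R 2) powr p \<le> ((norm x + norm y) / 2) powr p"
    using assms by (intro powr_mono2) auto
  show "((norm x + norm y) / 2) powr p \<le> (norm x powr p + norm y powr p) / 2"
    using powr_convex_combination[of "norm x" "norm y" p "1/2" "1/2"] assms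
    by (simp add: add_divide_distrib)
qed

text \<open>The normalisation \<open>max (norm a) (norm b) = 1\<close> makes the bound uniform; the general case follows
  by homogeneity.\<close>

lemma uniformly_convex_powr_normalized:
  assumes E: "uniformly_convex (UNIV :: 'e::real_normed_vector set) norm" and p: "1 < p" and \<eta>: "\<eta> > 0"
  shows "\<exists>d>0. \<forall>a b :: 'e. max (norm a) (norm b) = 1 \<longrightarrow> \<eta> \<le> norm (a - b) powr p \<longrightarrow>
    d \<le> (norm a powr p + norm b powr p) / 2 - norm ((a + b) /\<^sub>R 2) powr p"
proof (rule ccontr)
  define D where "D a b = (norm a powr p + norm b powr p) / 2 - norm ((a + b) /\<^sub>R 2) powr p" for a b :: 'e
  assume "\<not> ?thesis"
  then have "\<exists>a b :: 'e. max (norm a) (norm b) = 1 \<and> \<eta> \<le> norm (a - b) powr p \<and> D a b < d" if "d > 0" for d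
    using that unfolding D_def by (meson not_le)
  from this[of "inverse (real (Suc n))" for n]
  have "\<forall>n. \<exists>a b :: 'e. max (norm a) (norm b) = 1 \<and> \<eta> \<le> norm (a - b) powr p \<and> D a b < inverse (real (Suc n))"
    by simp
  then obtain a b :: "nat \<Rightarrow> 'e" where ab1: "\<And>n. max (norm (a n)) (norm (b n)) = 1"
    and ab2: "\<And>n. \<eta> \<le> norm (a n - b n) powr p" and ab3: "\<And>n. D (a n) (b n) < inverse (real (Suc n))"
    by metis
  have le1: "norm (a n) \<le> 1" "norm (b n) \<le> 1" for n
    using ab1[of n] by linarith+
  have bd: "\<bar>if j then norm (a n) else norm (b n)\<bar> \<le> 1" for j n
    using le1 by simp
  obtain l r where r: "strict_mono r"
    and l: "\<And>j. (\<lambda>n. if j then norm (a (r n)) else norm (b (r n))) \<longlonglongrightarrow> l j"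
    using coordinatewise_convergent_subsequence[where a = "\<lambda>n j. if j then norm (a n) else norm (b n)" and b = "\<lambda>_. 1", OF bd]
    by auto
  define \<alpha> where "\<alpha> = l True"
  define \<beta> where "\<beta> = l False"
  have \<alpha>: "(\<lambda>n. norm (a (r n))) \<longlonglongrightarrow> \<alpha>" and \<beta>: "(\<lambda>n. norm (b (r n))) \<longlonglongrightarrow> \<beta>"
    using l[of True] l[of False] by (auto simp: \<alpha>_def \<beta>_def)
  have nn: "0 \<le> \<alpha>" "0 \<le> \<beta>"
    using LIMSEQ_le_const[OF \<alpha>] LIMSEQ_le_const[OF \<beta>] by auto
  have D_ge: "(norm x powr p + norm y powr p) / 2 - ((norm x + norm y) / 2) powr p \<le> D x y" for x y
    unfolding D_def using powr_midpoint_le(1)[of p x y] p by simp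
  have D0: "0 \<le> D x y" for x y
    using D_ge[of x y] powr_midpoint_le(2)[of p x y] p by linarith
  have D_lim: "(\<lambda>n. D (a (r n)) (b (r n))) \<longlonglongrightarrow> 0"
  proof (rule tendsto_sandwich[OF _ _ tendsto_const])
    show "(\<lambda>n. inverse (real (Suc (r n)))) \<longlonglongrightarrow> 0"
      using LIMSEQ_subseq_LIMSEQ[OF LIMSEQ_inverse_real_of_nat r] by (simp add: o_def)
    show "\<forall>\<^sub>F n in sequentially. D (a (r n)) (b (r n)) \<le> inverse (real (Suc (r n)))"
      using ab3 by (intro always_eventually allI less_imp_le)
  qed (use D0 in auto)
  have pow: "(\<lambda>n. norm (a (r n)) powr p) \<longlonglongrightarrow> \<alpha> powr p" "(\<lambda>n. norm (b (r n)) powr p) \<longlonglongrightarrow> \<beta> powr p"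
    using p by (auto intro!: tendsto_powr' \<alpha> \<beta>)
  have "(\<lambda>n. ((norm (a (r n)) + norm (b (r n))) / 2) powr p) \<longlonglongrightarrow> ((\<alpha> + \<beta>) / 2) powr p"
    using p by (intro tendsto_powr' tendsto_divide tendsto_add \<alpha> \<beta> tendsto_const) auto
  then have lim1: "(\<lambda>n. (norm (a (r n)) powr p + norm (b (r n)) powr p) / 2 - ((norm (a (r n)) + norm (b (r n))) / 2) powr p)
      \<longlonglongrightarrow> (\<alpha> powr p + \<beta> powr p) / 2 - ((\<alpha> + \<beta>) / 2) powr p"
    by (intro tendsto_diff tendsto_divide tendsto_add pow tendsto_const) auto
  \<comment> \<open>D dominates the convexity defect of x^p at the two norms, so in the limit this
    defect vanishes. Strict convexity gives \<alpha> = \<beta>, and the normalisation makes both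
    equal to 1.\<close>
  have "(\<alpha> powr p + \<beta> powr p) / 2 - ((\<alpha> + \<beta>) / 2) powr p \<le> 0"
    by (rule LIMSEQ_le[OF lim1 D_lim]) (use D_ge in auto)
  moreover have "((\<alpha> + \<beta>) / 2) powr p \<le> (\<alpha> powr p + \<beta> powr p) / 2"
    using powr_midpoint_le(2)[of p \<alpha> \<beta>] p nn by simp
  ultimately have "\<alpha> = \<beta>"
    using nn p by - (rule powr_midpoint_eq[of \<alpha> \<beta> p]; linarith)
  moreover have "max \<alpha> \<beta> = 1"
    using LIMSEQ_unique[OF tendsto_max[OF \<alpha> \<beta>], of 1] by (simp add: ab1)
  ultimately have one: "\<alpha> = 1" "\<beta> = 1" by auto
  define \<epsilon> where "\<epsilon> = \<eta> powr (1 / p)"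
  have \<epsilon>: "\<epsilon> > 0" using \<eta> by (simp add: \<epsilon>_def)
  have far: "\<epsilon> \<le> norm (a n - b n)" for n
  proof -
    have "\<epsilon> \<le> (norm (a n - b n) powr p) powr (1 / p)"
      unfolding \<epsilon>_def using ab2[of n] \<eta> p by (intro powr_mono2) auto
    then show ?thesis using p by (simp add: powr_powr)
  qed
  obtain d where d: "d > 0" "\<And>x y :: 'e. norm x = 1 \<Longrightarrow> norm y = 1 \<Longrightarrow> \<epsilon> / 2 \<le> norm (x - y) \<Longrightarrow>
      norm ((x + y) /\<^sub>R 2) \<le> 1 - d"
    using E \<epsilon> unfolding uniformly_convex_def by (meson half_gt_zero UNIV_I)
  have "(\<lambda>n. norm ((a (r n) + b (r n)) /\<^sub>R 2) powr p) \<longlonglongrightarrow> (1 powr p + 1 powr p) / 2 - 0"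
  proof -
    have "(\<lambda>n. (norm (a (r n)) powr p + norm (b (r n)) powr p) / 2 - D (a (r n)) (b (r n)))
        \<longlonglongrightarrow> (1 powr p + 1 powr p) / 2 - 0"
      using pow unfolding one by (intro tendsto_diff tendsto_divide tendsto_add D_lim tendsto_const) auto
    then show ?thesis by (simp add: D_def)
  qed
  then have "(\<lambda>n. (norm ((a (r n) + b (r n)) /\<^sub>R 2) powr p) powr (1 / p)) \<longlonglongrightarrow> 1 powr (1 / p)"
    by (intro tendsto_powr tendsto_const) auto
  then have mid: "(\<lambda>n. norm ((a (r n) + b (r n)) /\<^sub>R 2)) \<longlonglongrightarrow> 1"
    using p by (simp add: powr_powr)
  \<comment> \<open>Rescaling to unit vectors costs at most 2s <= \<epsilon>/4 in the distance and s
    <= d/4 in the midpoint norm. The unit vectors are then at distance at least \<epsilon>/2 with a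
    midpoint too long for d.\<close>
  define s where "s = min (1/2) (min (\<epsilon> / 8) (d / 4))"
  have s: "s > 0" "s \<le> 1/2" "s \<le> \<epsilon> / 8" "s \<le> d / 4" using \<epsilon> d by (auto simp: s_def)
  have "\<forall>\<^sub>F n in sequentially. dist (norm (a (r n))) 1 < s \<and> dist (norm (b (r n))) 1 < s \<and>
      dist (norm ((a (r n) + b (r n)) /\<^sub>R 2)) 1 < s"
    using tendstoD[OF \<alpha>[unfolded one] s(1)] tendstoD[OF \<beta>[unfolded one] s(1)] tendstoD[OF mid s(1)]
    by eventually_elim simp
  then obtain n where n: "dist (norm (a (r n))) 1 < s" "dist (norm (b (r n))) 1 < s"
      "dist (norm ((a (r n) + b (r n)) /\<^sub>R 2)) 1 < s"
    by (auto simp: eventually_sequentially)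
  have unit: "norm (sgn v) = 1 \<and> norm (sgn v - v) < s" if "dist (norm v) 1 < s" for v :: 'e
  proof -
    have "v \<noteq> 0" using that s by auto
    have "sgn v - v = (1 - norm v) *\<^sub>R sgn v"
    proof -
      have "v = norm v *\<^sub>R sgn v" using \<open>v \<noteq> 0\<close> by (simp add: sgn_div_norm)
      then show ?thesis by (metis scaleR_diff_left scaleR_one)
    qed
    then have "norm (sgn v - v) = \<bar>1 - norm v\<bar>"
      using \<open>v \<noteq> 0\<close> by (simp add: norm_sgn)
    then show ?thesis using that \<open>v \<noteq> 0\<close> by (simp add: norm_sgn dist_real_def)
  qed
  let ?x = "a (r n)" and ?y = "b (r n)"
  note ux = unit[OF n(1)] and uy = unit[OF n(2)]
  have "norm (?x - ?y) \<le> norm (sgn ?x - sgn ?y) + norm (sgn ?x - ?x) + norm (sgn ?y - ?y)"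
    by norm
  then have "\<epsilon> / 2 \<le> norm (sgn ?x - sgn ?y)"
    using far[of "r n"] ux uy s by linarith
  then have 1: "norm ((sgn ?x + sgn ?y) /\<^sub>R 2) \<le> 1 - d"
    using d(2) ux uy by blast
  have "norm (?x + ?y) \<le> norm (sgn ?x + sgn ?y) + (norm (sgn ?x - ?x) + norm (sgn ?y - ?y))"
    by norm
  then have "norm ((?x + ?y) /\<^sub>R 2) \<le> norm ((sgn ?x + sgn ?y) /\<^sub>R 2) + s"
    using ux uy by simp
  moreover have "1 - s < norm ((?x + ?y) /\<^sub>R 2)"
    using n(3) by (simp add: dist_real_def)
  ultimately show False using 1 s(4) d(1) by linarith
qed

text \<open>Both sides are homogeneous of degree p, so the larger norm may be taken to be 1. If the
  p-th power of the distance is at least \<eta>, the defect is at least d, and K d = 2^p bounds any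
  such power; otherwise the first term on the right absorbs it, since one of the two powers of norms
  is 1.\<close>

lemma uniformly_convex_powr:
  assumes E: "uniformly_convex (UNIV :: 'e::real_normed_vector set) norm" and p: "1 < p" and \<eta>: "\<eta> > 0"
  shows "\<exists>K\<ge>0. \<forall>a b :: 'e. norm (a - b) powr p \<le> \<eta> * (norm a powr p + norm b powr p) +
    K * ((norm a powr p + norm b powr p) / 2 - norm ((a + b) /\<^sub>R 2) powr p)"
proof -
  obtain d where d: "d > 0" "\<And>a b :: 'e. max (norm a) (norm b) = 1 \<Longrightarrow> \<eta> \<le> norm (a - b) powr p \<Longrightarrow>
    d \<le> (norm a powr p + norm b powr p) / 2 - norm ((a + b) /\<^sub>R 2) powr p"
    using uniformly_convex_powr_normalized[OF E p \<eta>] by blast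
  define K where "K = 2 powr p / d"
  have K: "K \<ge> 0" "K * d = 2 powr p" using d by (auto simp: K_def)
  have main: "norm (a - b) powr p \<le> \<eta> * (norm a powr p + norm b powr p) +
    K * ((norm a powr p + norm b powr p) / 2 - norm ((a + b) /\<^sub>R 2) powr p)"
    if m: "max (norm a) (norm b) = 1" for a b :: 'e
  proof (cases "\<eta> \<le> norm (a - b) powr p")
    case True
    have "norm (a - b) powr p \<le> 2 powr p"
      using m norm_triangle_ineq4[of a b] p by (intro powr_mono2) auto
    also have "\<dots> \<le> K * ((norm a powr p + norm b powr p) / 2 - norm ((a + b) /\<^sub>R 2) powr p)"
      unfolding K(2)[symmetric] using d(2)[OF m True] K(1) by (intro mult_left_mono)
    finally show ?thesis using \<eta> by (simp add: add_increasing)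
  next
    case False
    have "norm a powr p = 1 \<or> norm b powr p = 1" using m by (auto simp: max_def split: if_splits)
    then have "1 \<le> norm a powr p + norm b powr p" by auto
    then have "\<eta> \<le> \<eta> * (norm a powr p + norm b powr p)"
      using \<eta> by simp
    moreover have "0 \<le> K * ((norm a powr p + norm b powr p) / 2 - norm ((a + b) /\<^sub>R 2) powr p)"
      using K(1) powr_midpoint_le[of p a b] p by (intro mult_nonneg_nonneg) auto
    ultimately show ?thesis using False by linarith
  qed
  have "norm (a - b) powr p \<le> \<eta> * (norm a powr p + norm b powr p) +
    K * ((norm a powr p + norm b powr p) / 2 - norm ((a + b) /\<^sub>R 2) powr p)" for a b :: 'e
  proof (cases "a = 0 \<and> b = 0")
    case False
    define m where "m = max (norm a) (norm b)"
    have m: "m > 0" using False by (auto simp: m_def less_max_iff_disj)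
    have sc: "norm (v /\<^sub>R m) powr p = norm v powr p / m powr p" for v :: 'e
    proof -
      have "norm (v /\<^sub>R m) = norm v / m" using m by (simp add: divide_inverse_commute)
      then show ?thesis by (simp add: powr_divide)
    qed
    have "max (norm (a /\<^sub>R m)) (norm (b /\<^sub>R m)) = 1"
    proof -
      have "max (inverse m * norm a) (inverse m * norm b) = inverse m * m"
        unfolding m_def using m by (subst max_mult_distrib_left) (auto simp: m_def)
      then show ?thesis using m by simp
    qed
    note main[OF this]
    moreover have "a /\<^sub>R m - b /\<^sub>R m = (a - b) /\<^sub>R m"
      and "(a /\<^sub>R m + b /\<^sub>R m) /\<^sub>R 2 = ((a + b) /\<^sub>R 2) /\<^sub>R m"
      by (simp_all add: scaleR_diff_right scaleR_add_right mult.commute)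
    ultimately have "norm (a - b) powr p / m powr p \<le> \<eta> * (norm a powr p / m powr p + norm b powr p / m powr p) +
      K * ((norm a powr p / m powr p + norm b powr p / m powr p) / 2 - norm ((a + b) /\<^sub>R 2) powr p / m powr p)"
      by (simp only: sc)
    also have "\<dots> = (\<eta> * (norm a powr p + norm b powr p) +
      K * ((norm a powr p + norm b powr p) / 2 - norm ((a + b) /\<^sub>R 2) powr p)) / m powr p"
      by (simp add: add_divide_distrib diff_divide_distrib right_diff_distrib distrib_left)
    finally show ?thesis using m by (simp add: divide_le_cancel)
  qed simp
  with K(1) show ?thesis by blast
qed

text \<open>Every term of the inequality for E is a constant times a p-th power of a norm, so
  integrating it pointwise gives the inequality for L^p.\<close>

lemma (in complete_finite_measure) uniformly_convex_space_Lp: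
  assumes E: "uniformly_convex (UNIV :: 'e::banach set) norm" and p: "1 < p"
  shows "uniformly_convex_space (Lp_space M p :: ('a \<Rightarrow> 'e) set) (Lp_norm M p) p"
proof -
  have p': "1 \<le> p" using p by simp
  interpret L: seminormed_space "Lp_space M p :: ('a \<Rightarrow> 'e) set" "Lp_norm M p"
    using p' by (rule seminormed_space_Lp)
  show ?thesis
  proof
    show "1 < p" by (rule p)
  next
    fix x :: "nat \<Rightarrow> 'a \<Rightarrow> 'e"
    assume "\<And>n. x n \<in> Lp_space M p" "\<And>e. 0 < e \<Longrightarrow> \<exists>n0. \<forall>m\<ge>n0. \<forall>n\<ge>n0. Lp_norm M p (x m - x n) < e"
    then show "\<exists>g\<in>Lp_space M p. (\<lambda>n. Lp_norm M p (x n - g)) \<longlonglongrightarrow> 0"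
      by (rule Lp_complete[OF p'])
  next
    fix \<eta> :: real assume "\<eta> > 0"
    then obtain K where K: "K \<ge> 0" "\<And>a b :: 'e. norm (a - b) powr p \<le> \<eta> * (norm a powr p + norm b powr p) +
      K * ((norm a powr p + norm b powr p) / 2 - norm ((a + b) /\<^sub>R 2) powr p)"
      using uniformly_convex_powr[OF E p] by blast
    have "Lp_norm M p (x - y) powr p \<le> \<eta> * (Lp_norm M p x powr p + Lp_norm M p y powr p) +
      K * ((Lp_norm M p x powr p + Lp_norm M p y powr p) / 2 - Lp_norm M p ((x + y) /\<^sub>R 2) powr p)"
      if x: "x \<in> Lp_space M p" and y: "y \<in> Lp_space M p" for x y :: "'a \<Rightarrow> 'e"
    proof -
      note int = LpD(2)[OF p' x] LpD(2)[OF p' y] LpD(2)[OF p' L.in_V(3)[OF L.in_V(2)[OF x y], of "inverse 2"]]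
      have "(\<integral>t. norm ((x - y) t) powr p \<partial>M) \<le> (\<integral>t. \<eta> * (norm (x t) powr p + norm (y t) powr p) +
          K * ((norm (x t) powr p + norm (y t) powr p) / 2 - norm (((x + y) /\<^sub>R 2) t) powr p) \<partial>M)"
        using K(2) by (intro integral_mono LpD(2)[OF p' L.in_V(4)[OF x y]] Bochner_Integration.integrable_add
          Bochner_Integration.integrable_diff integrable_mult_right integrable_divide int) simp
      also have "\<dots> = \<eta> * ((\<integral>t. norm (x t) powr p \<partial>M) + (\<integral>t. norm (y t) powr p \<partial>M)) +
          K * (((\<integral>t. norm (x t) powr p \<partial>M) + (\<integral>t. norm (y t) powr p \<partial>M)) / 2 - (\<integral>t. norm (((x + y) /\<^sub>R 2) t) powr p \<partial>M))"
        using int by (simp del: scaleR_fun_apply plus_fun_apply)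
      finally show ?thesis unfolding Lp_norm_powr[OF p'] .
    qed
    with K(1) show "\<exists>K\<ge>0. \<forall>x\<in>Lp_space M p. \<forall>y\<in>Lp_space M p. Lp_norm M p (x - y) powr p \<le>
      \<eta> * (Lp_norm M p x powr p + Lp_norm M p y powr p) +
      K * ((Lp_norm M p x powr p + Lp_norm M p y powr p) / 2 - Lp_norm M p ((x + y :: 'a \<Rightarrow> 'e) /\<^sub>R 2) powr p)"
      by blast
  qed
qed

section \<open>Pointwise weak convergence and the Bochner integral\<close>

lemma seminormed_space_norm: "seminormed_space (UNIV :: 'e::real_normed_vector set) norm"
  by standard (auto simp: norm_triangle_ineq)

lemma bounded_linear_functional:
  assumes "bounded_functional (UNIV :: 'e::real_normed_vector set) norm \<phi>"
  shows "bounded_linear \<phi>"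
proof -
  obtain K where K: "\<forall>x. \<bar>\<phi> x\<bar> \<le> K * norm x"
    using assms unfolding bounded_functional_def by auto
  show ?thesis
  proof (rule bounded_linear_intro[of _ K])
    show "\<phi> (x + y) = \<phi> x + \<phi> y" "\<phi> (c *\<^sub>R x) = c *\<^sub>R \<phi> x" for x y c
      using assms unfolding bounded_functional_def by simp_all
    show "norm (\<phi> x) \<le> norm x * K" for x
      using K by (simp add: mult.commute)
  qed
qed

context complete_finite_measure
begin

text \<open>The map \<beta> sends the space homeomorphically onto its open unit ball, so that the
  functions become uniformly bounded and, the measure being finite, lie in L^1. They are Cauchy
  there, and completeness supplies a strongly measurable G that agrees with \<beta> (g t) almost
  everywhere; the inverse of \<beta> recovers g.\<close>

lemma smeas_LIMSEQ:
  fixes f :: "nat \<Rightarrow> 'a \<Rightarrow> 'b::banach"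
  assumes f: "\<And>n. smeas (f n)" and lim: "AE t in M. (\<lambda>n. f n t) \<longlonglongrightarrow> g t"
  shows "smeas g"
proof -
  define \<beta> where "\<beta> x = x /\<^sub>R (1 + norm x)" for x :: 'b
  have \<beta>_cont: "isCont \<beta> x" for x
    unfolding \<beta>_def using norm_ge_zero[of x]
    by (intro continuous_intros) (simp add: add_nonneg_eq_0_iff)
  have \<beta>_norm: "norm (\<beta> x) = norm x / (1 + norm x)" for x
    by (simp add: \<beta>_def divide_inverse mult.commute)
  have \<beta>_lt: "norm (\<beta> x) < 1" for x
    unfolding \<beta>_norm using norm_ge_zero[of x] by (simp add: divide_less_eq add_pos_nonneg)
  have inv: "\<beta> x /\<^sub>R (1 - norm (\<beta> x)) = x" for x
  proof -
    have pos: "1 + norm x > 0" by (simp add: add_pos_nonneg)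
    then have "1 - norm (\<beta> x) = inverse (1 + norm x)"
      unfolding \<beta>_norm by (simp add: field_simps)
    then show ?thesis using pos by (simp add: \<beta>_def)
  qed
  define F where "F n t = \<beta> (f n t)" for n t
  have F: "smeas (F n)" for n
    unfolding F_def using f by (rule smeas_comp) (simp add: \<beta>_cont)
  have F_lim: "AE t in M. (\<lambda>n. F n t) \<longlonglongrightarrow> \<beta> (g t)"
    using lim unfolding F_def by eventually_elim (rule isCont_tendsto_compose[OF \<beta>_cont])
  have F_bound: "norm (F n t) \<le> 1" for n t
    using \<beta>_lt less_imp_le by (auto simp: F_def)
  have one: "(1 :: real) \<le> 1" by simp
  have FL: "F n \<in> Lp_space M 1" for n
    by (rule Lp_dominated[OF one F, of "\<lambda>_. 1"]) (use F_bound in auto)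
  interpret L: seminormed_space "Lp_space M 1 :: ('a \<Rightarrow> 'b) set" "Lp_norm M 1"
    by (rule seminormed_space_Lp[OF one])
  have "\<exists>G\<in>Lp_space M 1. (\<lambda>n. Lp_norm M 1 (F n - G)) \<longlonglongrightarrow> 0"
  proof (rule Lp_complete[OF one FL])
    fix e :: real assume e: "e > 0"
    show "\<exists>n0. \<forall>m\<ge>n0. \<forall>n\<ge>n0. Lp_norm M 1 (F m - F n) < e"
    proof (rule ccontr)
      assume "\<not> ?thesis"
      then have "\<forall>k. \<exists>m n. m \<ge> k \<and> n \<ge> k \<and> \<not> Lp_norm M 1 (F m - F n) < e"
        by blast
      then obtain m n where mn: "\<And>k. m k \<ge> k" "\<And>k. n k \<ge> k" "\<And>k. \<not> Lp_norm M 1 (F (m k) - F (n k)) < e"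
        by metis
      have top: "filterlim m at_top sequentially" "filterlim n at_top sequentially"
        using mn(1,2) by (auto intro!: filterlim_at_top_mono[OF filterlim_ident])
      \<comment> \<open>Dominated convergence towards \<beta> (g t) would presuppose the
        measurability to be shown; the differences have the measurable limit 0 instead.\<close>
      have "(\<lambda>k. Lp_norm M 1 (\<lambda>t. F (m k) t - F (n k) t)) \<longlonglongrightarrow> 0"
      proof -
        have ae: "AE t in M. (\<lambda>k. F (m k) t - F (n k) t) \<longlonglongrightarrow> 0"
          using F_lim
        proof eventually_elim
          case (elim t)
          then have "(\<lambda>k. F (m k) t - F (n k) t) \<longlonglongrightarrow> \<beta> (g t) - \<beta> (g t)"
            by (intro tendsto_diff filterlim_compose[OF elim] top)
          then show ?case by simp
        qed
        have le: "norm (F (m k) t - F (n k) t) \<le> 2" for k t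
          using norm_triangle_ineq4[of "F (m k) t" "F (n k) t"] F_bound[of "m k" t] F_bound[of "n k" t] by linarith
        have "(\<lambda>k. Lp_norm M 1 ((\<lambda>t. F (m k) t - F (n k) t) - (\<lambda>_. 0))) \<longlonglongrightarrow> 0"
          by (rule Lp_dominated_convergence(3)[OF one smeas_diff[OF F F] smeas_const ae, of "\<lambda>_. 2"])
            (use le in auto)
        then show ?thesis by (simp add: fun_diff_def)
      qed
      then have "\<forall>\<^sub>F k in sequentially. Lp_norm M 1 (\<lambda>t. F (m k) t - F (n k) t) < e"
        using e by (rule order_tendstoD)
      then obtain k where "Lp_norm M 1 (\<lambda>t. F (m k) t - F (n k) t) < e"
        by (auto simp: eventually_sequentially)
      then show False using mn(3)[of k] by (simp add: fun_diff_def)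
    qed
  qed
  then obtain G where G: "G \<in> Lp_space M 1" "(\<lambda>n. Lp_norm M 1 (F n - G)) \<longlonglongrightarrow> 0" by blast
  obtain r where r: "strict_mono r" "AE t in M. (\<lambda>n. (F (r n) - G) t) \<longlonglongrightarrow> 0"
    using Lp_convergent_AE_subseq[OF one, of "\<lambda>n. F n - G"] L.in_V(4)[OF FL G(1)] G(2) by blast
  have eq: "AE t in M. G t /\<^sub>R (1 - norm (G t)) = g t \<and> norm (G t) < 1"
    using r(2) F_lim
  proof eventually_elim
    case (elim t)
    have "(\<lambda>n. F (r n) t) \<longlonglongrightarrow> G t"
      using elim(1) by (auto intro: LIM_zero_cancel)
    moreover have "(\<lambda>n. F (r n) t) \<longlonglongrightarrow> \<beta> (g t)"
      using LIMSEQ_subseq_LIMSEQ[OF elim(2) r(1)] by (simp add: o_def)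
    ultimately have "G t = \<beta> (g t)" by (rule LIMSEQ_unique)
    then show ?case using inv \<beta>_lt by simp
  qed
  have "smeas (\<lambda>t. (\<lambda>x. x /\<^sub>R (1 - norm x)) (G t))"
  proof (rule smeas_comp[OF LpD(1)[OF one G(1)]])
    show "AE t in M. isCont (\<lambda>x. x /\<^sub>R (1 - norm x)) (G t)"
      using eq by eventually_elim (auto intro!: continuous_intros)
  qed
  then show ?thesis
    by (rule smeas_AE_cong) (use eq in \<open>eventually_elim, simp\<close>)
qed

text \<open>Convex combinations that converge in L^p converge almost everywhere along a subsequence.
  Evaluation at t is linear, so their values at t are convex combinations of the
  \<open>w k t\<close>; thus h t is a tail limit of these, and functionals on E identify it with v
  t.\<close>

lemma tail_limit_pointwise:
  fixes w :: "nat \<Rightarrow> 'a \<Rightarrow> 'e::banach"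
  assumes p: "1 \<le> p" and w: "\<And>n. w n \<in> Lp_space M p"
    and h: "seminormed_space.tail_limit (Lp_space M p) (Lp_norm M p) w h"
    and weak: "AE t in M. weakly_converges UNIV norm (\<lambda>n. w n t) (v t)"
  shows "AE t in M. h t = v t"
proof -
  interpret L: seminormed_space "Lp_space M p :: ('a \<Rightarrow> 'e) set" "Lp_norm M p"
    using p by (rule seminormed_space_Lp)
  interpret E: seminormed_space "UNIV :: 'e set" norm
    by (rule seminormed_space_norm)
  have hL: "h \<in> Lp_space M p" using h by (simp add: L.tail_limit_def)
  have "\<forall>n. \<exists>c. c \<in> convex hull (w ` {n..}) \<and> Lp_norm M p (c - h) < inverse (real (Suc n))"
  proof
    fix n
    show "\<exists>c. c \<in> convex hull (w ` {n..}) \<and> Lp_norm M p (c - h) < inverse (real (Suc n))"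
      using h unfolding L.tail_limit_def by (metis inverse_positive_iff_positive of_nat_0_less_iff zero_less_Suc)
  qed
  then obtain c where c: "\<And>n. c n \<in> convex hull (w ` {n..})" "\<And>n. Lp_norm M p (c n - h) < inverse (real (Suc n))"
    by metis
  have cL: "c n \<in> Lp_space M p" for n
    using c(1)[of n] L.hull_in_V[of "w ` {n..}"] w by blast
  have "(\<lambda>n. Lp_norm M p (c n - h)) \<longlonglongrightarrow> 0"
  proof (rule tendsto_sandwich[OF _ _ tendsto_const LIMSEQ_inverse_real_of_nat])
    show "\<forall>\<^sub>F n in sequentially. Lp_norm M p (c n - h) \<le> inverse (real (Suc n))"
      using c(2) by (intro always_eventually allI less_imp_le)
  qed (simp add: Lp_norm_nonneg[OF p])
  then obtain r where r: "strict_mono r" "AE t in M. (\<lambda>n. (c (r n) - h) t) \<longlonglongrightarrow> 0"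
    using Lp_convergent_AE_subseq[OF p, of "\<lambda>n. c n - h"] L.in_V(4)[OF cL hL] by blast
  show ?thesis
    using r(2) weak
  proof eventually_elim
    case (elim t)
    have ev: "d t \<in> convex hull ((\<lambda>k. w k t) ` {m..})" if "d \<in> convex hull (w ` {m..})" for d m
    proof -
      have "convex hull (w ` {m..}) \<subseteq> {d. d t \<in> convex hull ((\<lambda>k. w k t) ` {m..})}"
      proof (rule hull_minimal)
        show "w ` {m..} \<subseteq> {d. d t \<in> convex hull ((\<lambda>k. w k t) ` {m..})}"
          by (auto intro: hull_inc)
        show "convex {d. d t \<in> convex hull ((\<lambda>k. w k t) ` {m..})}"
          by (rule convexI) (auto intro: convexD[OF convex_convex_hull])
      qed
      with that show ?thesis by blast
    qed
    have lim: "(\<lambda>n. c (r n) t - h t) \<longlonglongrightarrow> 0" using elim(1) by simp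
    have tail: "E.tail_limit (\<lambda>k. w k t) (h t)"
      unfolding E.tail_limit_def
    proof (intro conjI allI impI)
      fix m and e :: real assume "e > 0"
      then have "\<forall>\<^sub>F n in sequentially. norm (c (r n) t - h t) < e"
        using tendstoD[OF lim] by simp
      then obtain n0 where n0: "\<And>n. n \<ge> n0 \<Longrightarrow> norm (c (r n) t - h t) < e"
        by (auto simp: eventually_sequentially)
      let ?n = "max n0 m"
      have "m \<le> r ?n" using seq_suble[OF r(1), of ?n] by simp
      then have "w ` {r ?n..} \<subseteq> w ` {m..}" by auto
      then have "c (r ?n) \<in> convex hull (w ` {m..})"
        using c(1)[of "r ?n"] hull_mono by blast
      then show "\<exists>c\<in>convex hull ((\<lambda>k. w k t) ` {m..}). norm (c - h t) < e"
        using ev n0[of ?n] by (intro bexI[of _ "c (r ?n) t"]) auto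
    qed simp
    have "norm (h t - v t) = 0"
    proof (rule E.N_eq_0_iff_functionals)
      fix \<phi> :: "'e \<Rightarrow> real" assume \<phi>: "bounded_functional UNIV norm \<phi>"
      then have "(\<lambda>n. \<phi> (w n t)) \<longlonglongrightarrow> \<phi> (v t)"
        using elim(2) by (simp add: weakly_converges_def)
      then have "\<phi> (h t) = \<phi> (v t)"
        using E.tail_limit_functional[OF _ tail \<phi>] by simp
      then show "\<phi> (h t - v t) = 0"
        using E.bf_diff[OF \<phi>] by simp
    qed simp
    then show ?case by simp
  qed
qed

text \<open>A tail limit of the bounded sequence w equals v almost everywhere, which yields both
  measurability and integrability of v. The same identification for every subsequence yields weak
  convergence.\<close>

lemma Lp_pointwise_weak_limit:
  fixes w :: "nat \<Rightarrow> 'a \<Rightarrow> 'e::banach"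
  assumes E: "uniformly_convex (UNIV :: 'e set) norm" and p: "1 < p"
    and w: "\<And>n. w n \<in> Lp_space M p" "\<And>n. Lp_norm M p (w n) \<le> b"
    and weak: "AE t in M. weakly_converges UNIV norm (\<lambda>n. w n t) (v t)"
  shows "weakly_converges (Lp_space M p) (Lp_norm M p) w v"
proof -
  have p': "1 \<le> p" using p by simp
  interpret L: uniformly_convex_space "Lp_space M p :: ('a \<Rightarrow> 'e) set" "Lp_norm M p" p
    using E p by (rule uniformly_convex_space_Lp)
  obtain g where g: "L.tail_limit w g"
    using L.tail_limit_exists[of w b] w by blast
  have "AE t in M. g t = v t"
    using p' w(1) g weak by (rule tail_limit_pointwise)
  moreover have "g \<in> Lp_space M p" using g by (simp add: L.tail_limit_def)
  ultimately have v: "v \<in> Lp_space M p"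
    using Lp_cong_AE[OF p'] by blast
  show ?thesis
  proof (rule L.weakly_converges_if_tail_limits[OF w v])
    fix r h assume r: "strict_mono (r :: nat \<Rightarrow> nat)" and h: "L.tail_limit (\<lambda>n. w (r n)) h"
    have "AE t in M. weakly_converges UNIV norm (\<lambda>n. w (r n) t) (v t)"
      using weak
    proof eventually_elim
      case (elim t)
      then show ?case
        unfolding weakly_converges_def using LIMSEQ_subseq_LIMSEQ[OF _ r] by (auto simp: o_def)
    qed
    then have "AE t in M. h t = v t"
      by (rule tail_limit_pointwise[OF p' w(1) h])
    then have "AE t in M. (h - v) t = 0" by eventually_elim simp
    then show "Lp_norm M p (h - v) = 0" by (rule Lp_norm_AE_0[OF p'])
  qed
qed

section \<open>The Bochner integral and its description by functionals\<close>

abbreviation sbochner :: "('a \<Rightarrow> 'b::real_vector) \<Rightarrow> bool" where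
  "sbochner \<equiv> Bochner_Integration.simple_bochner_integrable M"

abbreviation sintegral :: "('a \<Rightarrow> 'b::real_vector) \<Rightarrow> 'b" where
  "sintegral \<equiv> Bochner_Integration.simple_bochner_integral M"

lemma simple_bochner_integrable: "simple_function M s \<Longrightarrow> sbochner s"
  by (rule Bochner_Integration.simple_bochner_integrable.intros) auto

lemma integrable_functional:
  fixes f :: "'a \<Rightarrow> 'b::banach"
  assumes f: "smeas f" "integrable M (\<lambda>t. norm (f t))" and \<phi>: "bounded_linear \<phi>"
  shows "integrable M (\<lambda>t. \<phi> (f t) :: real)"
proof -
  obtain K where K: "\<And>x. norm (\<phi> x) \<le> norm x * K" using bounded_linear.bounded[OF \<phi>] by blast
  show ?thesis
  proof (rule Bochner_Integration.integrable_bound)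
    show "integrable M (\<lambda>t. norm (f t) * K)" using f(2) by simp
    show "(\<lambda>t. \<phi> (f t)) \<in> borel_measurable M"
      unfolding smeas_real_iff[symmetric]
      using f(1) by (rule smeas_comp) (auto intro: linear_continuous_at \<phi>)
    show "AE t in M. norm (\<phi> (f t)) \<le> norm (norm (f t) * K)"
      using K by (intro AE_I2) (auto intro: order_trans[OF _ abs_ge_self])
  qed
qed

text \<open>Applying \<phi> to the approximating simple functions approximates the scalar function.
  This reduces vector-valued integrals to scalar ones: uniqueness, the norm bound and later
  identities are all checked on functionals.\<close>

lemma has_Bochner_integral_functional:
  fixes f :: "'a \<Rightarrow> 'b::banach"
  assumes f: "smeas f" "integrable M (\<lambda>t. norm (f t))" and x: "has_Bochner_integral M f x" and \<phi>: "bounded_linear \<phi>"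
  shows "\<phi> x = (\<integral>t. (\<phi> (f t) :: real) \<partial>M)"
proof -
  obtain s where s: "\<And>n::nat. sbochner (s n)"
    and lim0: "(\<lambda>n. \<integral>\<^sup>+ t. ennreal (norm (f t - s n t)) \<partial>M) \<longlonglongrightarrow> 0"
    and limx: "(\<lambda>n. sintegral (s n)) \<longlonglongrightarrow> x"
    using x unfolding has_Bochner_integral_def by blast
  have sf: "simple_function M (s n)" for n
    using s[of n] by (auto elim: Bochner_Integration.simple_bochner_integrable.cases)
  obtain K where K: "K > 0" "\<And>x. norm (\<phi> x) \<le> norm x * K"
    using bounded_linear.pos_bounded[OF \<phi>] by blast
  have s\<phi>: "sbochner (\<lambda>t. \<phi> (s n t))" for n
    by (intro simple_bochner_integrable simple_function_compose1[OF sf])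
  have "has_bochner_integral M (\<lambda>t. \<phi> (f t)) (\<phi> x)"
  proof (rule has_bochner_integral.intros[where s = "\<lambda>n t. \<phi> (s n t)"])
    show "(\<lambda>t. \<phi> (f t)) \<in> borel_measurable M"
      using integrable_functional[OF f \<phi>] by (rule borel_measurable_integrable)
    show "sbochner (\<lambda>t. \<phi> (s n t))" for n by (rule s\<phi>)
    show "(\<lambda>n. \<integral>\<^sup>+ t. ennreal (norm (\<phi> (f t) - \<phi> (s n t))) \<partial>M) \<longlonglongrightarrow> 0"
    proof (rule tendsto_sandwich[OF _ _ tendsto_const])
      have meas: "(\<lambda>t. norm (f t - s n t)) \<in> borel_measurable M" for n
        by (rule smeas_norm[OF smeas_diff[OF f(1) smeas_simple[OF sf]]])
      show "\<forall>\<^sub>F n in sequentially. (\<integral>\<^sup>+ t. ennreal (norm (\<phi> (f t) - \<phi> (s n t))) \<partial>M) \<le>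
          ennreal K * (\<integral>\<^sup>+ t. ennreal (norm (f t - s n t)) \<partial>M)"
      proof (intro always_eventually allI)
        fix n
        have "(\<integral>\<^sup>+ t. ennreal (norm (\<phi> (f t) - \<phi> (s n t))) \<partial>M) \<le> (\<integral>\<^sup>+ t. ennreal K * ennreal (norm (f t - s n t)) \<partial>M)"
        proof (rule nn_integral_mono)
          fix t
          have "norm (\<phi> (f t) - \<phi> (s n t)) \<le> K * norm (f t - s n t)"
            using K(2)[of "f t - s n t"] linear_diff[OF bounded_linear.linear[OF \<phi>]] by (simp add: mult.commute)
          then show "ennreal (norm (\<phi> (f t) - \<phi> (s n t))) \<le> ennreal K * ennreal (norm (f t - s n t))"
            using K(1) by (simp add: ennreal_leI flip: ennreal_mult)
        qed
        also have "\<dots> = ennreal K * (\<integral>\<^sup>+ t. ennreal (norm (f t - s n t)) \<partial>M)"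
          by (rule nn_integral_cmult[OF measurable_compose[OF meas measurable_ennreal]])
        finally show "(\<integral>\<^sup>+ t. ennreal (norm (\<phi> (f t) - \<phi> (s n t))) \<partial>M) \<le>
          ennreal K * (\<integral>\<^sup>+ t. ennreal (norm (f t - s n t)) \<partial>M)" .
      qed
      show "(\<lambda>n. ennreal K * (\<integral>\<^sup>+ t. ennreal (norm (f t - s n t)) \<partial>M)) \<longlonglongrightarrow> 0"
        using ennreal_tendsto_cmult[OF _ lim0, of "ennreal K"] by simp
    qed simp
    show "(\<lambda>n. sintegral (\<lambda>t. \<phi> (s n t))) \<longlonglongrightarrow> \<phi> x"
      using bounded_linear.tendsto[OF \<phi> limx] s
      by (simp add: simple_bochner_integral_linear[OF bounded_linear.linear[OF \<phi>]])
  qed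
  then show ?thesis by (simp add: has_bochner_integral_integral_eq)
qed

text \<open>Dominated simple functions approximate f in L^1, and distances between their integrals
  are bounded by L^1 distances, so the integrals are Cauchy.\<close>

lemma has_Bochner_integral_exists:
  fixes f :: "'a \<Rightarrow> 'b::banach"
  assumes f: "smeas f" "integrable M (\<lambda>t. norm (f t))"
  shows "\<exists>x. has_Bochner_integral M f x"
proof -
  obtain s where s: "\<And>n::nat. simple_function M (s n)" "AE t in M. (\<lambda>n. s n t) \<longlonglongrightarrow> f t"
    "\<And>n t. norm (s n t) \<le> 2 * norm (f t)"
    using smeas_dominated_approx[OF f(1)] by blast
  note sb = simple_bochner_integrable[OF s(1)]
  have meas: "(\<lambda>t. norm (f t - s n t)) \<in> borel_measurable M" for n
    by (rule smeas_norm[OF smeas_diff[OF f(1) smeas_simple[OF s(1)]]])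
  have le: "norm (f t - s n t) \<le> 3 * norm (f t)" for n t
    using norm_triangle_ineq4[of "f t" "s n t"] s(3)[of n t] by linarith
  have int: "integrable M (\<lambda>t. norm (f t - s n t))" for n
    by (rule Bochner_Integration.integrable_bound[of _ "\<lambda>t. 3 * norm (f t)"]) (use f(2) le meas in auto)
  have "(\<lambda>n. \<integral>t. norm (f t - s n t) \<partial>M) \<longlonglongrightarrow> (\<integral>t. 0 \<partial>M)"
  proof (rule integral_dominated_convergence[where w = "\<lambda>t. 3 * norm (f t)"])
    show "AE t in M. (\<lambda>n. norm (f t - s n t)) \<longlonglongrightarrow> 0"
      using s(2)
    proof eventually_elim
      case (elim t)
      then have "(\<lambda>n. norm (f t - s n t)) \<longlonglongrightarrow> norm (f t - f t)"
        by (intro tendsto_intros)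
      then show ?case by simp
    qed
  qed (use f(2) le meas in auto)
  then have lim0: "(\<lambda>n. \<integral>t. norm (f t - s n t) \<partial>M) \<longlonglongrightarrow> 0" by simp
  have dist: "norm (sintegral (s m) - sintegral (s n))
      \<le> (\<integral>t. norm (f t - s m t) \<partial>M) + (\<integral>t. norm (f t - s n t) \<partial>M)" for m n
  proof -
    have sfd: "simple_function M (\<lambda>t. s m t - s n t)"
      by (rule simple_function_compose2[OF s(1) s(1)])
    note sd = simple_bochner_integrable[OF sfd]
      and sdn = simple_bochner_integrable[OF simple_function_compose1[OF sfd, of norm]]
    have "norm (sintegral (s m) - sintegral (s n)) =
        norm (sintegral (\<lambda>t. s m t - s n t))"
      using sb by (simp add: simple_bochner_integral_diff)
    also have "\<dots> \<le> sintegral (\<lambda>t. norm (s m t - s n t))"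
      by (rule simple_bochner_integral_norm_bound[OF sd])
    also have "\<dots> = (\<integral>t. norm (s m t - s n t) \<partial>M)"
      using has_bochner_integral_simple_bochner_integrable[OF sdn] by (simp add: has_bochner_integral_integral_eq)
    also have "\<dots> \<le> (\<integral>t. norm (f t - s m t) + norm (f t - s n t) \<partial>M)"
    proof (rule integral_mono)
      show "integrable M (\<lambda>t. norm (s m t - s n t))"
        using has_bochner_integral_simple_bochner_integrable[OF sdn] by (auto simp: integrable.simps)
      show "integrable M (\<lambda>t. norm (f t - s m t) + norm (f t - s n t))" using int by simp
      show "norm (s m t - s n t) \<le> norm (f t - s m t) + norm (f t - s n t)" for t by norm
    qed
    also have "\<dots> = (\<integral>t. norm (f t - s m t) \<partial>M) + (\<integral>t. norm (f t - s n t) \<partial>M)"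
      using int by simp
    finally show ?thesis .
  qed
  have "Cauchy (\<lambda>n. sintegral (s n))"
  proof (rule metric_CauchyI)
    fix e :: real assume e: "e > 0"
    have nonneg: "0 \<le> (\<integral>t. norm (f t - s n t) \<partial>M)" for n by simp
    obtain n0 where n0: "\<And>n. n \<ge> n0 \<Longrightarrow> (\<integral>t. norm (f t - s n t) \<partial>M) < e / 2"
      using LIMSEQ_D[OF lim0, of "e / 2"] e by auto
    show "\<exists>n0. \<forall>m\<ge>n0. \<forall>n\<ge>n0. dist (sintegral (s m))
        (sintegral (s n)) < e"
    proof (intro exI allI impI)
      fix m n assume "n0 \<le> m" "n0 \<le> n"
      then show "dist (sintegral (s m))
        (sintegral (s n)) < e"
        using n0[of m] n0[of n] dist[of m n] by (simp add: dist_norm)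
    qed
  qed
  then obtain x where "(\<lambda>n. sintegral (s n)) \<longlonglongrightarrow> x"
    by (auto simp: Cauchy_convergent_iff convergent_def)
  moreover have "(\<lambda>n. \<integral>\<^sup>+ t. ennreal (norm (f t - s n t)) \<partial>M) \<longlonglongrightarrow> 0"
  proof -
    have "(\<integral>\<^sup>+ t. ennreal (norm (f t - s n t)) \<partial>M) = ennreal (\<integral>t. norm (f t - s n t) \<partial>M)" for n
      using int by (intro nn_integral_eq_integral) auto
    then show ?thesis using tendsto_ennrealI[OF lim0] by simp
  qed
  ultimately show ?thesis
    unfolding has_Bochner_integral_def using f(1) sb by blast
qed

lemma Bochner_integral_functional:
  fixes f :: "'a \<Rightarrow> 'b::banach"
  assumes f: "smeas f" "integrable M (\<lambda>t. norm (f t))" and \<phi>: "bounded_linear \<phi>"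
  shows "\<phi> (Bochner_integral M f) = (\<integral>t. (\<phi> (f t) :: real) \<partial>M)"
proof -
  interpret E: seminormed_space "UNIV :: 'b set" norm by (rule seminormed_space_norm)
  have unique: "x = y" if x: "has_Bochner_integral M f x" and y: "has_Bochner_integral M f y" for x y
  proof -
    have "norm (x - y) = 0"
    proof (rule E.N_eq_0_iff_functionals)
      fix \<psi> :: "'b \<Rightarrow> real" assume "bounded_functional UNIV norm \<psi>"
      then have "bounded_linear \<psi>" by (rule bounded_linear_functional)
      then show "\<psi> (x - y) = 0"
        using has_Bochner_integral_functional[OF f x] has_Bochner_integral_functional[OF f y]
        by (simp add: linear_diff[OF bounded_linear.linear])
    qed simp
    then show ?thesis by simp
  qed
  obtain x where x: "has_Bochner_integral M f x" using has_Bochner_integral_exists[OF f] by blast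
  have "Bochner_integral M f = x"
    unfolding Bochner_integral_def using x unique by (auto intro!: the_equality)
  then show ?thesis using has_Bochner_integral_functional[OF f x \<phi>] by simp
qed

lemma norm_Bochner_integral_le:
  fixes f :: "'a \<Rightarrow> 'b::banach"
  assumes f: "smeas f" "integrable M (\<lambda>t. norm (f t))"
  shows "norm (Bochner_integral M f) \<le> (\<integral>t. norm (f t) \<partial>M)"
proof -
  interpret E: seminormed_space "UNIV :: 'b set" norm by (rule seminormed_space_norm)
  obtain \<phi> :: "'b \<Rightarrow> real" where \<phi>: "bounded_functional UNIV norm \<phi>"
    "\<phi> (Bochner_integral M f) = norm (Bochner_integral M f)" "\<And>x. \<bar>\<phi> x\<bar> \<le> norm x"
    using E.Hahn_Banach_norming[of "Bochner_integral M f"] by blast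
  have bl: "bounded_linear \<phi>" using \<phi>(1) by (rule bounded_linear_functional)
  have "norm (Bochner_integral M f) = (\<integral>t. \<phi> (f t) \<partial>M)"
    using Bochner_integral_functional[OF f bl] \<phi>(2) by simp
  also have "\<dots> \<le> (\<integral>t. norm (f t) \<partial>M)"
    using integrable_functional[OF f bl] f(2) \<phi>(3) by (intro integral_mono) (auto intro: order_trans[OF abs_ge_self])
  finally show ?thesis .
qed

end

lemma vector_eqI_functionals:
  fixes x y :: "'e::real_normed_vector"
  assumes "\<And>\<phi> :: 'e \<Rightarrow> real. bounded_linear \<phi> \<Longrightarrow> \<phi> x = \<phi> y"
  shows "x = y"
proof -
  interpret E: seminormed_space "UNIV :: 'e set" norm by (rule seminormed_space_norm)
  have "norm (x - y) = 0"
  proof (rule E.N_eq_0_iff_functionals)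
    fix \<phi> :: "'e \<Rightarrow> real" assume "bounded_functional UNIV norm \<phi>"
    then have "bounded_linear \<phi>" by (rule bounded_linear_functional)
    then show "\<phi> (x - y) = 0" using assms[of \<phi>] by (simp add: linear_diff[OF bounded_linear.linear])
  qed simp
  then show ?thesis by simp
qed

section \<open>The modulus of convexity\<close>

text \<open>Glueing is possible in \<open>L\<^sup>p\<close> of an interval: squeeze two functions into one half of the interval
  and add multiples of a constant on the other half. It makes the modulus of convexity monotone
  and continuous from the right.\<close>

locale glueing_space = uniformly_convex_space +
  assumes unit: "\<exists>x\<in>V. N x = 1"
    and glue: "x \<in> V \<Longrightarrow> y \<in> V \<Longrightarrow> 0 \<le> \<tau> \<Longrightarrow> \<tau> \<le> 1 \<Longrightarrow> \<exists>x'\<in>V. \<exists>y'\<in>V.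
      N x' powr p = (1 - \<tau>) * N x powr p + \<tau> \<and> N y' powr p = (1 - \<tau>) * N y powr p + \<tau> * \<bar>a\<bar> powr p \<and>
      N (x' - y') powr p = (1 - \<tau>) * N (x - y) powr p + \<tau> * \<bar>1 - a\<bar> powr p \<and>
      N ((x' + y') /\<^sub>R 2) powr p = (1 - \<tau>) * N ((x + y) /\<^sub>R 2) powr p + \<tau> * \<bar>(1 + a) / 2\<bar> powr p"
begin

abbreviation "\<delta> \<equiv> convexity_modulus V N"

lemma powr_eqD:
  fixes a b :: real
  assumes "0 \<le> a" "0 \<le> b" "a powr p = b powr p" shows "a = b"
proof (cases a b rule: linorder_cases)
  case less then show ?thesis using assms p_gt_1 powr_less_mono2[of p a b] by simp
next
  case greater then show ?thesis using assms p_gt_1 powr_less_mono2[of p b a] by simp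
qed

lemma N_powr_eqD: "v \<in> V \<Longrightarrow> 0 \<le> c \<Longrightarrow> N v powr p = c powr p \<Longrightarrow> N v = c"
  using powr_eqD[of "N v" c] N_nonneg[of v] by simp

lemma powr_leD:
  fixes a b :: real
  assumes "0 \<le> a" "0 \<le> b" "a powr p \<le> b powr p" shows "a \<le> b"
proof (rule ccontr)
  assume "\<not> a \<le> b"
  then show False using assms p_gt_1 powr_less_mono2[of p b a] by simp
qed

lemma midpoint_le_1:
  assumes "x \<in> V" "y \<in> V" "N x = 1" "N y = 1"
  shows "N ((x + y) /\<^sub>R 2) \<le> 1"
  using assms triangle[of x y] by (simp add: scale)

lemma midpoint_le_modulus:
  assumes x: "x \<in> V" "y \<in> V" "N x = 1" "N y = 1"
  shows "N ((x + y) /\<^sub>R 2) \<le> 1 - \<delta> (N (x - y))"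
proof -
  have "N ((x + y) /\<^sub>R 2) \<le> Sup {N ((x' + y') /\<^sub>R 2) | x' y'. x' \<in> V \<and> y' \<in> V \<and> N x' = 1 \<and> N y' = 1 \<and> N (x' - y') = N (x - y)}"
    using x midpoint_le_1 by (intro cSup_upper bdd_aboveI[of _ 1]) auto
  then show ?thesis by (simp add: convexity_modulus_def)
qed

text \<open>The pair x, -x is at distance 2. Glueing the same constant to both, with \<tau> = 1 -
  (\<epsilon>/2)^p, keeps the norms and brings the distance down to \<epsilon>. So the set in
  \<open>convexity_modulus\<close> is nonempty on all of [0,2] and its supremum is
  meaningful.\<close>

lemma unit_pair_exists:
  assumes "0 \<le> \<epsilon>" "\<epsilon> \<le> 2"
  shows "\<exists>x\<in>V. \<exists>y\<in>V. N x = 1 \<and> N y = 1 \<and> N (x - y) = \<epsilon>"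
proof -
  obtain x where x: "x \<in> V" "N x = 1" using unit by blast
  define \<tau> where "\<tau> = 1 - (\<epsilon> / 2) powr p"
  have "(\<epsilon> / 2) powr p \<le> 1 powr p"
    using assms p_gt_1 by (intro powr_mono2) auto
  then have \<tau>: "0 \<le> \<tau>" "\<tau> \<le> 1" by (auto simp: \<tau>_def)
  have "x + x = 2 *\<^sub>R x" by (simp add: scaleR_2)
  then have dist2: "N (x + x) = 2" using x by (simp add: scale)
  obtain x' y' where xy: "x' \<in> V" "y' \<in> V" "N x' powr p = (1 - \<tau>) * N x powr p + \<tau>"
    "N y' powr p = (1 - \<tau>) * N (- x) powr p + \<tau>"
    "N (x' - y') powr p = (1 - \<tau>) * N (x - - x) powr p"
    using glue[OF x(1) in_V(5)[OF x(1)] \<tau>, of 1] p_gt_1 by auto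
  have "N x' powr p = 1 powr p" "N y' powr p = 1 powr p"
    using xy x by (simp_all add: N_minus)
  moreover have "N (x' - y') powr p = \<epsilon> powr p"
    using xy(5) by (simp add: dist2 \<tau>_def powr_divide)
  ultimately have "N x' = 1" "N y' = 1" "N (x' - y') = \<epsilon>"
    using N_powr_eqD[OF xy(1), of 1] N_powr_eqD[OF xy(2), of 1] N_powr_eqD[OF in_V(4)[OF xy(1,2)], of \<epsilon>]
          assms by simp_all
  then show ?thesis using xy by blast
qed

lemma modulus_geI:
  assumes \<epsilon>: "0 \<le> \<epsilon>" "\<epsilon> \<le> 2"
    and le: "\<And>x y. x \<in> V \<Longrightarrow> y \<in> V \<Longrightarrow> N x = 1 \<Longrightarrow> N y = 1 \<Longrightarrow> N (x - y) = \<epsilon> \<Longrightarrow> N ((x + y) /\<^sub>R 2) \<le> 1 - d"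
  shows "d \<le> \<delta> \<epsilon>"
proof -
  have "Sup {N ((x + y) /\<^sub>R 2) | x y. x \<in> V \<and> y \<in> V \<and> N x = 1 \<and> N y = 1 \<and> N (x - y) = \<epsilon>} \<le> 1 - d"
    using unit_pair_exists[OF \<epsilon>] le by (intro cSup_least) blast+
  then show ?thesis by (simp add: convexity_modulus_def)
qed

lemma modulus_nonneg: "0 \<le> \<epsilon> \<Longrightarrow> \<epsilon> \<le> 2 \<Longrightarrow> 0 \<le> \<delta> \<epsilon>"
  using midpoint_le_1 by (intro modulus_geI) auto

text \<open>Glueing equal constants turns a pair at distance b into one at distance a, while the
  p-th power of the midpoint norm becomes a convex combination of its old value and 1. So the new
  midpoint is at least as long.\<close>

lemma modulus_mono:
  assumes "0 \<le> a" "a \<le> b" "b \<le> 2"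
  shows "\<delta> a \<le> \<delta> b"
proof (cases "b = 0")
  case True
  then show ?thesis using assms by simp
next
  case False
  then have b: "b > 0" using assms by simp
  define \<tau> where "\<tau> = 1 - (a / b) powr p"
  have "(a / b) powr p \<le> 1 powr p"
    using assms p_gt_1 b by (intro powr_mono2) auto
  then have \<tau>: "0 \<le> \<tau>" "\<tau> \<le> 1" by (auto simp: \<tau>_def)
  show ?thesis
  proof (rule modulus_geI)
    fix x y assume x: "x \<in> V" "y \<in> V" "N x = 1" "N y = 1" "N (x - y) = b"
    obtain x' y' where xy: "x' \<in> V" "y' \<in> V" "N x' powr p = (1 - \<tau>) * N x powr p + \<tau>"
      "N y' powr p = (1 - \<tau>) * N y powr p + \<tau>" "N (x' - y') powr p = (1 - \<tau>) * N (x - y) powr p"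
      "N ((x' + y') /\<^sub>R 2) powr p = (1 - \<tau>) * N ((x + y) /\<^sub>R 2) powr p + \<tau>"
      using glue[OF x(1,2) \<tau>, of 1] p_gt_1 by auto
    have "N x' powr p = 1 powr p" "N y' powr p = 1 powr p"
      using xy x by simp_all
    moreover have "N (x' - y') powr p = a powr p"
      using xy(5) x b by (simp add: \<tau>_def powr_divide)
    ultimately have n: "N x' = 1" "N y' = 1" "N (x' - y') = a"
      using N_powr_eqD[OF xy(1), of 1] N_powr_eqD[OF xy(2), of 1] N_powr_eqD[OF in_V(4)[OF xy(1,2)], of a]
          assms by simp_all
    have "N ((x + y) /\<^sub>R 2) powr p \<le> 1 powr p"
      using midpoint_le_1[OF x(1-4)] x p_gt_1 N_nonneg by (intro powr_mono2) auto
    then have "\<tau> * N ((x + y) /\<^sub>R 2) powr p \<le> \<tau> * 1"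
      using \<tau> by (intro mult_left_mono) auto
    then have "N ((x + y) /\<^sub>R 2) powr p \<le> N ((x' + y') /\<^sub>R 2) powr p"
      unfolding xy(6) by (simp add: left_diff_distrib)
    then have "N ((x + y) /\<^sub>R 2) \<le> N ((x' + y') /\<^sub>R 2)"
      using powr_leD[OF N_nonneg N_nonneg] x(1,2) xy(1,2) by simp
    also have "\<dots> \<le> 1 - \<delta> a"
      using midpoint_le_modulus[of x' y'] xy(1,2) n by simp
    finally show "N ((x + y) /\<^sub>R 2) \<le> 1 - \<delta> a" .
  qed (use assms in auto)
qed

text \<open>Glueing opposite constants moves the p-th power of the distance a little towards 2^p and
  multiplies that of the midpoint norm by 1 - \<tau>. As \<tau> <= \<eta>, the midpoint norm drops
  by at most \<eta>.\<close>

lemma modulus_right_continuous: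
  assumes a: "0 \<le> a" "a < 2" and \<eta>: "\<eta> > 0"
  shows "\<exists>b>a. b \<le> 2 \<and> \<delta> b \<le> \<delta> a + \<eta>"
proof -
  define \<tau> where "\<tau> = min 1 \<eta>"
  have \<tau>: "0 < \<tau>" "\<tau> \<le> 1" "\<tau> \<le> \<eta>" using \<eta> by (auto simp: \<tau>_def)
  have lt: "a powr p < 2 powr p" using a p_gt_1 by (intro powr_less_mono2) auto
  define B where "B = (1 - \<tau>) * a powr p + \<tau> * 2 powr p"
  define b where "b = B powr (1 / p)"
  have B0: "0 \<le> B" unfolding B_def using \<tau> by (intro add_nonneg_nonneg mult_nonneg_nonneg) auto
  have bp: "b powr p = B" using p_gt_1 B0 by (simp add: b_def powr_powr)
  have b0: "0 \<le> b" by (simp add: b_def)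
  have "0 < \<tau> * (2 powr p - a powr p)" "0 \<le> (1 - \<tau>) * (2 powr p - a powr p)"
    using \<tau> lt by auto
  then have "a powr p < B" "B \<le> 2 powr p"
    by (auto simp: B_def algebra_simps)
  then have "a powr p < b powr p" "b powr p \<le> 2 powr p" by (auto simp: bp)
  then have ab: "a < b" "b \<le> 2"
    using powr_mono2[of p b a] powr_leD[of b 2] a b0 p_gt_1 by (auto simp: not_le[symmetric])
  have "1 - \<delta> a \<le> 1 - (\<delta> b - \<eta>)"
  proof -
    have "\<delta> b - \<eta> \<le> \<delta> a"
    proof (rule modulus_geI)
      fix x y assume x: "x \<in> V" "y \<in> V" "N x = 1" "N y = 1" "N (x - y) = a"
      obtain x' y' where xy: "x' \<in> V" "y' \<in> V" "N x' powr p = (1 - \<tau>) * N x powr p + \<tau>"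
        "N y' powr p = (1 - \<tau>) * N y powr p + \<tau>"
        "N (x' - y') powr p = (1 - \<tau>) * N (x - y) powr p + \<tau> * 2 powr p"
        "N ((x' + y') /\<^sub>R 2) powr p = (1 - \<tau>) * N ((x + y) /\<^sub>R 2) powr p"
        using glue[OF x(1,2) less_imp_le[OF \<tau>(1)] \<tau>(2), of "-1"] p_gt_1 by auto
      have "N x' powr p = 1 powr p" "N y' powr p = 1 powr p"
        using xy x by simp_all
      moreover have "N (x' - y') powr p = b powr p"
        unfolding bp using xy(5) x by (simp add: B_def)
      ultimately have n: "N x' = 1" "N y' = 1" "N (x' - y') = b"
        using N_powr_eqD[OF xy(1), of 1] N_powr_eqD[OF xy(2), of 1] N_powr_eqD[OF in_V(4)[OF xy(1,2)], of b]
          b0 by simp_all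
      let ?m = "N ((x + y) /\<^sub>R 2)"
      have m: "0 \<le> ?m" "?m \<le> 1" using midpoint_le_1[OF x(1-4)] x by (simp_all add: N_nonneg)
      have "(1 - \<tau>) powr p \<le> (1 - \<tau>) powr 1"
        using \<tau> p_gt_1 by (intro powr_mono') auto
      then have "((1 - \<tau>) * ?m) powr p \<le> (1 - \<tau>) * ?m powr p"
        using \<tau> m by (simp add: powr_mult mult_right_mono)
      then have "(1 - \<tau>) * ?m \<le> N ((x' + y') /\<^sub>R 2)"
        using powr_leD[OF _ N_nonneg, of "(1 - \<tau>) * ?m" "(x' + y') /\<^sub>R 2"] \<tau> m xy(1,2,6) by simp
      also have "\<dots> \<le> 1 - \<delta> b"
        using midpoint_le_modulus[of x' y'] xy(1,2) n by simp
      finally have "?m - \<tau> * ?m \<le> 1 - \<delta> b" by (simp add: left_diff_distrib)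
      moreover have "\<tau> * ?m \<le> \<tau> * 1" using \<tau> m by (intro mult_left_mono) auto
      ultimately show "?m \<le> 1 - (\<delta> b - \<eta>)" using \<tau>(3) by linarith
    qed (use a in auto)
    then show ?thesis by simp
  qed
  then show ?thesis using ab by (intro exI[of _ b]) auto
qed

text \<open>In the convexity inequality for x and -y the midpoint is (x - y)/2, of norm 1, so the
  defect vanishes and N (x + y) = 0. This settles the splitting 2 + 2, where right continuity has no
  room.\<close>

lemma modulus_2: "1 \<le> \<delta> 2"
proof (rule modulus_geI)
  fix x y assume x: "x \<in> V" "y \<in> V" "N x = 1" "N y = 1" "N (x - y) = 2"
  have "N (x + y) powr p \<le> 0"
  proof (rule field_le_epsilon)
    fix e :: real assume e: "e > 0"
    then obtain K where "\<forall>x\<in>V. \<forall>y\<in>V. N (x - y) powr p \<le> e / 2 * (N x powr p + N y powr p) +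
        K * ((N x powr p + N y powr p) / 2 - N ((x + y) /\<^sub>R 2) powr p)"
      using convexity[of "e / 2"] by auto
    from this[rule_format, OF x(1) in_V(5)[OF x(2)]]
    show "N (x + y) powr p \<le> 0 + e"
      using x by (simp add: N_minus scale)
  qed
  then have "N (x + y) = 0"
    using N_nonneg[of "x + y"] x by (metis antisym in_V(2) powr_eq_0_iff powr_ge_zero)
  then show "N ((x + y) /\<^sub>R 2) \<le> 1 - 1" using x by (simp add: scale)
qed auto

text \<open>x is the sum of the midpoint and half the difference, so the midpoint has norm at least
  1 - a/2. Hence no candidate for \<open>epsilon0\<close> is below 1, and their infimum is
  positive.\<close>

lemma modulus_le_half:
  assumes "0 \<le> a" "a \<le> 2" shows "\<delta> a \<le> a / 2"
proof -
  obtain x y where x: "x \<in> V" "y \<in> V" "N x = 1" "N y = 1" "N (x - y) = a"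
    using unit_pair_exists[OF assms] by blast
  have "x = (x + y) /\<^sub>R 2 + (x - y) /\<^sub>R 2"
    by (simp flip: scaleR_add_right)
  then have "N x \<le> N ((x + y) /\<^sub>R 2) + N ((x - y) /\<^sub>R 2)"
    using triangle[of "(x + y) /\<^sub>R 2" "(x - y) /\<^sub>R 2"] x by simp
  then show ?thesis
    using midpoint_le_modulus[OF x(1-4)] x by (simp add: scale)
qed

text \<open>The least real with the property exists only if the infimum m of all such reals has it.
  Candidates approach m from above; enlarging one part of a splitting of m makes the sum a
  candidate, and right continuity of the modulus leads back to m.\<close>

lemma epsilon0_property:
  "1 \<le> epsilon0 V N"
  "\<forall>e1 e2. 0 \<le> e1 \<longrightarrow> e1 \<le> 2 \<longrightarrow> 0 \<le> e2 \<longrightarrow> e2 \<le> 2 \<longrightarrow> epsilon0 V N = e1 + e2 \<longrightarrow> 1 / 2 \<le> \<delta> e1 + \<delta> e2"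
proof -
  define P where "P e \<longleftrightarrow> 0 < e \<and> (\<forall>e1 e2. 0 \<le> e1 \<longrightarrow> e1 \<le> 2 \<longrightarrow> 0 \<le> e2 \<longrightarrow> e2 \<le> 2 \<longrightarrow> e = e1 + e2 \<longrightarrow>
      \<delta> e1 + \<delta> e2 \<ge> 1 / 2)" for e
  have P_ge: "1 \<le> e" if "P e" for e
  proof (rule ccontr)
    assume "\<not> 1 \<le> e"
    then have "1 / 2 \<le> \<delta> (e / 2) + \<delta> (e / 2)" "\<delta> (e / 2) \<le> e / 2 / 2"
      using that[unfolded P_def, THEN conjunct2, rule_format, of "e / 2" "e / 2"] that
        modulus_le_half[of "e / 2"] by (auto simp: P_def)
    then show False using \<open>\<not> 1 \<le> e\<close> by simp
  qed
  define m where "m = Inf {e. P e}"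
  \<comment> \<open>Two parts in [0,2] never add up to 5, so the condition is vacuous there.\<close>
  have "P 5" by (auto simp: P_def)
  have bdd: "bdd_below {e. P e}" using P_ge by (intro bdd_belowI[of _ 1]) auto
  have m1: "1 \<le> m" unfolding m_def using \<open>P 5\<close> P_ge by (intro cInf_greatest) auto
  have close: "\<exists>e. P e \<and> m \<le> e \<and> e < m + t" if "t > 0" for t
  proof -
    obtain e where "P e" "e < m + t"
      using cInf_lessD[of "{e. P e}" "m + t"] \<open>P 5\<close> \<open>t > 0\<close> by (auto simp: m_def)
    moreover have "m \<le> e" unfolding m_def using \<open>P e\<close> bdd by (intro cInf_lower) auto
    ultimately show ?thesis by blast
  qed
  have half: "1 / 2 \<le> \<delta> a + \<delta> b" if ab: "0 \<le> a" "a < 2" "0 \<le> b" "b \<le> 2" "m = a + b" for a b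
  proof (rule field_le_epsilon)
    fix \<eta> :: real assume "\<eta> > 0"
    then obtain c where c: "a < c" "c \<le> 2" "\<delta> c \<le> \<delta> a + \<eta>"
      using modulus_right_continuous[OF ab(1,2)] by blast
    obtain e where e: "P e" "m \<le> e" "e < m + (c - a)"
      using close[of "c - a"] c by auto
    have "1 / 2 \<le> \<delta> (e - b) + \<delta> b"
      using e ab c unfolding P_def by auto
    moreover have "\<delta> (e - b) \<le> \<delta> c"
      using e ab c by (intro modulus_mono) auto
    ultimately show "1 / 2 \<le> \<delta> a + \<delta> b + \<eta>" using c by simp
  qed
  have "P m"
    unfolding P_def
  proof (intro conjI allI impI)
    fix a b assume ab: "0 \<le> a" "a \<le> 2" "0 \<le> b" "b \<le> 2" "m = a + b"
    consider "a < 2" | "b < 2" | "a = 2" "b = 2" using ab by linarith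
    then show "1 / 2 \<le> \<delta> a + \<delta> b"
    proof cases
      case 1 then show ?thesis using half ab by auto
    next
      case 2 then show ?thesis using half[of b a] ab by (simp add: add.commute)
    next
      case 3 then show ?thesis using modulus_2 by simp
    qed
  qed (use m1 in simp)
  moreover have "epsilon0 V N = m"
    unfolding epsilon0_def P_def[symmetric]
    using \<open>P m\<close> bdd by (intro Least_equality) (auto simp: m_def intro: cInf_lower)
  ultimately show "1 \<le> epsilon0 V N"
    "\<forall>e1 e2. 0 \<le> e1 \<longrightarrow> e1 \<le> 2 \<longrightarrow> 0 \<le> e2 \<longrightarrow> e2 \<le> 2 \<longrightarrow> epsilon0 V N = e1 + e2 \<longrightarrow> 1 / 2 \<le> \<delta> e1 + \<delta> e2"
    using m1 unfolding P_def by auto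
qed

text \<open>The defining property needs an exact splitting. Both parts are lowered until the sum is
  exact, and monotonicity of the modulus restores them.\<close>

lemma epsilon0_le_sum:
  assumes ab: "0 \<le> a" "a \<le> 2" "0 \<le> b" "b \<le> 2" and le: "epsilon0 V N \<le> a + b"
  shows "1 / 2 \<le> \<delta> a + \<delta> b"
proof -
  define a' where "a' = min a (epsilon0 V N)"
  define b' where "b' = epsilon0 V N - a'"
  have "0 \<le> a'" "a' \<le> a" "0 \<le> b'" "b' \<le> b" "epsilon0 V N = a' + b'"
    using ab le epsilon0_property(1) by (auto simp: a'_def b'_def)
  moreover from this have "1 / 2 \<le> \<delta> a' + \<delta> b'"
    using epsilon0_property(2) ab by (meson order_trans)
  ultimately show ?thesis
    using modulus_mono[of a' a] modulus_mono[of b' b] ab by linarith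
qed


lemma norm_add_le_of_angles:
  assumes a: "a \<in> V" "N a \<le> R" and b: "b \<in> V" "N b \<le> R"
    and angle: "N a \<noteq> 0 \<Longrightarrow> N b \<noteq> 0 \<Longrightarrow> N (a + b) \<noteq> 0 \<Longrightarrow>
      epsilon0 V N \<le> vangle N a (a + b) + vangle N b (a + b)"
  shows "N (a + b) \<le> R"
\<comment> \<open>With a vanishing norm the angle condition is void, but then a + b has norm 0 or is
  no longer than one summand.\<close>
proof (cases "N a = 0 \<or> N b = 0 \<or> N (a + b) = 0")
  case True
  then show ?thesis using triangle[OF a(1) b(1)] a b N_nonneg[of a] N_nonneg[of b] by auto
next
  case False
  have R: "R \<ge> 0" using a N_nonneg[of a] by simp
  define z where "z = (a + b) /\<^sub>R N (a + b)"
  obtain \<phi> where \<phi>: "bounded_functional V N \<phi>" "\<phi> (a + b) = N (a + b)" "\<And>x. x \<in> V \<Longrightarrow> \<bar>\<phi> x\<bar> \<le> N x"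
    using Hahn_Banach_norming[of "a + b"] a b by auto
  have abV: "a + b \<in> V" using a b by simp
  have zV: "z \<in> V" using abV by (simp add: z_def)
  have z1: "N z = 1" using False N_nonneg[OF abV] abV by (simp add: z_def scale)
  have \<phi>z: "\<phi> z = 1" using False \<phi> abV by (simp add: z_def bf_scale)
  have key: "\<phi> v \<le> R * max 0 (1 - 2 * \<delta> (vangle N v (a + b)))" "0 \<le> vangle N v (a + b)" "vangle N v (a + b) \<le> 2"
    if v: "v \<in> V" "N v \<le> R" "N v \<noteq> 0" for v
  proof -
    define x where "x = v /\<^sub>R N v"
    have x: "x \<in> V" "N x = 1" using v N_nonneg[OF v(1)] by (auto simp: x_def scale)
    have e: "vangle N v (a + b) = N (x - z)" by (simp add: vangle_def x_def z_def)
    show "0 \<le> vangle N v (a + b)" using x zV by (simp add: e N_nonneg)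
    show "vangle N v (a + b) \<le> 2" using N_diff[OF x(1) zV] x z1 by (simp add: e)
    have "\<phi> x + \<phi> z = \<phi> (x + z)" using \<phi>(1) x zV by (simp add: bf_add)
    also have "\<dots> \<le> N (x + z)" using \<phi>(3)[of "x + z"] x zV by simp
    also have "\<dots> = 2 * N ((x + z) /\<^sub>R 2)" using x zV by (simp add: scale)
    also have "\<dots> \<le> 2 * (1 - \<delta> (N (x - z)))"
      using midpoint_le_modulus[OF x(1) zV x(2) z1] by simp
    \<comment> \<open>Subtracting \<phi> z = 1 from the bound 2 - 2 \<delta> gives 1 - 2 \<delta>.
      The truncation at 0 makes the factor nonnegative, so that N v may be replaced by R.\<close>
    finally have "\<phi> x \<le> max 0 (1 - 2 * \<delta> (N (x - z)))" using \<phi>z by simp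
    then have "N v * \<phi> x \<le> N v * max 0 (1 - 2 * \<delta> (N (x - z)))"
      using N_nonneg[OF v(1)] by (rule mult_left_mono)
    also have "\<dots> \<le> R * max 0 (1 - 2 * \<delta> (N (x - z)))"
      using v(2) by (intro mult_right_mono) auto
    also have "N v * \<phi> x = \<phi> v" using \<phi>(1) v by (simp add: x_def bf_scale)
    finally show "\<phi> v \<le> R * max 0 (1 - 2 * \<delta> (vangle N v (a + b)))" by (simp add: e)
  qed
  note ka = key[OF a] and kb = key[OF b]
  have nz: "N a \<noteq> 0" "N b \<noteq> 0" "N (a + b) \<noteq> 0" using False by auto
  let ?da = "\<delta> (vangle N a (a + b))" and ?db = "\<delta> (vangle N b (a + b))"
  have "1 / 2 \<le> ?da + ?db"
    using ka[OF nz(1)] kb[OF nz(2)] angle[OF nz] by (intro epsilon0_le_sum)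
  moreover have "0 \<le> ?da" "0 \<le> ?db"
    using ka[OF nz(1)] kb[OF nz(2)] by (auto intro!: modulus_nonneg)
  \<comment> \<open>Nonnegativity of the moduli covers the case that one term is truncated: the
    other is then still at most 1.\<close>
  ultimately have "max 0 (1 - 2 * ?da) + max 0 (1 - 2 * ?db) \<le> 1" by auto
  then have "R * (max 0 (1 - 2 * ?da) + max 0 (1 - 2 * ?db)) \<le> R * 1"
    using R by (rule mult_left_mono)
  moreover have "N (a + b) = \<phi> a + \<phi> b" using \<phi> a b by (simp add: bf_add)
  ultimately show ?thesis
    using ka(1)[OF nz(1)] kb(1)[OF nz(2)] by (simp add: distrib_left)
qed

end

section \<open>Lebesgue-Bochner spaces of an interval\<close>

lemma complete_finite_measure_interval: "complete_finite_measure (lebesgue_on {a..b::real})"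
proof -
  interpret finite_measure "lebesgue_on {a..b}"
    by (rule finite_measure_lebesgue_on) simp
  show ?thesis
  proof
    fix A B :: "real set" assume "B \<subseteq> A" "A \<in> null_sets (lebesgue_on {a..b})"
    then have "B \<in> null_sets lebesgue" "B \<subseteq> {a..b}"
      using null_sets_completion_subset by (auto simp: null_sets_restrict_space)
    then show "B \<in> sets (lebesgue_on {a..b})"
      by (auto simp: sets_restrict_space_iff)
  qed
qed

lemma measurable_lebesgue_double: "(\<lambda>x :: real. 2 * x) \<in> lebesgue \<rightarrow>\<^sub>M lebesgue"
proof -
  have "(*\<^sub>R) (2 :: real) = (\<lambda>x :: real. 2 * x)" by (simp add: fun_eq_iff)
  then show ?thesis using lebesgue_measurable_scaling[of "2 :: real", where 'a = real] by simp
qed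

lemma AE_lebesgue_double:
  assumes "AE x in lebesgue. P (x :: real)"
  shows "AE x in lebesgue. P (2 * x)"
proof -
  obtain Z where Z: "Z \<in> null_sets lebesgue" "\<And>x. \<not> P x \<Longrightarrow> x \<in> Z"
    using assms by (auto simp: eventually_ae_filter)
  note m = measurable_lebesgue_double
  have "0 = (\<integral>\<^sup>+x. indicator Z x \<partial>(lebesgue :: real measure))"
    using Z by (subst nn_integral_indicator) auto
  also have "\<dots> = ennreal \<bar>2\<bar> * (\<integral>\<^sup>+x. indicator Z (0 + 2 * x) \<partial>lebesgue)"
    using Z by (intro nn_integral_real_affine_lebesgue) auto
  finally have "(\<integral>\<^sup>+x. indicator Z (2 * x) \<partial>(lebesgue :: real measure)) = 0" by simp
  moreover have "(\<lambda>x. indicator Z (2 * x) :: ennreal) \<in> borel_measurable lebesgue"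
    using Z by (intro measurable_compose[OF m] borel_measurable_indicator) auto
  ultimately have "AE x in lebesgue. indicator Z (2 * x :: real) = (0 :: ennreal)"
    by (simp add: nn_integral_0_iff_AE)
  then show ?thesis
    by eventually_elim (use Z in \<open>auto simp: indicator_def split: if_splits\<close>)
qed

text \<open>Squeezing u by t -> 2t halves the integral of its p-th power, whence the factor 1/2; the
  constant lives on an interval of length T/2. Strong measurability follows by squeezing the
  approximating simple functions as well.\<close>

lemma Lp_glue:
  fixes u :: "real \<Rightarrow> 'e::banach" and c :: 'e
  assumes p: "1 \<le> p" and T: "0 < T" and \<alpha>: "0 \<le> \<alpha>" and u: "u \<in> Lp_space (lebesgue_on {0..T}) p"
  defines "g \<equiv> \<lambda>t. if t \<le> T / 2 then \<alpha> *\<^sub>R u (2 * t) else c"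
  shows "g \<in> Lp_space (lebesgue_on {0..T}) p"
    and "Lp_norm (lebesgue_on {0..T}) p g powr p =
      \<alpha> powr p / 2 * Lp_norm (lebesgue_on {0..T}) p u powr p + T / 2 * norm c powr p"
proof -
  let ?M = "lebesgue_on {0..T}"
  let ?I = "\<alpha> powr p / 2 * Lp_norm ?M p u powr p + T / 2 * norm c powr p"
  interpret complete_finite_measure ?M by (rule complete_finite_measure_interval)
  have I: "{0..T} \<inter> space lebesgue \<in> sets lebesgue" "{0..T} \<in> sets lebesgue" by auto
  note m = measurable_lebesgue_double
  obtain s where s: "\<And>n::nat. simple_function ?M (s n)" "AE t in ?M. (\<lambda>n. s n t) \<longlonglongrightarrow> u t"
    using LpD(1)[OF p u] unfolding smeas_iff by blast
  define r where "r n t = (if t \<le> T / 2 then \<alpha> *\<^sub>R s n (2 * t) else c)" for n t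
  have "simple_function ?M (r n)" for n
    unfolding simple_function_def
  proof (intro conjI ballI)
    have "r n ` space ?M \<subseteq> (\<lambda>y. \<alpha> *\<^sub>R y) ` s n ` {0..T} \<union> {c}"
      by (auto simp: r_def)
    moreover have "finite (s n ` {0..T})" using s(1)[of n] by (simp add: simple_function_def)
    ultimately show "finite (r n ` space ?M)" by (auto intro: finite_subset)
    fix y
    have "s n -` {v. \<alpha> *\<^sub>R v = y} \<inter> space ?M \<in> sets ?M"
      using s(1) by (rule simple_functionD)
    then have S: "s n -` {v. \<alpha> *\<^sub>R v = y} \<inter> {0..T} \<in> sets lebesgue"
      using I by (simp add: sets_restrict_space_iff)
    have "(\<lambda>x. 2 * x) -` (s n -` {v. \<alpha> *\<^sub>R v = y} \<inter> {0..T}) \<inter> space lebesgue \<in> sets lebesgue"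
      using m S by (rule measurable_sets)
    moreover have "{T / 2<..T} \<in> sets lebesgue" by auto
    moreover have "r n -` {y} \<inter> space ?M =
      (\<lambda>x. 2 * x) -` (s n -` {v. \<alpha> *\<^sub>R v = y} \<inter> {0..T}) \<union> (if c = y then {T / 2<..T} else {})"
      using T by (auto simp: r_def split: if_splits)
    ultimately have "r n -` {y} \<inter> space ?M \<in> sets lebesgue" by auto
    then show "r n -` {y} \<inter> space ?M \<in> sets ?M"
      using I by (simp add: sets_restrict_space_iff)
  qed
  moreover have "AE t in ?M. (\<lambda>n. r n t) \<longlonglongrightarrow> g t"
  proof -
    have "AE t in lebesgue. t \<in> {0..T} \<longrightarrow> (\<lambda>n. s n t) \<longlonglongrightarrow> u t"
      using s(2) I by (simp add: AE_restrict_space_iff)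
    then have "AE t in lebesgue. 2 * t \<in> {0..T} \<longrightarrow> (\<lambda>n. s n (2 * t)) \<longlonglongrightarrow> u (2 * t)"
      by (rule AE_lebesgue_double)
    then have "AE t in lebesgue. t \<in> {0..T} \<longrightarrow> (\<lambda>n. r n t) \<longlonglongrightarrow> g t"
      by eventually_elim (auto simp: r_def g_def intro!: tendsto_intros)
    then show ?thesis using I by (simp add: AE_restrict_space_iff)
  qed
  ultimately have g: "smeas g" unfolding smeas_iff by blast
  have nn: "(\<integral>\<^sup>+t. ennreal (norm (v t) powr p) \<partial>?M) = (\<integral>\<^sup>+t. ennreal (norm (v t) powr p) * indicator {0..T} t \<partial>lebesgue)"
    for v :: "real \<Rightarrow> 'e"
    using I by (intro nn_integral_restrict_space) auto
  define F where "F t = ennreal (norm (u t) powr p) * indicator {0..T} t" for t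
  have F: "F \<in> borel_measurable lebesgue"
  proof -
    have "(\<lambda>t. ennreal (norm (u t) powr p)) \<in> borel_measurable ?M"
      by (rule measurable_compose[OF smeas_norm_powr[OF p LpD(1)[OF p u]] measurable_ennreal])
    then show ?thesis
      unfolding F_def by (rule iffD1[OF borel_measurable_restrict_space_iff_ennreal[OF I(1)]])
  qed
  have F2: "(\<lambda>x. F (2 * x)) \<in> borel_measurable lebesgue"
    by (rule measurable_compose[OF m F])
  have Iu: "(\<integral>\<^sup>+t. F t \<partial>lebesgue) = ennreal (Lp_norm ?M p u powr p)"
    unfolding F_def nn[symmetric] Lp_norm_powr[OF p]
    using LpD(2)[OF p u] by (intro nn_integral_eq_integral) auto
  have "(\<integral>\<^sup>+t. F t \<partial>lebesgue) = ennreal 2 * (\<integral>\<^sup>+x. F (2 * x) \<partial>lebesgue)"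
    using nn_integral_real_affine_lebesgue[OF F, of 2 0] by simp
  then have dbl: "ennreal 2 * (\<integral>\<^sup>+x. F (2 * x) \<partial>lebesgue) = ennreal (Lp_norm ?M p u powr p)"
    by (simp only: Iu)
  have "ennreal (1 / 2) * ennreal 2 = ennreal (1 / 2 * 2)"
    by (rule ennreal_mult[symmetric]) auto
  then have "(\<integral>\<^sup>+x. F (2 * x) \<partial>lebesgue) = ennreal (1 / 2) * (ennreal 2 * (\<integral>\<^sup>+x. F (2 * x) \<partial>lebesgue))"
    by (simp only: mult.assoc[symmetric]) simp
  then have half: "(\<integral>\<^sup>+x. F (2 * x) \<partial>lebesgue) = ennreal (1 / 2 * Lp_norm ?M p u powr p)"
    unfolding dbl by (simp only: ennreal_mult[symmetric] powr_ge_zero)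
  have "(\<integral>\<^sup>+t. ennreal (norm (g t) powr p) \<partial>?M) =
      (\<integral>\<^sup>+t. ennreal (\<alpha> powr p) * F (2 * t) + ennreal (norm c powr p) * indicator {T / 2<..T} t \<partial>lebesgue)"
    unfolding nn
  proof (rule nn_integral_cong)
    fix t
    consider "t < 0" | "0 \<le> t" "t \<le> T / 2" | "T / 2 < t" "t \<le> T" | "T < t" by linarith
    then show "ennreal (norm (g t) powr p) * indicator {0..T} t =
        ennreal (\<alpha> powr p) * F (2 * t) + ennreal (norm c powr p) * indicator {T / 2<..T} t"
      using T \<alpha> by cases (simp_all add: g_def F_def powr_mult ennreal_mult)
  qed
  also have "\<dots> = ennreal (\<alpha> powr p) * (\<integral>\<^sup>+t. F (2 * t) \<partial>lebesgue) + ennreal (norm c powr p) * emeasure lebesgue {T / 2<..T}"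
  proof -
    have "{T / 2<..T} \<in> sets lebesgue" by auto
    then have ind: "(\<lambda>t. ennreal (norm c powr p) * indicator {T / 2<..T} t) \<in> borel_measurable lebesgue"
      by measurable
    have aF: "(\<lambda>t. ennreal (\<alpha> powr p) * F (2 * t)) \<in> borel_measurable lebesgue"
      using F2 by measurable
    show ?thesis
      unfolding nn_integral_add[OF aF ind] nn_integral_cmult[OF F2]
      by (subst nn_integral_cmult_indicator) auto
  qed
  also have "\<dots> = ennreal (?I)"
  proof -
    have "emeasure lebesgue {T / 2<..T} = ennreal (T / 2)" using T by simp
    then have "ennreal (\<alpha> powr p) * (\<integral>\<^sup>+t. F (2 * t) \<partial>lebesgue) + ennreal (norm c powr p) * emeasure lebesgue {T / 2<..T}
        = ennreal (\<alpha> powr p * (1 / 2 * Lp_norm ?M p u powr p) + norm c powr p * (T / 2))"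
    proof -
      have "ennreal x * ennreal y + ennreal z * ennreal w = ennreal (x * y + z * w)"
        if "0 \<le> x" "0 \<le> y" "0 \<le> z" "0 \<le> w" for x y z w
        using that by (simp add: ennreal_mult)
      from this[of "\<alpha> powr p" "1 / 2 * Lp_norm ?M p u powr p" "norm c powr p" "T / 2"] T
      show ?thesis using \<open>emeasure lebesgue {T / 2<..T} = ennreal (T / 2)\<close> half by simp
    qed
    then show ?thesis by (simp add: mult.commute)
  qed
  finally have *: "(\<integral>\<^sup>+t. ennreal (norm (g t) powr p) \<partial>?M) =
      ennreal (?I)" .
  have int: "integrable ?M (\<lambda>t. norm (g t) powr p)"
    by (rule integrableI_bounded[OF smeas_norm_powr[OF p g]]) (simp add: *)
  with g show "g \<in> Lp_space ?M p" by (simp add: Lp_space_def)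
  have "ennreal (\<integral>t. norm (g t) powr p \<partial>?M) = ennreal (?I)"
    using int * by (subst nn_integral_eq_integral[symmetric]) auto
  then show "Lp_norm ?M p g powr p = ?I"
    unfolding Lp_norm_powr[OF p] using T by (subst (asm) ennreal_inj) auto
qed

lemma glueing_space_Lp:
  assumes E: "uniformly_convex (UNIV :: 'e::banach set) norm" and p: "1 < p" and T: "0 < T"
    and e: "(e :: 'e) \<noteq> 0"
  shows "glueing_space (Lp_space (lebesgue_on {0..T}) p :: (real \<Rightarrow> 'e) set) (Lp_norm (lebesgue_on {0..T}) p) p"
proof -
  let ?M = "lebesgue_on {0..T}"
  let ?N = "Lp_norm ?M p :: (real \<Rightarrow> 'e) \<Rightarrow> real"
  interpret M: complete_finite_measure ?M by (rule complete_finite_measure_interval)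
  interpret L: uniformly_convex_space "Lp_space ?M p :: (real \<Rightarrow> 'e) set" "?N" p
    using E p by (rule M.uniformly_convex_space_Lp)
  have p': "1 \<le> p" using p by simp
  \<comment> \<open>The factors are p-th roots that cancel 1/2 and T/2 in the norm formula, so the
    two halves contribute (1 - \<tau>) times the p-th power of the norm of u and \<tau> |a|^p. The
    construction is linear in the pair (u, a), so differences and midpoints of glued functions are
    glued again.\<close>
  define glue where "glue \<tau> u a = (\<lambda>t. if t \<le> T / 2 then (2 * (1 - \<tau>)) powr (1 / p) *\<^sub>R u (2 * t)
    else (a * (2 * \<tau> / T) powr (1 / p)) *\<^sub>R sgn e)" for \<tau> a and u :: "real \<Rightarrow> 'e"
  have glue_V: "glue \<tau> u a \<in> Lp_space ?M p" if "u \<in> Lp_space ?M p" for \<tau> u a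
    unfolding glue_def by (rule Lp_glue(1)[OF p' T _ that]) simp
  have glue_N: "?N (glue \<tau> u a) powr p = (1 - \<tau>) * ?N u powr p + \<tau> * \<bar>a\<bar> powr p"
    if "u \<in> Lp_space ?M p" "0 \<le> \<tau>" "\<tau> \<le> 1" for \<tau> u a
  proof -
    have "?N (glue \<tau> u a) powr p = ((2 * (1 - \<tau>)) powr (1 / p)) powr p / 2 * ?N u powr p +
        T / 2 * norm ((a * (2 * \<tau> / T) powr (1 / p)) *\<^sub>R sgn e) powr p"
      unfolding glue_def by (rule Lp_glue(2)[OF p' T _ that(1)]) simp
    also have "norm ((a * (2 * \<tau> / T) powr (1 / p)) *\<^sub>R sgn e) = \<bar>a\<bar> * (2 * \<tau> / T) powr (1 / p)"
      using e by (simp add: norm_sgn abs_mult)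
    finally show ?thesis
      using that T p by (simp add: powr_mult powr_powr powr_divide)
  qed
  have glue_diff: "glue \<tau> u a - glue \<tau> v b = glue \<tau> (u - v) (a - b)" for \<tau> u v a b
    by (auto simp: glue_def fun_eq_iff scaleR_diff_right left_diff_distrib scaleR_diff_left)
  have glue_mid: "(glue \<tau> u a + glue \<tau> v b) /\<^sub>R 2 = glue \<tau> ((u + v) /\<^sub>R 2) ((a + b) / 2)" for \<tau> u v a b
  proof
    fix t
    have "((a * k) *\<^sub>R w + (b * k) *\<^sub>R w) /\<^sub>R 2 = ((a + b) / 2 * k) *\<^sub>R w" for k and w :: 'e
      by (simp add: distrib_right flip: scaleR_add_left)
    moreover have "(k *\<^sub>R v + k *\<^sub>R w) /\<^sub>R 2 = k *\<^sub>R ((v + w) /\<^sub>R 2)" for k and v w :: 'e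
      by (simp add: mult.commute flip: scaleR_add_right)
    ultimately show "((glue \<tau> u a + glue \<tau> v b) /\<^sub>R 2) t = glue \<tau> ((u + v) /\<^sub>R 2) ((a + b) / 2) t"
      by (simp add: glue_def)
  qed
  show ?thesis
  proof
    have "?N (glue 1 0 1) powr p = 1"
      using glue_N[of 0 1 1] by simp
    then have "(?N (glue 1 0 1) powr p) powr (1 / p) = 1" by simp
    then have "?N (glue 1 0 1) = 1"
      using p M.Lp_norm_nonneg[OF p', of "glue 1 0 1"] by (simp add: powr_powr)
    then show "\<exists>x\<in>Lp_space ?M p. ?N x = 1"
      using glue_V[of 0 1 1] by blast
  next
    fix x y :: "real \<Rightarrow> 'e" and \<tau> a :: real
    assume xy: "x \<in> Lp_space ?M p" "y \<in> Lp_space ?M p" and \<tau>: "0 \<le> \<tau>" "\<tau> \<le> 1"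
    have V: "x - y \<in> Lp_space ?M p" "(x + y) /\<^sub>R 2 \<in> Lp_space ?M p" using xy by auto
    have "?N (glue \<tau> x 1) powr p = (1 - \<tau>) * ?N x powr p + \<tau> \<and>
      ?N (glue \<tau> y a) powr p = (1 - \<tau>) * ?N y powr p + \<tau> * \<bar>a\<bar> powr p \<and>
      ?N (glue \<tau> x 1 - glue \<tau> y a) powr p = (1 - \<tau>) * ?N (x - y) powr p + \<tau> * \<bar>1 - a\<bar> powr p \<and>
      ?N ((glue \<tau> x 1 + glue \<tau> y a) /\<^sub>R 2) powr p =
        (1 - \<tau>) * ?N ((x + y) /\<^sub>R 2) powr p + \<tau> * \<bar>(1 + a) / 2\<bar> powr p"
      unfolding glue_diff glue_mid glue_N[OF xy(1) \<tau>] glue_N[OF xy(2) \<tau>] glue_N[OF V(1) \<tau>] glue_N[OF V(2) \<tau>]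
      by simp
    then show "\<exists>x'\<in>Lp_space ?M p. \<exists>y'\<in>Lp_space ?M p. ?N x' powr p = (1 - \<tau>) * ?N x powr p + \<tau> \<and>
      ?N y' powr p = (1 - \<tau>) * ?N y powr p + \<tau> * \<bar>a\<bar> powr p \<and>
      ?N (x' - y') powr p = (1 - \<tau>) * ?N (x - y) powr p + \<tau> * \<bar>1 - a\<bar> powr p \<and>
      ?N ((x' + y') /\<^sub>R 2) powr p = (1 - \<tau>) * ?N ((x + y) /\<^sub>R 2) powr p + \<tau> * \<bar>(1 + a) / 2\<bar> powr p"
      using glue_V[OF xy(1)] glue_V[OF xy(2)] by blast
  qed
qed

section \<open>The Volterra operator\<close>

text \<open>Young's inequality after division by the two norms; if one of them is 0 the product
  vanishes almost everywhere.\<close>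

lemma (in complete_finite_measure) Holder:
  fixes u :: "'a \<Rightarrow> 'e::banach" and \<kappa> :: "'a \<Rightarrow> real"
  assumes p: "1 < p" and q: "1 < q" and pq: "1 / p + 1 / q = 1"
    and \<kappa>: "\<kappa> \<in> Lp_space M q" and u: "u \<in> Lp_space M p"
  shows "smeas (\<lambda>t. \<kappa> t *\<^sub>R u t)" "integrable M (\<lambda>t. norm (\<kappa> t *\<^sub>R u t))"
    "(\<integral>t. norm (\<kappa> t *\<^sub>R u t) \<partial>M) \<le> Lp_norm M q \<kappa> * Lp_norm M p u"
proof -
  have p': "1 \<le> p" and q': "1 \<le> q" using p q by auto
  note iu = LpD(2)[OF p' u] and i\<kappa> = LpD(2)[OF q' \<kappa>]
  show sm: "smeas (\<lambda>t. \<kappa> t *\<^sub>R u t)"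
    using LpD(1)[OF q' \<kappa>] LpD(1)[OF p' u] by (rule smeas_scaleR)
  have young: "norm (\<kappa> t *\<^sub>R u t) / (b * a) \<le> norm (u t) powr p / (p * a powr p) + norm (\<kappa> t) powr q / (q * b powr q)"
    if ab: "a > 0" "b > 0" for a b t
  proof -
    have "(norm (u t) / a) * (norm (\<kappa> t) / b) \<le> (norm (u t) / a) powr p / p + (norm (\<kappa> t) / b) powr q / q"
      using ab by (intro Youngs_inequality p q pq) auto
    then show ?thesis
      by (simp add: powr_divide mult.commute)
  qed
  have int_ab: "integrable M (\<lambda>t. norm (u t) powr p / (p * a powr p) + norm (\<kappa> t) powr q / (q * b powr q))" for a b
    using iu i\<kappa> by (intro Bochner_Integration.integrable_add integrable_divide)
  show int: "integrable M (\<lambda>t. norm (\<kappa> t *\<^sub>R u t))"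
  proof (rule Bochner_Integration.integrable_bound[OF int_ab[of 1 1] smeas_norm[OF sm]])
    show "AE t in M. norm (norm (\<kappa> t *\<^sub>R u t)) \<le> norm (norm (u t) powr p / (p * 1 powr p) + norm (\<kappa> t) powr q / (q * 1 powr q))"
    proof (rule AE_I2)
      fix t
      show "norm (norm (\<kappa> t *\<^sub>R u t)) \<le> norm (norm (u t) powr p / (p * 1 powr p) + norm (\<kappa> t) powr q / (q * 1 powr q))"
        using young[of 1 1 t] by (simp del: norm_scaleR)
    qed
  qed
  let ?a = "Lp_norm M p u" and ?b = "Lp_norm M q \<kappa>"
  show "(\<integral>t. norm (\<kappa> t *\<^sub>R u t) \<partial>M) \<le> ?b * ?a"
  proof (cases "?a = 0 \<or> ?b = 0")
    case True
    then have "AE t in M. norm (\<kappa> t *\<^sub>R u t) = 0"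
    proof
      assume "?a = 0"
      from Lp_norm_eq_0_AE[OF p' u this] show ?thesis by eventually_elim simp
    next
      assume "?b = 0"
      from Lp_norm_eq_0_AE[OF q' \<kappa> this] show ?thesis by eventually_elim simp
    qed
    then have "(\<integral>t. norm (\<kappa> t *\<^sub>R u t) \<partial>M) = 0" by (rule integral_eq_zero_AE)
    then show ?thesis using Lp_norm_nonneg[OF p', of u] Lp_norm_nonneg[OF q', of \<kappa>] by simp
  next
    case False
    then have ab: "?a > 0" "?b > 0"
      using Lp_norm_nonneg[OF p', of u] Lp_norm_nonneg[OF q', of \<kappa>] by auto
    have "(\<integral>t. norm (\<kappa> t *\<^sub>R u t) / (?b * ?a) \<partial>M) \<le>
        (\<integral>t. norm (u t) powr p / (p * ?a powr p) + norm (\<kappa> t) powr q / (q * ?b powr q) \<partial>M)"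
      using young[OF ab] by (intro integral_mono integrable_divide int int_ab)
    also have "\<dots> = (\<integral>t. norm (u t) powr p \<partial>M) / (p * ?a powr p) + (\<integral>t. norm (\<kappa> t) powr q \<partial>M) / (q * ?b powr q)"
      using iu i\<kappa> by simp
    also have "\<dots> = 1 / p + 1 / q"
      unfolding Lp_norm_powr[OF p', symmetric] Lp_norm_powr[OF q', symmetric] using ab by simp
    finally have "(\<integral>t. norm (\<kappa> t *\<^sub>R u t) \<partial>M) / (?b * ?a) \<le> 1" using pq by simp
    then show ?thesis using ab by (simp add: pos_divide_le_eq del: norm_scaleR)
  qed
qed

lemma strongly_measurable_restrict:
  fixes f :: "real \<Rightarrow> 'e::real_normed_vector"
  assumes f: "strongly_measurable (lebesgue_on {0..T}) UNIV norm f" and t: "t \<le> T"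
  shows "strongly_measurable (lebesgue_on {0..t}) UNIV norm f"
proof -
  interpret T: complete_finite_measure "lebesgue_on {0..T}" by (rule complete_finite_measure_interval)
  interpret t: complete_finite_measure "lebesgue_on {0..t}" by (rule complete_finite_measure_interval)
  have sub: "{0..t} \<subseteq> {0..T}" using t by auto
  obtain s where s: "\<And>n::nat. simple_function (lebesgue_on {0..T}) (s n)"
    "AE x in lebesgue_on {0..T}. (\<lambda>n. s n x) \<longlonglongrightarrow> f x"
    using f unfolding T.smeas_iff by blast
  have "simple_function (lebesgue_on {0..t}) (s n)" for n
    unfolding simple_function_def
  proof (intro conjI ballI)
    have "finite (s n ` {0..T})" using s(1)[of n] by (simp add: simple_function_def)
    then show "finite (s n ` space (lebesgue_on {0..t}))"
      using sub by (auto intro: finite_subset[of _ "s n ` {0..T}"])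
    fix y
    have "s n -` {y} \<inter> space (lebesgue_on {0..T}) \<in> sets (lebesgue_on {0..T})"
      using s(1) by (rule simple_functionD)
    then have "s n -` {y} \<inter> {0..T} \<in> sets lebesgue" by (simp add: sets_restrict_space_iff)
    then have "(s n -` {y} \<inter> {0..T}) \<inter> {0..t} \<in> sets lebesgue" by (rule sets.Int) simp
    moreover have "(s n -` {y} \<inter> {0..T}) \<inter> {0..t} = s n -` {y} \<inter> {0..t}" using sub by auto
    ultimately show "s n -` {y} \<inter> space (lebesgue_on {0..t}) \<in> sets (lebesgue_on {0..t})"
      by (simp add: sets_restrict_space_iff)
  qed
  moreover have "AE x in lebesgue_on {0..t}. (\<lambda>n. s n x) \<longlonglongrightarrow> f x"
  proof -
    have "AE x in lebesgue. x \<in> {0..T} \<longrightarrow> (\<lambda>n. s n x) \<longlonglongrightarrow> f x"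
      using s(2) by (simp add: AE_restrict_space_iff)
    then have "AE x in lebesgue. x \<in> {0..t} \<longrightarrow> (\<lambda>n. s n x) \<longlonglongrightarrow> f x"
      by eventually_elim (use sub in auto)
    then show ?thesis by (simp add: AE_restrict_space_iff)
  qed
  ultimately show ?thesis unfolding t.smeas_iff by blast
qed

lemma integrable_lebesgue_on_subinterval:
  fixes h :: "real \<Rightarrow> real"
  assumes h: "integrable (lebesgue_on {0..T}) h" and t: "t \<le> T"
  shows "integrable (lebesgue_on {0..t}) h"
proof -
  have "set_integrable lebesgue {0..T} h"
    using h by (simp add: integrable_restrict_space set_integrable_def)
  then have "set_integrable lebesgue {0..t} h"
    by (rule set_integrable_subset) (use t in auto)
  then show ?thesis by (simp add: integrable_restrict_space set_integrable_def)
qed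

text \<open>Moves the variable upper limit into the integrand, so that later integrals are all taken
  over the same measure. The two sides are compared through functionals.\<close>

lemma Bochner_integral_subinterval:
  fixes f :: "real \<Rightarrow> 'e::banach"
  assumes f: "strongly_measurable (lebesgue_on {0..T}) UNIV norm f"
    "integrable (lebesgue_on {0..T}) (\<lambda>s. norm (f s))" and t: "t \<le> T"
  shows "Bochner_integral (lebesgue_on {0..t}) f = Bochner_integral (lebesgue_on {0..T}) (\<lambda>s. indicator {0..t} s *\<^sub>R f s)"
proof (rule vector_eqI_functionals)
  fix \<phi> :: "'e \<Rightarrow> real" assume \<phi>: "bounded_linear \<phi>"
  interpret T: complete_finite_measure "lebesgue_on {0..T}" by (rule complete_finite_measure_interval)
  interpret t: complete_finite_measure "lebesgue_on {0..t}" by (rule complete_finite_measure_interval)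
  have sub: "{0..t} \<subseteq> {0..T}" using t by auto
  have mt: "{0..t} \<in> sets (lebesgue_on {0..T})" using sub by (simp add: sets_restrict_space_iff)
  have sm: "T.smeas (\<lambda>s. indicator {0..t} s *\<^sub>R f s)" using f(1) mt by (rule T.smeas_indicator)
  have int: "integrable (lebesgue_on {0..T}) (\<lambda>s. norm (indicator {0..t} s *\<^sub>R f s))"
    by (rule Bochner_Integration.integrable_bound[OF f(2) T.smeas_norm[OF sm]]) (auto simp: indicator_def)
  have "\<phi> (Bochner_integral (lebesgue_on {0..t}) f) = (\<integral>s. \<phi> (f s) \<partial>lebesgue_on {0..t})"
    by (rule t.Bochner_integral_functional[OF strongly_measurable_restrict[OF f(1) t]
      integrable_lebesgue_on_subinterval[OF f(2) t] \<phi>])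
  also have "\<dots> = (\<integral>s. (if s \<in> {0..t} then \<phi> (f s) else 0) \<partial>lebesgue_on {0..T})"
    using sub by (intro integral_restrict[symmetric]) auto
  also have "\<dots> = (\<integral>s. \<phi> (indicator {0..t} s *\<^sub>R f s) \<partial>lebesgue_on {0..T})"
    by (intro Bochner_Integration.integral_cong)
      (auto simp: indicator_def linear_simps(3)[OF \<phi>] linear_0[OF bounded_linear.linear[OF \<phi>]])
  also have "\<dots> = \<phi> (Bochner_integral (lebesgue_on {0..T}) (\<lambda>s. indicator {0..t} s *\<^sub>R f s))"
    by (rule T.Bochner_integral_functional[OF sm int \<phi>, symmetric])
  finally show "\<phi> (Bochner_integral (lebesgue_on {0..t}) f) =
    \<phi> (Bochner_integral (lebesgue_on {0..T}) (\<lambda>s. indicator {0..t} s *\<^sub>R f s))" .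
qed

locale Lp_interval =
  fixes T p q :: real
  assumes T: "0 < T" and p: "1 < p" and pq: "1 / p + 1 / q = 1"
begin

abbreviation "M \<equiv> lebesgue_on {0..T}"

lemma q: "1 < q"
proof -
  have "0 < 1 / p" "1 / p < 1" using p by simp_all
  then have "0 < 1 / q" "1 / q < 1" using pq by linarith+
  then show ?thesis by (simp add: pos_divide_less_eq)
qed

sublocale complete_finite_measure M by (rule complete_finite_measure_interval)

lemma p': "1 \<le> p" and q': "1 \<le> q" using p q by auto

text \<open>The Volterra integral with the kernel section \<kappa> detached from the upper limit t.
  It is continuous in t for fixed \<kappa> and Lipschitz in \<kappa> for fixed t; together these
  give measurability in time of the full operator.\<close>

definition W :: "(real \<Rightarrow> real) \<Rightarrow> real \<Rightarrow> (real \<Rightarrow> 'e::banach) \<Rightarrow> 'e" where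
  "W \<kappa> t u = Bochner_integral M (\<lambda>s. indicator {0..t} s *\<^sub>R (\<kappa> s *\<^sub>R u s))"

context
  fixes u :: "real \<Rightarrow> 'e::banach" and \<kappa> :: "real \<Rightarrow> real"
  assumes u: "u \<in> Lp_space M p" and \<kappa>: "\<kappa> \<in> Lp_space M q"
begin

lemma W_smeas: "smeas (\<lambda>s. indicator {0..t} s *\<^sub>R (\<kappa> s *\<^sub>R u s))"
proof -
  have "{0..t} \<inter> {0..T} \<in> sets M" by (simp add: sets_restrict_space_iff)
  then have "smeas (\<lambda>s. indicator ({0..t} \<inter> {0..T}) s *\<^sub>R (\<kappa> s *\<^sub>R u s))"
    using Holder(1)[OF p q pq \<kappa> u] by (rule smeas_indicator[rotated])
  then show ?thesis
    by (rule smeas_AE_cong) (auto simp: indicator_def intro!: AE_I2)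
qed

lemma W_integrable: "integrable M (\<lambda>s. norm (indicator {0..t} s *\<^sub>R (\<kappa> s *\<^sub>R u s)))"
  by (rule Bochner_Integration.integrable_bound[OF Holder(2)[OF p q pq \<kappa> u] smeas_norm[OF W_smeas]])
    (auto simp: indicator_def)

lemma W_functional:
  "bounded_linear \<phi> \<Longrightarrow> (\<phi> (W \<kappa> t u) :: real) = (\<integral>s. \<phi> (indicator {0..t} s *\<^sub>R (\<kappa> s *\<^sub>R u s)) \<partial>M)"
  unfolding W_def by (rule Bochner_integral_functional[OF W_smeas W_integrable])

lemma W_functional_integrable:
  "bounded_linear \<phi> \<Longrightarrow> integrable M (\<lambda>s. \<phi> (indicator {0..t} s *\<^sub>R (\<kappa> s *\<^sub>R u s)) :: real)"
  by (rule integrable_functional[OF W_smeas W_integrable])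

lemma norm_W_le: "norm (W \<kappa> t u) \<le> Lp_norm M q \<kappa> * Lp_norm M p u"
proof -
  have "norm (W \<kappa> t u) \<le> (\<integral>s. norm (indicator {0..t} s *\<^sub>R (\<kappa> s *\<^sub>R u s)) \<partial>M)"
    unfolding W_def by (rule norm_Bochner_integral_le[OF W_smeas W_integrable])
  also have "\<dots> \<le> (\<integral>s. norm (\<kappa> s *\<^sub>R u s) \<partial>M)"
    by (intro integral_mono W_integrable Holder(2)[OF p q pq \<kappa> u]) (auto simp: indicator_def)
  also have "\<dots> \<le> Lp_norm M q \<kappa> * Lp_norm M p u"
    by (rule Holder(3)[OF p q pq \<kappa> u])
  finally show ?thesis .
qed

lemma W_eq: "t \<le> T \<Longrightarrow> Bochner_integral (lebesgue_on {0..t}) (\<lambda>s. \<kappa> s *\<^sub>R u s) = W \<kappa> t u"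
  unfolding W_def by (rule Bochner_integral_subinterval[OF Holder(1,2)[OF p q pq \<kappa> u]])

text \<open>At every s other than t the indicators of [0, x n] eventually agree with that of [0, t];
  dominated convergence does the rest.\<close>

lemma W_tendsto:
  assumes x: "x \<longlonglongrightarrow> t"
  shows "(\<lambda>n. W \<kappa> (x n) u) \<longlonglongrightarrow> W \<kappa> t u"
proof -
  let ?d = "\<lambda>n s. indicator {0..x n} s *\<^sub>R (\<kappa> s *\<^sub>R u s) - indicator {0..t} s *\<^sub>R (\<kappa> s *\<^sub>R u s)"
  have dm: "smeas (?d n)" for n by (rule smeas_diff[OF W_smeas W_smeas])
  have le: "norm (?d n s) \<le> norm (\<kappa> s *\<^sub>R u s)" for n s
    by (auto simp: indicator_def)
  have di: "integrable M (\<lambda>s. norm (?d n s))" for n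
    by (rule Bochner_Integration.integrable_bound[OF Holder(2)[OF p q pq \<kappa> u] smeas_norm[OF dm]]) (use le in auto)
  have eq: "W \<kappa> (x n) u - W \<kappa> t u = Bochner_integral M (?d n)" for n
  proof (rule vector_eqI_functionals)
    fix \<phi> :: "'e \<Rightarrow> real" assume \<phi>: "bounded_linear \<phi>"
    note diff = linear_diff[OF bounded_linear.linear[OF \<phi>]]
    show "\<phi> (W \<kappa> (x n) u - W \<kappa> t u) = \<phi> (Bochner_integral M (?d n))"
      unfolding diff Bochner_integral_functional[OF dm di \<phi>] W_functional[OF \<phi>]
      by (rule Bochner_Integration.integral_diff[OF W_functional_integrable[OF \<phi>] W_functional_integrable[OF \<phi>], symmetric])
  qed
  have ae: "AE s in M. s \<noteq> t"
  proof -
    have "AE s in lebesgue. s \<noteq> t"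
      by (intro AE_completion) (rule AE_lborel_singleton)
    then have "AE s in lebesgue. s \<in> {0..T} \<longrightarrow> s \<noteq> t" by eventually_elim simp
    then show ?thesis by (simp add: AE_restrict_space_iff)
  qed
  have "(\<lambda>n. \<integral>s. norm (?d n s) \<partial>M) \<longlonglongrightarrow> (\<integral>s. 0 \<partial>M)"
  proof (rule integral_dominated_convergence[where w = "\<lambda>s. norm (\<kappa> s *\<^sub>R u s)"])
    show "AE s in M. (\<lambda>n. norm (?d n s)) \<longlonglongrightarrow> 0"
      using ae
    proof eventually_elim
      case (elim s)
      have "\<forall>\<^sub>F n in sequentially. s \<le> x n \<longleftrightarrow> s \<le> t"
      proof (cases "s < t")
        case True
        from order_tendstoD(1)[OF x this] show ?thesis by eventually_elim (use True in auto)
      next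
        case False
        with elim have "t < s" by simp
        from order_tendstoD(2)[OF x this] show ?thesis by eventually_elim (use \<open>t < s\<close> in auto)
      qed
      then have "\<forall>\<^sub>F n in sequentially. norm (?d n s) = 0"
        by eventually_elim (auto simp: indicator_def)
      then show ?case by (rule tendsto_eventually)
    qed
  qed (use Holder(2)[OF p q pq \<kappa> u] smeas_norm[OF dm] le in auto)
  then have lim: "(\<lambda>n. \<integral>s. norm (?d n s) \<partial>M) \<longlonglongrightarrow> 0" by simp
  have "(\<lambda>n. W \<kappa> (x n) u - W \<kappa> t u) \<longlonglongrightarrow> 0"
    by (rule Lim_null_comparison[OF _ lim])
      (use norm_Bochner_integral_le[OF dm di] eq in \<open>auto intro!: always_eventually\<close>)
  then show ?thesis by (rule LIM_zero_cancel)
qed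

lemma W_smeas_time: "smeas (\<lambda>t. W \<kappa> t u)"
proof -
  have "(\<lambda>t. t) \<in> borel_measurable M"
    using id_borel_measurable_lebesgue_on[of "{0..T}"] by (simp add: id_def)
  from borel_measurable_implies_sequence_metric[OF this, of 0]
  obtain F where F: "\<forall>i. simple_function M (F i)" "\<forall>t\<in>space M. (\<lambda>i. F i t) \<longlonglongrightarrow> t" by blast
  have 1: "simple_function M (\<lambda>t. W \<kappa> (F i t) u)" for i
    by (rule simple_function_compose1[where g = "\<lambda>t. W \<kappa> t u"]) (use F(1) in blast)
  have 2: "AE t in M. (\<lambda>i. W \<kappa> (F i t) u) \<longlonglongrightarrow> W \<kappa> t u"
    by (rule AE_I2) (use F(2) W_tendsto in blast)
  show ?thesis
    unfolding smeas_iff by (intro exI[of _ "\<lambda>i t. W \<kappa> (F i t) u"] conjI allI 1 2)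
qed

end

lemma W_diff_kernel:
  fixes u :: "real \<Rightarrow> 'e::banach"
  assumes u: "u \<in> Lp_space M p" and \<kappa>: "\<kappa> \<in> Lp_space M q" and \<kappa>': "\<kappa>' \<in> Lp_space M q"
  shows "norm (W \<kappa> t u - W \<kappa>' t u) \<le> Lp_norm M q (\<kappa> - \<kappa>') * Lp_norm M p u"
proof -
  have d: "\<kappa> - \<kappa>' \<in> Lp_space M q" using \<kappa> \<kappa>' by (rule Lp_diff[OF q'])
  have "W \<kappa> t u - W \<kappa>' t u = W (\<kappa> - \<kappa>') t u"
  proof (rule vector_eqI_functionals)
    fix \<phi> :: "'e \<Rightarrow> real" assume \<phi>: "bounded_linear \<phi>"
    note lin = bounded_linear.linear[OF \<phi>]
    show "\<phi> (W \<kappa> t u - W \<kappa>' t u) = \<phi> (W (\<kappa> - \<kappa>') t u)"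
      unfolding linear_diff[OF lin] W_functional[OF u \<kappa> \<phi>] W_functional[OF u \<kappa>' \<phi>] W_functional[OF u d \<phi>]
        Bochner_Integration.integral_diff[OF W_functional_integrable[OF u \<kappa> \<phi>] W_functional_integrable[OF u \<kappa>' \<phi>], symmetric]
      by (simp add: scaleR_diff_left scaleR_diff_right linear_diff[OF lin])
  qed
  then show ?thesis using norm_W_le[OF u d] by simp
qed

text \<open>By Hoelder's inequality the integral at a fixed time is bounded on L^p, so weak
  convergence in L^p implies weak convergence in E of the values at this time.\<close>

lemma W_bounded_functional:
  assumes \<kappa>: "\<kappa> \<in> Lp_space M q" and \<phi>: "bounded_linear (\<phi> :: 'e::banach \<Rightarrow> real)"
  shows "bounded_functional (Lp_space M p) (Lp_norm M p) (\<lambda>u :: real \<Rightarrow> 'e. \<phi> (W \<kappa> t u))"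
  unfolding bounded_functional_def
proof (intro conjI ballI allI)
  note lin = bounded_linear.linear[OF \<phi>]
  fix u v :: "real \<Rightarrow> 'e" assume u: "u \<in> Lp_space M p" and v: "v \<in> Lp_space M p"
  show "\<phi> (W \<kappa> t (u + v)) = \<phi> (W \<kappa> t u) + \<phi> (W \<kappa> t v)"
    unfolding W_functional[OF u \<kappa> \<phi>] W_functional[OF v \<kappa> \<phi>] W_functional[OF Lp_add[OF p' u v] \<kappa> \<phi>]
      Bochner_Integration.integral_add[OF W_functional_integrable[OF u \<kappa> \<phi>] W_functional_integrable[OF v \<kappa> \<phi>], symmetric]
    by (simp add: scaleR_add_right linear_add[OF lin])
next
  note lin = bounded_linear.linear[OF \<phi>]
  fix c and u :: "real \<Rightarrow> 'e" assume u: "u \<in> Lp_space M p"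
  have "(\<integral>s. \<phi> (indicator {0..t} s *\<^sub>R (\<kappa> s *\<^sub>R (c *\<^sub>R u) s)) \<partial>M) = (\<integral>s. c * \<phi> (indicator {0..t} s *\<^sub>R (\<kappa> s *\<^sub>R u s)) \<partial>M)"
    by (intro Bochner_Integration.integral_cong refl) (simp add: linear_scale[OF lin])
  then show "\<phi> (W \<kappa> t (c *\<^sub>R u)) = c * \<phi> (W \<kappa> t u)"
    unfolding W_functional[OF u \<kappa> \<phi>] W_functional[OF Lp_scaleR[OF p' u] \<kappa> \<phi>] by simp
next
  obtain K where K: "K > 0" "\<And>x. norm (\<phi> x) \<le> norm x * K"
    using bounded_linear.pos_bounded[OF \<phi>] by blast
  have "\<bar>\<phi> (W \<kappa> t u)\<bar> \<le> (Lp_norm M q \<kappa> * K) * Lp_norm M p u" if u: "u \<in> Lp_space M p" for u :: "real \<Rightarrow> 'e"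
  proof -
    have "\<bar>\<phi> (W \<kappa> t u)\<bar> \<le> norm (W \<kappa> t u) * K" using K(2)[of "W \<kappa> t u"] by simp
    also have "\<dots> \<le> (Lp_norm M q \<kappa> * Lp_norm M p u) * K"
      using K(1) norm_W_le[OF u \<kappa>] by (intro mult_right_mono) auto
    finally show ?thesis by (simp add: ac_simps)
  qed
  then show "\<exists>K. \<forall>u\<in>Lp_space M p. \<bar>\<phi> (W \<kappa> t (u :: real \<Rightarrow> 'e))\<bar> \<le> K * Lp_norm M p u" by blast
qed

text \<open>The kernel is approximated by functions of time with finitely many values in L^q. For
  each value the integral is continuous in t, and a finite sum over level sets is measurable;
  convergence of the kernel sections in L^q gives convergence of the integrals.\<close>

lemma Volterra_smeas:
  fixes u :: "real \<Rightarrow> 'e::banach"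
  assumes u: "u \<in> Lp_space M p" and k: "strongly_measurable M (Lp_space M q) (Lp_norm M q) k"
  shows "smeas (Volterra k u)"
proof -
  obtain s where s: "\<And>n::nat. simple_function M (s n)" "\<And>n. s n ` space M \<subseteq> Lp_space M q"
    "AE t in M. (\<lambda>n. Lp_norm M q (s n t - k t)) \<longlonglongrightarrow> 0"
    and kV: "AE t in M. k t \<in> Lp_space M q"
    using k unfolding strongly_measurable_def by blast
  have "smeas (\<lambda>t. W (s n t) t u)" for n
  proof -
    let ?R = "s n ` space M"
    have fin: "finite ?R" using s(1) by (rule simple_functionD)
    have "smeas (\<lambda>t. \<Sum>\<kappa>\<in>?R. indicator (s n -` {\<kappa>} \<inter> space M) t *\<^sub>R W \<kappa> t u)"
      using s(2)[of n] by (intro smeas_sum smeas_indicator W_smeas_time u simple_functionD(2)[OF s(1)]) auto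
    moreover have "AE t in M. (\<Sum>\<kappa>\<in>?R. indicator (s n -` {\<kappa>} \<inter> space M) t *\<^sub>R W \<kappa> t u) = W (s n t) t u"
    proof (rule AE_I2)
      fix t assume t: "t \<in> space M"
      have "(\<Sum>\<kappa>\<in>?R. indicator (s n -` {\<kappa>} \<inter> space M) t *\<^sub>R W \<kappa> t u) = (\<Sum>\<kappa>\<in>?R. if \<kappa> = s n t then W \<kappa> t u else 0)"
        using t by (intro sum.cong) (auto simp: indicator_def)
      also have "\<dots> = W (s n t) t u" using fin t by simp
      finally show "(\<Sum>\<kappa>\<in>?R. indicator (s n -` {\<kappa>} \<inter> space M) t *\<^sub>R W \<kappa> t u) = W (s n t) t u" .
    qed
    ultimately show ?thesis by (rule smeas_AE_cong)
  qed
  moreover have "AE t in M. (\<lambda>n. W (s n t) t u) \<longlonglongrightarrow> Volterra k u t"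
    using s(3) kV AE_space
  proof eventually_elim
    case (elim t)
    have sV: "s n t \<in> Lp_space M q" for n using s(2)[of n] elim(3) by auto
    have "(\<lambda>n. W (s n t) t u - W (k t) t u) \<longlonglongrightarrow> 0"
    proof (rule Lim_null_comparison)
      show "\<forall>\<^sub>F n in sequentially. norm (W (s n t) t u - W (k t) t u) \<le> Lp_norm M q (s n t - k t) * Lp_norm M p u"
        using W_diff_kernel[OF u sV elim(2)] by (intro always_eventually allI)
      show "(\<lambda>n. Lp_norm M q (s n t - k t) * Lp_norm M p u) \<longlonglongrightarrow> 0"
        using tendsto_mult[OF elim(1) tendsto_const[of "Lp_norm M p u"]] by simp
    qed
    then have "(\<lambda>n. W (s n t) t u) \<longlonglongrightarrow> W (k t) t u" by (rule LIM_zero_cancel)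
    moreover have "Volterra k u t = W (k t) t u"
      unfolding Volterra_def using elim(3) by (intro W_eq u elim(2)) simp
    ultimately show ?case by simp
  qed
  ultimately show ?thesis by (rule smeas_LIMSEQ)
qed

end


text \<open>The countably many bounds that exceed the infimum by 1/(n+1) hold simultaneously almost
  everywhere.\<close>

lemma (in complete_finite_measure) Linf_norm_AE:
  assumes k: "k \<in> Linf_space M V N" and N: "\<And>x. 0 \<le> N x"
  shows "0 \<le> Linf_norm M N k" "AE t in M. N (k t) \<le> Linf_norm M N k"
proof -
  let ?A = "{c. 0 \<le> c \<and> (AE t in M. N (k t) \<le> c)}"
  obtain c where c: "AE t in M. N (k t) \<le> c" using k by (auto simp: Linf_space_def)
  then have "AE t in M. N (k t) \<le> max 0 c" by eventually_elim simp
  then have ne: "?A \<noteq> {}" by (auto intro!: exI[of _ "max 0 c"])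
  show "0 \<le> Linf_norm M N k" unfolding Linf_norm_def using ne by (intro cInf_greatest) auto
  have "AE t in M. N (k t) \<le> Linf_norm M N k + inverse (real (Suc n))" for n
  proof -
    obtain a where "a \<in> ?A" "a < Linf_norm M N k + inverse (real (Suc n))"
      using cInf_lessD[OF ne, of "Linf_norm M N k + inverse (real (Suc n))"] by (auto simp: Linf_norm_def)
    then show ?thesis by (auto elim!: eventually_mono)
  qed
  then have "AE t in M. \<forall>n. N (k t) \<le> Linf_norm M N k + inverse (real (Suc n))"
    by (simp add: AE_all_countable)
  then show "AE t in M. N (k t) \<le> Linf_norm M N k"
  proof eventually_elim
    case (elim t)
    have "(\<lambda>n. Linf_norm M N k + inverse (real (Suc n))) \<longlonglongrightarrow> Linf_norm M N k + 0"
      by (intro tendsto_intros LIMSEQ_inverse_real_of_nat)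
    then show ?case using LIMSEQ_le_const[of _ "Linf_norm M N k + 0" "N (k t)"] elim by simp
  qed
qed

lemma (in complete_finite_measure) Lp_norm_mono:
  fixes w :: "'a \<Rightarrow> 'b::banach" and G :: "'a \<Rightarrow> real"
  assumes p: "1 \<le> p" and w: "smeas w" and G: "G \<in> Lp_space M p" and c: "0 \<le> c"
    and le: "AE t in M. norm (w t) \<le> c * \<bar>G t\<bar>"
  shows "w \<in> Lp_space M p" "Lp_norm M p w \<le> c * Lp_norm M p G"
proof -
  have int: "integrable M (\<lambda>t. (c * \<bar>G t\<bar>) powr p)"
    using LpD(2)[OF p G] by (simp add: powr_mult)
  show wL: "w \<in> Lp_space M p" using p w int le by (rule Lp_dominated)
  have "(\<integral>t. norm (w t) powr p \<partial>M) \<le> (\<integral>t. (c * \<bar>G t\<bar>) powr p \<partial>M)"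
  proof (rule integral_mono_AE[OF LpD(2)[OF p wL] int])
    show "AE t in M. norm (w t) powr p \<le> (c * \<bar>G t\<bar>) powr p"
      using le by eventually_elim (use p in \<open>auto intro: powr_mono2\<close>)
  qed
  also have "\<dots> = c powr p * Lp_norm M p G powr p"
    unfolding Lp_norm_powr[OF p] by (simp add: powr_mult)
  also have "\<dots> = (c * Lp_norm M p G) powr p" by (simp add: powr_mult)
  finally show "Lp_norm M p w \<le> c * Lp_norm M p G"
    using c Lp_norm_nonneg[OF p, of G] by (subst Lp_norm_le_iff[OF p]) auto
qed

section \<open>The Volterra equation\<close>

locale Volterra_superposition = Lp_interval +
  fixes k :: "real \<Rightarrow> real \<Rightarrow> real" and \<Phi> :: "real \<Rightarrow> 'e::banach \<Rightarrow> 'e" and G \<psi> :: "real \<Rightarrow> real" and C :: real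
  assumes E: "uniformly_convex (UNIV :: 'e set) norm"
    and k: "k \<in> Linf_space M (Lp_space M q) (Lp_norm M q)"
    and C_def: "C = Linf_norm M (Lp_norm M q) k"
    and \<Phi>: "weak_Caratheodory M \<Phi>"
    and G: "G \<in> Lp_space M p"
    and \<psi>_nonneg: "\<And>r. 0 \<le> r \<Longrightarrow> 0 \<le> \<psi> r"
    and \<psi>_mono: "mono_on {0..} \<psi>"
    and \<Phi>_bound: "AE t in M. \<forall>x. norm (\<Phi> t x) \<le> G t * \<psi> (norm x)"
begin

definition F :: "(real \<Rightarrow> 'e) \<Rightarrow> real \<Rightarrow> 'e" where
  "F u t = \<Phi> t (Volterra k u t)"

lemma C: "0 \<le> C" "AE t in M. Lp_norm M q (k t) \<le> C"
  unfolding C_def using Linf_norm_AE[OF k Lp_norm_nonneg[OF q']] by auto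

lemma k_Lp: "AE t in M. k t \<in> Lp_space M q"
  using k by (auto simp: Linf_space_def strongly_measurable_def)

lemma Volterra_eq_W:
  assumes "u \<in> Lp_space M p" "k t \<in> Lp_space M q" "t \<le> T"
  shows "Volterra k u t = W (k t) t (u :: real \<Rightarrow> 'e)"
  unfolding Volterra_def using assms by (intro W_eq)

lemma norm_Volterra_le:
  fixes u :: "real \<Rightarrow> 'e"
  assumes u: "u \<in> Lp_space M p"
  shows "AE t in M. norm (Volterra k u t) \<le> C * Lp_norm M p u"
  using C(2) k_Lp AE_space
proof eventually_elim
  case (elim t)
  have "norm (W (k t) t u) \<le> Lp_norm M q (k t) * Lp_norm M p u"
    using norm_W_le[OF u elim(2)] .
  also have "\<dots> \<le> C * Lp_norm M p u"
    using elim(1) Lp_norm_nonneg[OF p'] by (intro mult_right_mono)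
  finally show ?case using Volterra_eq_W[OF u elim(2)] elim(3) by simp
qed

lemma \<Phi>_le:
  assumes "AE t in M. norm (v t) \<le> c"
  shows "AE t in M. norm (\<Phi> t (v t)) \<le> \<psi> c * \<bar>G t\<bar>"
  using assms \<Phi>_bound
proof eventually_elim
  case (elim t)
  have "0 \<le> c" using elim(1) norm_ge_zero[of "v t"] by linarith
  then have "\<psi> (norm (v t)) \<le> \<psi> c" using \<psi>_mono elim(1) by (auto simp: mono_on_def)
  have "norm (\<Phi> t (v t)) \<le> G t * \<psi> (norm (v t))" using elim(2) by blast
  also have "\<dots> \<le> \<bar>G t\<bar> * \<psi> (norm (v t))"
    using \<psi>_nonneg by (intro mult_right_mono) auto
  also have "\<dots> \<le> \<bar>G t\<bar> * \<psi> c"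
    using \<open>\<psi> (norm (v t)) \<le> \<psi> c\<close> by (intro mult_left_mono) auto
  finally show ?case by (simp add: mult.commute)
qed

lemma \<Phi>_simple_smeas:
  assumes s: "simple_function M s"
  shows "smeas (\<lambda>t. \<Phi> t (s t))"
proof -
  have fin: "finite (s ` space M)" using s by (rule simple_functionD)
  have \<Phi>x: "smeas (\<lambda>t. \<Phi> t x)" for x using \<Phi> by (simp add: weak_Caratheodory_def)
  have "smeas (\<lambda>t. \<Sum>x\<in>s ` space M. indicator (s -` {x} \<inter> space M) t *\<^sub>R \<Phi> t x)"
    by (intro smeas_sum smeas_indicator \<Phi>x simple_functionD(2)[OF s])
  moreover have "AE t in M. (\<Sum>x\<in>s ` space M. indicator (s -` {x} \<inter> space M) t *\<^sub>R \<Phi> t x) = \<Phi> t (s t)"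
  proof (rule AE_I2)
    fix t assume t: "t \<in> space M"
    have "(\<Sum>x\<in>s ` space M. indicator (s -` {x} \<inter> space M) t *\<^sub>R \<Phi> t x) = (\<Sum>x\<in>s ` space M. if x = s t then \<Phi> t x else 0)"
      using t by (intro sum.cong) (auto simp: indicator_def)
    also have "\<dots> = \<Phi> t (s t)" using fin t by simp
    finally show "(\<Sum>x\<in>s ` space M. indicator (s -` {x} \<inter> space M) t *\<^sub>R \<Phi> t x) = \<Phi> t (s t)" .
  qed
  ultimately show ?thesis by (rule smeas_AE_cong)
qed

lemma \<Phi>_AE: "AE t in M. seq_weakly_continuous UNIV norm (\<Phi> t)"
  using \<Phi> by (simp add: weak_Caratheodory_def)

text \<open>Along simple functions approximating the Volterra integral the values of \<Phi> t
  converge merely weakly, so strong measurability of the limit is not immediate. The growth bound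
  keeps these values bounded in L^p, and a pointwise weak limit of such a sequence belongs to
  L^p.\<close>

lemma F_Lp:
  assumes u: "u \<in> Lp_space M p"
  shows "F u \<in> Lp_space M p"
proof -
  interpret E: seminormed_space "UNIV :: 'e set" norm by (rule seminormed_space_norm)
  \<comment> \<open>The factor 2 is that of the dominated approximation by simple functions.\<close>
  define c where "c = 2 * (C * Lp_norm M p u)"
  have c: "0 \<le> c" using C(1) Lp_norm_nonneg[OF p', of u] by (simp add: c_def)
  have v: "smeas (Volterra k u)"
    using u k by (intro Volterra_smeas) (auto simp: Linf_space_def)
  obtain s where s: "\<And>n::nat. simple_function M (s n)" "AE t in M. (\<lambda>n. s n t) \<longlonglongrightarrow> Volterra k u t"
    "\<And>n t. norm (s n t) \<le> 2 * norm (Volterra k u t)"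
    using smeas_dominated_approx[OF v] by blast
  have sc: "AE t in M. norm (s n t) \<le> c" for n
    using norm_Volterra_le[OF u]
  proof eventually_elim
    case (elim t)
    then show ?case using s(3)[of n t] by (simp add: c_def)
  qed
  have w: "(\<lambda>t. \<Phi> t (s n t)) \<in> Lp_space M p" "Lp_norm M p (\<lambda>t. \<Phi> t (s n t)) \<le> \<psi> c * Lp_norm M p G" for n
    using Lp_norm_mono[OF p' \<Phi>_simple_smeas[OF s(1)] G \<psi>_nonneg[OF c] \<Phi>_le[OF sc]] by auto
  have "AE t in M. weakly_converges UNIV norm (\<lambda>n. \<Phi> t (s n t)) (F u t)"
    using s(2) \<Phi>_AE
  proof eventually_elim
    case (elim t)
    have "(\<lambda>n. norm (s n t - Volterra k u t)) \<longlonglongrightarrow> 0"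
      using tendsto_norm_zero[OF LIM_zero[OF elim(1)]] .
    then have "weakly_converges UNIV norm (\<lambda>n. s n t) (Volterra k u t)"
      by (intro E.weakly_converges_strong) auto
    then show ?case using elim(2) unfolding seq_weakly_continuous_def F_def by blast
  qed
  from Lp_pointwise_weak_limit[OF E p w this]
  show ?thesis by (simp add: weakly_converges_def)
qed

lemma F_norm_le:
  assumes u: "u \<in> Lp_space M p" and R: "Lp_norm M p u \<le> R"
  shows "Lp_norm M p (F u) \<le> \<psi> (C * R) * Lp_norm M p G"
proof -
  have "AE t in M. norm (Volterra k u t) \<le> C * R"
    using norm_Volterra_le[OF u]
  proof eventually_elim
    case (elim t)
    then show ?case using mult_left_mono[OF R C(1)] by linarith
  qed
  then have le: "AE t in M. norm (F u t) \<le> \<psi> (C * R) * \<bar>G t\<bar>"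
    unfolding F_def by (rule \<Phi>_le)
  have "0 \<le> C * R" using C(1) R Lp_norm_nonneg[OF p', of u] by simp
  then show ?thesis
    using Lp_norm_mono(2)[OF p' LpD(1)[OF p' F_Lp[OF u]] G \<psi>_nonneg le] by simp
qed

text \<open>The Volterra integral turns weak convergence in L^p into weak convergence in E at almost
  every t, and \<Phi> t preserves it; boundedness in L^p leads back to weak convergence
  there.\<close>

lemma F_weakly_continuous:
  assumes x: "weakly_converges (Lp_space M p) (Lp_norm M p) x u" and R: "\<And>n. Lp_norm M p (x n) \<le> R"
  shows "weakly_converges (Lp_space M p) (Lp_norm M p) (\<lambda>n. F (x n)) (F u)"
proof (rule Lp_pointwise_weak_limit[OF E p])
  have xL: "x n \<in> Lp_space M p" and uL: "u \<in> Lp_space M p" for n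
    using x by (auto simp: weakly_converges_def)
  show "F (x n) \<in> Lp_space M p" for n using xL by (rule F_Lp)
  show "Lp_norm M p (F (x n)) \<le> \<psi> (C * R) * Lp_norm M p G" for n using xL R by (rule F_norm_le)
  show "AE t in M. weakly_converges UNIV norm (\<lambda>n. F (x n) t) (F u t)"
    using k_Lp \<Phi>_AE AE_space
  proof eventually_elim
    case (elim t)
    have t: "t \<le> T" using elim(3) by simp
    have "weakly_converges UNIV norm (\<lambda>n. Volterra k (x n) t) (Volterra k u t)"
      unfolding weakly_converges_def
    proof (intro conjI allI impI)
      fix \<phi> :: "'e \<Rightarrow> real" assume "bounded_functional UNIV norm \<phi>"
      then have "bounded_linear \<phi>" by (rule bounded_linear_functional)
      from W_bounded_functional[OF elim(1) this, of t]
      have "(\<lambda>n. \<phi> (W (k t) t (x n))) \<longlonglongrightarrow> \<phi> (W (k t) t u)"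
        using x by (auto simp: weakly_converges_def)
      then show "(\<lambda>n. \<phi> (Volterra k (x n) t)) \<longlonglongrightarrow> \<phi> (Volterra k u t)"
        by (simp add: Volterra_eq_W[OF xL elim(1) t] Volterra_eq_W[OF uL elim(1) t])
    qed auto
    then show ?case using elim(2) unfolding seq_weakly_continuous_def F_def by blast
  qed
qed

end

theorem theorem7p8:
  fixes f \<Phi> :: "real \<Rightarrow> 'e::banach \<Rightarrow> 'e"
    and k :: "real \<Rightarrow> real \<Rightarrow> real"
    and G \<psi> :: "real \<Rightarrow> real"
    and p q T C R :: real
  assumes E: "uniformly_convex (UNIV :: 'e set) norm"
    and p: "1 < p" and pq: "1 / p + 1 / q = 1" and T: "0 < T"
    and A1_meas: "\<And>x. strongly_measurable (lebesgue_on {0..T}) UNIV norm (\<lambda>t. f t x)"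
    and A1_Lp: "(\<lambda>t. f t 0) \<in> Lp_space (lebesgue_on {0..T}) p"
    and A1_bound: "\<And>t x. t \<in> {0..T} \<Longrightarrow> norm (f t x - f t 0) \<le> norm x"
    and A2: "k \<in> Linf_space (lebesgue_on {0..T})
               (Lp_space (lebesgue_on {0..T}) q) (Lp_norm (lebesgue_on {0..T}) q)"
    and C_def: "C = Linf_norm (lebesgue_on {0..T}) (Lp_norm (lebesgue_on {0..T}) q) k"
    and A3_Carath: "weak_Caratheodory (lebesgue_on {0..T}) \<Phi>"
    and A3_G: "G \<in> Lp_space (lebesgue_on {0..T}) p"
    and A3_psi_nonneg: "\<And>r. 0 \<le> r \<Longrightarrow> 0 \<le> \<psi> r"
    and A3_psi_mono: "mono_on {0..} \<psi>"
    and A3_psi_bdd: "locally_bounded_on {0..} \<psi>"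
    and A3_bound: "AE t in lebesgue_on {0..T}. \<forall>x. norm (\<Phi> t x) \<le> G t * \<psi> (norm x)"
    and A3_R: "R > Lp_norm (lebesgue_on {0..T}) p (\<lambda>t. f t 0)"
    and A3_R_bound: "Lp_norm (lebesgue_on {0..T}) p G * \<psi> (C * R)
               / (R - Lp_norm (lebesgue_on {0..T}) p (\<lambda>t. f t 0)) \<le> 1"
    and A4: "seq_weakly_continuous
               (Lp_space (lebesgue_on {0..T}) p) (Lp_norm (lebesgue_on {0..T}) p) (opB f)"
    and A5: "\<And>u. u \<in> Lp_space (lebesgue_on {0..T}) p \<Longrightarrow>
               Lp_norm (lebesgue_on {0..T}) p (opA f \<Phi> k u) \<noteq> 0 \<Longrightarrow>
               Lp_norm (lebesgue_on {0..T}) p (opB f u) \<noteq> 0 \<Longrightarrow>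
               Lp_norm (lebesgue_on {0..T}) p (opA f \<Phi> k u + opB f u) \<noteq> 0 \<Longrightarrow>
               vangle (Lp_norm (lebesgue_on {0..T}) p)
                   (opA f \<Phi> k u) (opA f \<Phi> k u + opB f u)
                 + vangle (Lp_norm (lebesgue_on {0..T}) p)
                   (opB f u) (opA f \<Phi> k u + opB f u)
               \<ge> epsilon0 (Lp_space (lebesgue_on {0..T}) p :: (real \<Rightarrow> 'e) set)
                   (Lp_norm (lebesgue_on {0..T}) p)"
  shows "\<exists>u \<in> Lp_space (lebesgue_on {0..T}) p.
           AE t in lebesgue_on {0..T}.
             u t = f t (u t) + \<Phi> t (Bochner_integral (lebesgue_on {0..t}) (\<lambda>s. k t s *\<^sub>R u s))"
proof (cases "\<exists>e :: 'e. e \<noteq> 0")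
  \<comment> \<open>In the zero space every function is a solution. It is set apart because glueing
    needs a unit vector.\<close>
  case False
  then have all0: "x = 0" for x :: 'e by blast
  have "(\<lambda>t. f t 0) \<in> Lp_space (lebesgue_on {0..T}) p" by (rule A1_Lp)
  then show ?thesis
    by (rule bexI[rotated]) (intro AE_I2, metis all0)
next
  case True
  then obtain e :: 'e where e: "e \<noteq> 0" by blast
  let ?M = "lebesgue_on {0..T}"
  interpret VS: Volterra_superposition T p q k \<Phi> G \<psi> C
    by unfold_locales (fact T p pq E A2 C_def A3_Carath A3_G A3_psi_nonneg A3_psi_mono A3_bound)+
  interpret L: glueing_space "Lp_space ?M p :: (real \<Rightarrow> 'e) set" "Lp_norm ?M p" p
    by (rule glueing_space_Lp[OF E p T e])
  let ?wc = "weakly_converges (Lp_space ?M p) (Lp_norm ?M p :: (real \<Rightarrow> 'e) \<Rightarrow> real)"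
  define f0 where "f0 = (\<lambda>t. f t 0)"
  have f0: "f0 \<in> Lp_space ?M p" unfolding f0_def by (rule A1_Lp)
  have A: "opA f \<Phi> k u = f0 + VS.F u" for u
    by (auto simp: opA_def f0_def VS.F_def fun_eq_iff)
  have AV: "opA f \<Phi> k u \<in> Lp_space ?M p" if "u \<in> Lp_space ?M p" for u
    unfolding A using f0 VS.F_Lp[OF that] by (rule L.in_V)
  have BV: "opB f u \<in> Lp_space ?M p" if "u \<in> Lp_space ?M p" for u
    using A4 that by (auto simp: seq_weakly_continuous_def)
  define S where "S u = opA f \<Phi> k u + opB f u" for u
  have R0: "0 < R" using A3_R VS.Lp_norm_nonneg[OF VS.p', of f0] by (simp add: f0_def)
  have "\<exists>u\<in>Lp_space ?M p. Lp_norm ?M p u \<le> R \<and> Lp_norm ?M p (S u - u) = 0"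
  proof (rule L.fixed_point)
    show "S u \<in> Lp_space ?M p" if "u \<in> Lp_space ?M p" for u :: "real \<Rightarrow> 'e"
      unfolding S_def using AV[OF that] BV[OF that] by (rule L.in_V)
  next
    fix x :: "nat \<Rightarrow> real \<Rightarrow> 'e" and g
    assume x: "?wc x g" and xR: "\<And>n. Lp_norm ?M p (x n) \<le> R"
    have F: "?wc (\<lambda>n. VS.F (x n)) (VS.F g)"
      using x xR by (rule VS.F_weakly_continuous)
    have B: "?wc (\<lambda>n. opB f (x n)) (opB f g)"
      using A4 x by (auto simp: seq_weakly_continuous_def)
    show "?wc (\<lambda>n. S (x n)) (S g)"
      unfolding weakly_converges_def
    proof (intro conjI allI impI)
      have V: "VS.F (x n) \<in> Lp_space ?M p" "VS.F g \<in> Lp_space ?M p" "opB f (x n) \<in> Lp_space ?M p" "opB f g \<in> Lp_space ?M p" for n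
        using F B by (auto simp: weakly_converges_def)
      show "S (x n) \<in> Lp_space ?M p" "S g \<in> Lp_space ?M p" for n
        using V f0 by (auto simp: S_def A)
      fix \<phi> :: "(real \<Rightarrow> 'e) \<Rightarrow> real" assume \<phi>: "bounded_functional (Lp_space ?M p) (Lp_norm ?M p) \<phi>"
      have "(\<lambda>n. \<phi> f0 + \<phi> (VS.F (x n)) + \<phi> (opB f (x n))) \<longlonglongrightarrow> \<phi> f0 + \<phi> (VS.F g) + \<phi> (opB f g)"
        using F B \<phi> by (intro tendsto_add tendsto_const) (auto simp: weakly_converges_def)
      then show "(\<lambda>n. \<phi> (S (x n))) \<longlonglongrightarrow> \<phi> (S g)"
        using V f0 by (simp add: S_def A L.bf_add[OF \<phi>])
    qed
  next
    fix u :: "real \<Rightarrow> 'e" assume u: "u \<in> Lp_space ?M p" and uR: "Lp_norm ?M p u \<le> R"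
    have "Lp_norm ?M p (opA f \<Phi> k u) \<le> Lp_norm ?M p f0 + Lp_norm ?M p (VS.F u)"
      unfolding A using f0 VS.F_Lp[OF u] by (rule L.triangle)
    also have "\<dots> \<le> Lp_norm ?M p f0 + \<psi> (C * R) * Lp_norm ?M p G"
      using VS.F_norm_le[OF u uR] by simp
    \<comment> \<open>The quotient condition on R multiplied out, its denominator being
      positive.\<close>
    also have "\<dots> \<le> R"
      using A3_R A3_R_bound by (simp add: f0_def pos_divide_le_eq mult.commute)
    finally have a: "Lp_norm ?M p (opA f \<Phi> k u) \<le> R" .
    \<comment> \<open>B does not increase the norm at any t, so it maps the ball of radius R into
      itself.\<close>
    have b: "Lp_norm ?M p (opB f u) \<le> R"
    proof -
      have nu: "(\<lambda>t. norm (u t)) \<in> Lp_space ?M p"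
        using VS.LpD[OF VS.p' u] by (simp add: Lp_space_def VS.smeas_real_iff VS.smeas_norm)
      have "AE t in ?M. norm (opB f u t) \<le> 1 * \<bar>norm (u t)\<bar>"
        using A1_bound by (intro AE_I2) (auto simp: opB_def)
      then have "Lp_norm ?M p (opB f u) \<le> 1 * Lp_norm ?M p (\<lambda>t. norm (u t))"
        using VS.LpD(1)[OF VS.p' BV[OF u]] nu by (intro VS.Lp_norm_mono(2)[OF VS.p']) auto
      then show ?thesis using uR by (simp add: Lp_norm_def)
    qed
    show "Lp_norm ?M p (S u) \<le> R"
      unfolding S_def using A5[OF u] by (intro L.norm_add_le_of_angles AV BV u a b)
  qed (use R0 in simp)
  then obtain u where u: "u \<in> Lp_space ?M p" "Lp_norm ?M p (S u - u) = 0" by blast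
  have "S u - u \<in> Lp_space ?M p"
    unfolding S_def using u(1) AV BV by (intro L.in_V)
  then have "AE t in ?M. (S u - u) t = 0"
    using u(2) by (rule VS.Lp_norm_eq_0_AE[OF VS.p'])
  \<comment> \<open>The terms \<open>f t 0\<close> in \<open>opA\<close> and \<open>opB\<close>
    cancel, so a fixed point of the sum solves the equation.\<close>
  then have "AE t in ?M. u t = f t (u t) + \<Phi> t (Bochner_integral (lebesgue_on {0..t}) (\<lambda>s. k t s *\<^sub>R u s))"
    by eventually_elim (simp add: S_def opA_def opB_def Volterra_def add.commute)
  with u(1) show ?thesis by blast
qed

end
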